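(* Let $n$ be a smooth, strictly positive real function on an open set $\Omega\subset\mathbb{C}$ and let $\phi:\Omega\to\mathbb{C}$ be a smooth solution of the eikonal equation $4\,\phi_z\,\phi_{\bar z}=n(z)^2$ in $\Omega$ (equivalently $\phi_x^2+\phi_y^2=n^2$). Let $\zeta(z)=\frac{2}{n}\,\phi_{\bar z}$, suppose that $z\mapsto\zeta(z)$ is a smooth diffeomorphism of $\Omega$ onto an open set $D\subset\mathbb{C}\setminus\{0\}$, and let $z=z(\zeta)$ be its inverse. Put $\ell(\zeta)=\log n(z(\zeta))$, $$a=1+\zeta\,\ell_\zeta,\quad b=-\frac1\zeta\,\ell_{\bar\zeta},\quad c=\frac1{\zeta^2}\,(1-\zeta\,\ell_\zeta),\quad d=\zeta\,\ell_{\bar\zeta},$$ assume $|a+c|^2-|b+d|^2\neq0$ in $D$, and set $$A_{11}=2\,\frac{\mathrm{Im}\bigl[(a+b)\,\overline{(c+d)}\bigr]}{|a+c|^2-|b+d|^2},\qquad A_{12}=\frac{|a+d|^2-|b+c|^2}{|a+c|^2-|b+d|^2},$$ $$A_{21}=\frac{|a-d|^2-|b-c|^2}{|a+c|^2-|b+d|^2},\qquad A_{22}=2\,\frac{\mathrm{Im}\bigl[\overline{(a-b)}\,(c-d)\bigr]}{|a+c|^2-|b+d|^2}.$$ Suppose that in $D$ $$4\,A_{12}\,A_{21}-(A_{11}+A_{22})^2>0,\qquad A_{12}>0,$$ and let $$\sigma=\frac{A_{12}-A_{21}-i\,(A_{11}+A_{22})}{A_{12}+A_{21}+\sqrt{4\,A_{12}\,A_{21}-(A_{11}+A_{22})^2}}.$$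 Then, locally in $D$, there exist a homeomorphism $\chi=\chi(\zeta)$ with $\chi_{\bar\zeta}=\sigma\,\chi_\zeta$, complex-valued functions $\kappa(\chi)$ (with $|\kappa|\neq1$) and $s(\chi)$, an analytic function $f(\chi)$, and a function $\Phi$ such that $\phi$ is parametrized by $$z=Z(\chi(\zeta)),\qquad \phi=\Phi(\zeta,\chi(\zeta)),$$ where $$Z(\chi)=\frac{e^{s(\chi)}f(\chi)+\kappa(\chi)\,\overline{f(\chi)\,e^{s(\chi)}}}{1-|\kappa(\chi)|^2},\qquad Z_{\bar\chi}=\kappa\,\overline{Z_\chi},$$ and $\phi$, regarded as a function of $\zeta$ (that is, $\zeta\mapsto\phi(z(\zeta))=\Phi(\zeta,\chi(\zeta))$), satisfies $$\phi_\zeta=\frac{N(\chi)}{2\,\zeta}\Bigl[(1+\zeta^2\,\overline{\kappa})\,Z_\chi\,\chi_\zeta+\overline{\sigma}\,(\kappa+\zeta^2)\,\overline{Z_\chi\,\chi_\zeta}\Bigr],$$ $$\phi_{\bar\zeta}=\frac{N(\chi)}{2\,\zeta}\Bigl[\sigma\,(1+\zeta^2\,\overline{\kappa})\,Z_\chi\,\chi_\zeta+(\kappa+\zeta^2)\,\overline{Z_\chi\,\chi_\zeta}\Bigr],$$ where $N=n\circ Z$, and $\chi$, $\kappa$, $Z_\chi$ are evaluated at $\chi=\chi(\zeta)$.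
   Context: For a complex variable $w=p+i\,q$, $\partial_w=\frac12(\partial_p-i\,\partial_q)$ and $\partial_{\bar w}=\frac12(\partial_p+i\,\partial_q)$; subscripts $z,\bar z,\zeta,\bar\zeta,\chi,\bar\chi$ denote the corresponding derivatives. Functions are assumed as regular as needed, and parametrizations are of local character. *)

theory Defs
  imports "HOL-Complex_Analysis.Complex_Analysis"
begin

text \<open>
  Partial derivatives along the real and imaginary axes, and the Wirtinger derivatives. They are
  only meaningful where \<open>f\<close> is real-differentiable (elsewhere
  \<^const>\<open>frechet_derivative\<close> is unspecified).
\<close>

definition partial_re :: "(complex \<Rightarrow> 'a::real_normed_vector) \<Rightarrow> complex \<Rightarrow> 'a" where
  "partial_re f w = frechet_derivative f (at w) 1"

definition partial_im :: "(complex \<Rightarrow> 'a::real_normed_vector) \<Rightarrow> complex \<Rightarrow> 'a" where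
  "partial_im f w = frechet_derivative f (at w) \<i>"

definition wd :: "(complex \<Rightarrow> complex) \<Rightarrow> complex \<Rightarrow> complex" where
  "wd f w = (partial_re f w - \<i> * partial_im f w) / 2"

definition wdbar :: "(complex \<Rightarrow> complex) \<Rightarrow> complex \<Rightarrow> complex" where
  "wdbar f w = (partial_re f w + \<i> * partial_im f w) / 2"

text \<open>Real regularity classes on an open subset of the plane; \<open>Ck_on k S f\<close> says that \<open>f\<close> is
  \<open>k\<close> times continuously differentiable in the real sense.\<close>

fun Ck_on :: "nat \<Rightarrow> complex set \<Rightarrow> (complex \<Rightarrow> 'a::real_normed_vector) \<Rightarrow> bool" where
  "Ck_on 0 S f \<longleftrightarrow> continuous_on S f"
| "Ck_on (Suc k) S f \<longleftrightarrow>
     (\<forall>w\<in>S. f differentiable (at w)) \<and> Ck_on k S (partial_re f) \<and> Ck_on k S (partial_im f)"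

definition smooth_on :: "complex set \<Rightarrow> (complex \<Rightarrow> 'a::real_normed_vector) \<Rightarrow> bool" where
  "smooth_on S f \<longleftrightarrow> (\<forall>k. Ck_on k S f)"

definition smooth_diffeomorphism ::
    "complex set \<Rightarrow> complex set \<Rightarrow> (complex \<Rightarrow> complex) \<Rightarrow> (complex \<Rightarrow> complex) \<Rightarrow> bool" where
  "smooth_diffeomorphism S T f g \<longleftrightarrow>
     open S \<and> open T \<and> homeomorphism S T f g \<and> smooth_on S f \<and> smooth_on T g"

text \<open>The coefficients \<open>a, b, c, d\<close> attached to \<open>\<ell> = log n(z(\<zeta>))\<close>, which is real-valued but is
  regarded as a complex function so that it has Wirtinger derivatives.\<close>

definition coeff_a :: "(complex \<Rightarrow> complex) \<Rightarrow> complex \<Rightarrow> complex" where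
  "coeff_a l w = 1 + w * wd l w"

definition coeff_b :: "(complex \<Rightarrow> complex) \<Rightarrow> complex \<Rightarrow> complex" where
  "coeff_b l w = - (1 / w) * wdbar l w"

definition coeff_c :: "(complex \<Rightarrow> complex) \<Rightarrow> complex \<Rightarrow> complex" where
  "coeff_c l w = 1 / w\<^sup>2 * (1 - w * wd l w)"

definition coeff_d :: "(complex \<Rightarrow> complex) \<Rightarrow> complex \<Rightarrow> complex" where
  "coeff_d l w = w * wdbar l w"

definition denom :: "complex \<Rightarrow> complex \<Rightarrow> complex \<Rightarrow> complex \<Rightarrow> real" where
  "denom a b c d = (cmod (a + c))\<^sup>2 - (cmod (b + d))\<^sup>2"

definition A11 :: "complex \<Rightarrow> complex \<Rightarrow> complex \<Rightarrow> complex \<Rightarrow> real" where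
  "A11 a b c d = 2 * (Im ((a + b) * cnj (c + d)) / denom a b c d)"

definition A12 :: "complex \<Rightarrow> complex \<Rightarrow> complex \<Rightarrow> complex \<Rightarrow> real" where
  "A12 a b c d = ((cmod (a + d))\<^sup>2 - (cmod (b + c))\<^sup>2) / denom a b c d"

definition A21 :: "complex \<Rightarrow> complex \<Rightarrow> complex \<Rightarrow> complex \<Rightarrow> real" where
  "A21 a b c d = ((cmod (a - d))\<^sup>2 - (cmod (b - c))\<^sup>2) / denom a b c d"

definition A22 :: "complex \<Rightarrow> complex \<Rightarrow> complex \<Rightarrow> complex \<Rightarrow> real" where
  "A22 a b c d = 2 * (Im (cnj (a - b) * (c - d)) / denom a b c d)"

definition beltrami_coeff :: "real \<Rightarrow> real \<Rightarrow> real \<Rightarrow> real \<Rightarrow> complex" where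
  "beltrami_coeff a11 a12 a21 a22 =
     (complex_of_real (a12 - a21) - \<i> * complex_of_real (a11 + a22))
     / complex_of_real (a12 + a21 + sqrt (4 * a12 * a21 - (a11 + a22)\<^sup>2))"

end

theory Submission
  imports Defs
begin

text \<open>
  Let \<open>p = wd zinv\<close> and \<open>q = wdbar zinv\<close> be the Wirtinger derivatives of the inverse map.  The
  eikonal equation and the definition of \<open>\<zeta>\<close> determine both first derivatives of \<open>\<phi>\<close>, namely
  \<open>n / (2 \<zeta>)\<close> and \<open>n \<zeta> / 2\<close>, so the equality of the mixed second derivatives of \<open>\<phi>\<close> becomes the
  real-linear equation \<open>a cnj p + b p = c q + d cnj q\<close> (\<open>hodograph_equation\<close>).  The inequalities on the
  \<open>A\<^sub>i\<^sub>j\<close> imply that this system is elliptic, and \<open>\<sigma>\<close> is the root of modulus less than one of its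
  characteristic equation (\<open>beltrami_coeff_characteristic\<close>).

  Let \<open>\<chi>\<close> be a local diffeomorphism with Beltrami coefficient \<open>\<sigma>\<close> and put \<open>Z = zinv \<circ> \<chi>\<^sup>-\<^sup>1\<close>.
  Up to a nonzero factor, the derivative \<open>Z\<^sub>\<chi>\<close> is \<open>p - cnj \<sigma> q\<close>.  If it vanished,
  ellipticity would force \<open>d = a \<sigma>\<close> and \<open>c = b cnj \<sigma>\<close>; but \<open>l\<close> is real, hence
  \<open>\<bar>d\<bar> = \<bar>\<zeta> l\<^sub>\<zeta>\<bar>\<close>, and these relations then give \<open>\<bar>\<sigma>\<bar> = 1\<close> (\<open>first_derivative_nonzero\<close>).  So \<open>\<kappa>\<close> can be
  defined as the quotient of the \<open>\<chi>\<close>-bar derivative of \<open>Z\<close> by \<open>cnj Z\<^sub>\<chi>\<close>; it is continuous, and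
  \<open>\<bar>\<kappa>\<bar> \<noteq> 1\<close> because \<open>Z\<close> has nonzero Jacobian.  With this \<open>\<kappa>\<close> the formulas for the derivatives of \<open>\<phi>\<close>
  are the chain rule.

  The representation of \<open>Z\<close> through \<open>s\<close> and \<open>f\<close> says that \<open>W = Z - \<kappa> cnj Z\<close> equals \<open>exp s * f\<close>.  Near a
  point where \<open>Z \<noteq> 0\<close> one takes \<open>f = 1\<close> and a logarithm of \<open>W\<close>.  At a zero \<open>x\<^sub>0\<close> of \<open>Z\<close>, the \<open>\<chi>\<close>-bar
  derivative of \<open>W\<close> cancels to first order, so that \<open>W / (x - x\<^sub>0)\<close> extends to a continuous function
  that does not vanish near \<open>x\<^sub>0\<close>, and \<open>f = x - x\<^sub>0\<close> works (\<open>similarity_representation\<close>).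

  What remains is the existence of \<open>\<chi>\<close>, that is, of isothermal coordinates for a smooth \<open>\<sigma>\<close>
  (\<open>local_beltrami_solution\<close>).  The equation is solved by a Neumann series in the algebra of absolutely
  convergent sums of waves: there the operator that sends a \<open>v\<close>-bar derivative to the
  \<open>v\<close> derivative of its primitive multiplies each coefficient by a number of modulus at most one
  (\<open>wiener_dbar_primitive\<close>), so the series converges as soon as the coefficient of the equation has norm
  less than one.  This is arranged by blowing up at the given point: on a small square,
  rescaled to side \<open>\<pi>\<close>, the function \<open>\<sigma>\<close> is a constant of modulus less than one plus a
  double cosine series with small coefficient sum (\<open>cosine_series_square\<close>).
\<close>

section \<open>Calculus of real differentiability classes\<close>

lemma partial_eq:
  assumes "(f has_derivative f') (at w)"
  shows "partial_re f w = f' 1" "partial_im f w = f' \<i>"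
  using frechet_derivative_at[OF assms] by (simp_all add: partial_re_def partial_im_def)

lemma linear_complex_expand:
  assumes "linear f" shows "f h = Re h *\<^sub>R f 1 + Im h *\<^sub>R f \<i>"
proof -
  have "f h = f (Re h *\<^sub>R 1 + Im h *\<^sub>R \<i>)" by (intro arg_cong[of _ _ f]) (simp add: complex_eq_iff)
  then show ?thesis using assms by (simp add: linear_add linear_scale)
qed

lemma differentiable_partials:
  assumes "f differentiable (at w)"
  shows "(f has_derivative (\<lambda>h. Re h *\<^sub>R partial_re f w + Im h *\<^sub>R partial_im f w)) (at w)"
proof -
  obtain f' where f': "(f has_derivative f') (at w)" using assms by (auto simp: differentiable_def)
  then have "f' = (\<lambda>h. Re h *\<^sub>R f' 1 + Im h *\<^sub>R f' \<i>)"
    using linear_complex_expand has_derivative_linear by blast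
  then show ?thesis using f' partial_eq[OF f'] by metis
qed

lemma Ck_on_SucD:
  assumes "Ck_on (Suc k) S f" "w \<in> S"
  shows "(f has_derivative (\<lambda>h. Re h *\<^sub>R partial_re f w + Im h *\<^sub>R partial_im f w)) (at w)"
  using assms by (intro differentiable_partials) auto

text \<open>
  On an open set the class depends only on the values there. This is what allows a function that is
  prescribed only on \<open>D\<close>, such as \<open>l\<close> or \<open>\<sigma>\<close>, to be replaced by the formula that defines it.
\<close>

lemma Ck_on_cong:
  assumes "open S" "Ck_on k S f" "\<And>w. w \<in> S \<Longrightarrow> f w = g w"
  shows "Ck_on k S g"
  using assms(2,3)
proof (induction k arbitrary: f g)
  case 0
  then show ?case by (simp cong: continuous_on_cong)
next
  case (Suc k)
  have der: "(g has_derivative (\<lambda>h. Re h *\<^sub>R partial_re f w + Im h *\<^sub>R partial_im f w)) (at w)" if "w \<in> S" for w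
    using has_derivative_transform_within_open[OF Ck_on_SucD[OF Suc.prems(1) that] assms(1) that] Suc.prems(2) by blast
  have "Ck_on k S (partial_re g)"
    by (rule Suc.IH[of "partial_re f"]) (use Suc.prems partial_eq[OF der] in auto)
  moreover have "Ck_on k S (partial_im g)"
    by (rule Suc.IH[of "partial_im f"]) (use Suc.prems partial_eq[OF der] in auto)
  ultimately show ?case using der by (auto simp: differentiable_def)
qed

text \<open>
  The closure properties that follow are inductions on \<open>k\<close> through this rule: the product or chain rule
  supplies \<open>f'\<close>, whose values at \<open>1\<close> and \<open>\<i>\<close> are again expressions covered by the induction hypothesis.
\<close>

lemma Ck_on_SucI:
  assumes "open S" "\<And>w. w \<in> S \<Longrightarrow> (f has_derivative f' w) (at w)"
    and "Ck_on k S (\<lambda>w. f' w 1)" "Ck_on k S (\<lambda>w. f' w \<i>)"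
  shows "Ck_on (Suc k) S f"
  using assms(2) Ck_on_cong[OF assms(1,3), of "partial_re f"] Ck_on_cong[OF assms(1,4), of "partial_im f"]
  by (auto simp: differentiable_def partial_eq[OF assms(2)])

lemma Ck_on_Suc_imp: "Ck_on (Suc k) S f \<Longrightarrow> Ck_on k S f"
proof (induction k arbitrary: f)
  case 0
  then show ?case
    by (auto intro!: continuous_at_imp_continuous_on differentiable_imp_continuous_within)
next
  case (Suc k)
  then show ?case by (metis Ck_on.simps(2))
qed

lemma Ck_on_imp_continuous_on: "Ck_on k S f \<Longrightarrow> continuous_on S f"
  by (induction k) (use Ck_on_Suc_imp in auto)

lemma Ck_on_const [intro]: "Ck_on k S (\<lambda>_. c)"
proof (induction k arbitrary: c)
  case (Suc k)
  have "partial_re (\<lambda>_. c) = (\<lambda>_. 0)" "partial_im (\<lambda>_. c) = (\<lambda>_. 0)"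
    by (auto simp: partial_eq[OF has_derivative_const])
  then show ?case using Suc by simp
qed simp

lemma Ck_on_ident [intro]: "open S \<Longrightarrow> Ck_on k S (\<lambda>w. w)"
  by (cases k) (auto simp del: Ck_on.simps(2) intro!: Ck_on_SucI[OF _ has_derivative_ident])

lemma Ck_on_add:
  assumes "open S" "Ck_on k S f" "Ck_on k S g"
  shows "Ck_on k S (\<lambda>w. f w + g w)"
  using assms(2,3)
proof (induction k arbitrary: f g)
  case 0
  then show ?case by (auto intro: continuous_intros)
next
  case (Suc k)
  note d = Suc.prems[THEN Ck_on_SucD]
  show ?case
    by (rule Ck_on_SucI[OF assms(1) has_derivative_add[OF d]]) (use Suc in auto)
qed

lemma Ck_on_bilinear:
  assumes bl: "bounded_bilinear B" and S: "open S" "Ck_on k S f" "Ck_on k S g"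
  shows "Ck_on k S (\<lambda>w. B (f w) (g w))"
  using S(2,3)
proof (induction k arbitrary: f g)
  case 0
  then show ?case by (auto intro: bounded_bilinear.continuous_on[OF bl])
next
  case (Suc k)
  note d = Suc.prems[THEN Ck_on_SucD]
  show ?case
    by (rule Ck_on_SucI[OF S(1) bounded_bilinear.FDERIV[OF bl d]])
       (use Suc.prems Suc.prems[THEN Ck_on_Suc_imp] in \<open>auto intro!: Ck_on_add[OF S(1)] Suc.IH\<close>)
qed

lemmas Ck_on_mult = Ck_on_bilinear[OF bounded_bilinear_mult]
lemmas Ck_on_scaleR = Ck_on_bilinear[OF bounded_bilinear_scaleR]

lemma Ck_on_bounded_linear:
  assumes bl: "bounded_linear L" and S: "open S" "Ck_on k S f"
  shows "Ck_on k S (\<lambda>w. L (f w))"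
  using S(2)
proof (induction k arbitrary: f)
  case 0
  then show ?case by (auto intro: bounded_linear.continuous_on[OF bl])
next
  case (Suc k)
  note d = Ck_on_SucD[OF Suc.prems]
  show ?case
    by (rule Ck_on_SucI[OF S(1) bounded_linear.has_derivative[OF bl d]])
       (use Suc in auto)
qed

lemmas Ck_on_Re = Ck_on_bounded_linear[OF bounded_linear_Re]
lemmas Ck_on_Im = Ck_on_bounded_linear[OF bounded_linear_Im]
lemmas Ck_on_cnj = Ck_on_bounded_linear[OF bounded_linear_cnj]
lemmas Ck_on_of_real = Ck_on_bounded_linear[OF bounded_linear_of_real]
lemmas Ck_on_minus = Ck_on_bounded_linear[OF bounded_linear_minus[OF bounded_linear_ident]]

lemma Ck_on_diff:
  assumes "open S" "Ck_on k S f" "Ck_on k S g"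
  shows "Ck_on k S (\<lambda>w. f w - g w)"
  using Ck_on_add[OF assms(1,2) Ck_on_minus[OF assms(1,3)]] by simp

lemma Ck_on_power2:
  fixes f :: "complex \<Rightarrow> 'a::real_normed_field"
  shows "open S \<Longrightarrow> Ck_on k S f \<Longrightarrow> Ck_on k S (\<lambda>w. (f w)\<^sup>2)"
  by (simp add: power2_eq_square Ck_on_mult)

lemma Ck_on_inverse:
  fixes f :: "complex \<Rightarrow> 'a::real_normed_field"
  assumes "open S" "Ck_on k S f" "\<And>w. w \<in> S \<Longrightarrow> f w \<noteq> 0"
  shows "Ck_on k S (\<lambda>w. inverse (f w))"
  using assms(2,3)
proof (induction k arbitrary: f)
  case 0
  then show ?case by (auto intro: continuous_intros)
next
  case (Suc k)
  note d = Ck_on_SucD[OF Suc.prems(1)]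
  show ?case
    by (rule Ck_on_SucI[OF assms(1) Deriv.has_derivative_inverse[OF Suc.prems(2) d]])
       (use Suc Ck_on_Suc_imp[OF Suc.prems(1)] in \<open>auto intro!: Ck_on_mult Ck_on_minus assms\<close>)
qed

lemma Ck_on_divide:
  fixes f :: "complex \<Rightarrow> 'a::real_normed_field"
  assumes "open S" "Ck_on k S f" "Ck_on k S g" "\<And>w. w \<in> S \<Longrightarrow> g w \<noteq> 0"
  shows "Ck_on k S (\<lambda>w. f w / g w)"
  using assms by (simp add: divide_inverse Ck_on_mult Ck_on_inverse)

lemma Ck_on_ln:
  fixes f :: "complex \<Rightarrow> real"
  assumes "open S" "Ck_on k S f" "\<And>w. w \<in> S \<Longrightarrow> f w > 0"
  shows "Ck_on k S (\<lambda>w. ln (f w))"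
proof (cases k)
  case 0
  have "\<forall>w\<in>S. f w \<noteq> 0" using assms(3) by force
  then show ?thesis using assms(2) 0 by (auto intro: continuous_on_ln)
next
  case (Suc m)
  note d = Ck_on_SucD[OF assms(2)[unfolded Suc]]
  have "Ck_on m S (\<lambda>w. inverse (f w))"
    using Ck_on_inverse[OF assms(1) Ck_on_Suc_imp[OF assms(2)[unfolded Suc]]] assms(3) by force
  then show ?thesis unfolding Suc
    by (intro Ck_on_SucI[OF assms(1) has_derivative_ln[OF assms(3) d]])
       (use assms Suc in \<open>auto intro!: Ck_on_mult simp: divide_inverse\<close>)
qed

lemma Ck_on_sqrt:
  fixes f :: "complex \<Rightarrow> real"
  assumes "open S" "Ck_on k S f" "\<And>w. w \<in> S \<Longrightarrow> f w > 0"
  shows "Ck_on k S (\<lambda>w. sqrt (f w))"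
  using assms(2)
proof (induction k)
  case 0
  then show ?case by (auto intro: continuous_intros)
next
  case (Suc k)
  have i: "Ck_on k S (\<lambda>w. inverse (sqrt (f w)))"
    using Ck_on_inverse[OF assms(1) Suc.IH[OF Ck_on_Suc_imp[OF Suc.prems]]] assms(3) by force
  have d: "((\<lambda>w. sqrt (f w)) has_derivative
     (\<lambda>h. (Re h *\<^sub>R partial_re f w + Im h *\<^sub>R partial_im f w) * (1/2 * inverse (sqrt (f w))))) (at w)"
    if "w \<in> S" for w
    using has_derivative_compose[OF Ck_on_SucD[OF Suc.prems that]
        DERIV_real_sqrt[OF assms(3)[OF that], unfolded has_field_derivative_def]]
    by (simp add: mult_ac)
  show ?case
    by (rule Ck_on_SucI[OF assms(1) d], assumption)
       (use Suc.prems Ck_on_mult[OF assms(1) _ Ck_on_mult[OF assms(1) Ck_on_const[of _ _ "1/2"] i]] in simp_all)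
qed

lemma Ck_on_compose:
  assumes "open S" "open T" "Ck_on k T f" "Ck_on k S g" "g ` S \<subseteq> T"
  shows "Ck_on k S (\<lambda>w. f (g w))"
  using assms(3,4)
proof (induction k arbitrary: f)
  case 0
  then show ?case using assms(5) by (auto intro: continuous_on_compose2)
next
  case (Suc k)
  have d: "((\<lambda>w. f (g w)) has_derivative (\<lambda>h. Re (Re h *\<^sub>R partial_re g w + Im h *\<^sub>R partial_im g w) *\<^sub>R partial_re f (g w)
     + Im (Re h *\<^sub>R partial_re g w + Im h *\<^sub>R partial_im g w) *\<^sub>R partial_im f (g w))) (at w)" if "w \<in> S" for w
  proof -
    have "g w \<in> T" using that assms(5) by auto
    from has_derivative_compose[OF Ck_on_SucD[OF Suc.prems(2) that] Ck_on_SucD[OF Suc.prems(1) this]]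
    show ?thesis .
  qed
  have "Ck_on k S (\<lambda>w. partial_re f (g w))" "Ck_on k S (\<lambda>w. partial_im f (g w))"
    using Suc.IH Suc.prems Ck_on_Suc_imp[OF Suc.prems(2)] by auto
  then show ?case using Suc.prems(2)
    by (intro Ck_on_SucI[OF assms(1) d]) (auto intro!: Ck_on_add Ck_on_scaleR Ck_on_Re Ck_on_Im assms)
qed

lemma wirtinger_eq:
  assumes "(f has_derivative (\<lambda>u. p * u + q * cnj u)) (at w)"
  shows "wd f w = p" "wdbar f w = q"
  unfolding wd_def wdbar_def partial_eq[OF assms] by (simp_all add: algebra_simps)

lemma wirtinger_has_derivative:
  assumes "f differentiable (at w)"
  shows "(f has_derivative (\<lambda>u. wd f w * u + wdbar f w * cnj u)) (at w)"
  by (rule has_derivative_eq_rhs[OF differentiable_partials[OF assms]])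
     (auto simp: fun_eq_iff wd_def wdbar_def complex_eq_iff field_simps)

section \<open>Equality of mixed derivatives\<close>

text \<open>
  The mean value theorem in \<open>x\<close> and then in \<open>y\<close>. The second difference on the left is symmetric in the
  two variables, so the roles of \<open>x\<close> and \<open>y\<close> can be exchanged without changing it.
\<close>

lemma mixed_difference:
  fixes g gx gxy :: "real \<Rightarrow> real \<Rightarrow> real"
  assumes "h > 0"
    and gx: "\<And>x y. x \<in> {0..h} \<Longrightarrow> y \<in> {0..h} \<Longrightarrow> ((\<lambda>x. g x y) has_real_derivative gx x y) (at x)"
    and gxy: "\<And>x y. x \<in> {0..h} \<Longrightarrow> y \<in> {0..h} \<Longrightarrow> ((\<lambda>y. gx x y) has_real_derivative gxy x y) (at y)"
  shows "\<exists>x\<in>{0..h}. \<exists>y\<in>{0..h}. g h h - g h 0 - g 0 h + g 0 0 = h\<^sup>2 * gxy x y"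
proof -
  have "((\<lambda>x. g x h - g x 0) has_real_derivative gx x h - gx x 0) (at x)" if "0 \<le> x" "x \<le> h" for x
    using that \<open>h > 0\<close> by (intro DERIV_diff gx) auto
  from MVT2[OF \<open>h > 0\<close> this]
  obtain x where x: "0 < x" "x < h" "(g h h - g h 0) - (g 0 h - g 0 0) = (h - 0) * (gx x h - gx x 0)"
    by auto
  obtain y where y: "0 < y" "y < h" "gx x h - gx x 0 = (h - 0) * gxy x y"
    using MVT2[OF \<open>h > 0\<close>, of "gx x" "gxy x"] gxy x by force
  show ?thesis using x y by (intro bexI[of _ x] bexI[of _ y]) (auto simp: power2_eq_square algebra_simps)
qed

text \<open>
  If the mixed derivatives differed at \<open>w\<close>, their values would be separated on a small square with corner
  \<open>w\<close>. But both represent, at some point of the square, the same second difference divided by the area.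
\<close>

lemma symmetric_partials_real:
  fixes g gx gy gxx gxy gyx gyy :: "complex \<Rightarrow> real"
  assumes S: "open S" "w \<in> S"
    and g: "\<And>z. z \<in> S \<Longrightarrow> (g has_derivative (\<lambda>h. Re h * gx z + Im h * gy z)) (at z)"
    and gx: "\<And>z. z \<in> S \<Longrightarrow> (gx has_derivative (\<lambda>h. Re h * gxx z + Im h * gxy z)) (at z)"
    and gy: "\<And>z. z \<in> S \<Longrightarrow> (gy has_derivative (\<lambda>h. Re h * gyx z + Im h * gyy z)) (at z)"
    and cont: "continuous_on S gxy" "continuous_on S gyx"
  shows "gxy w = gyx w"
proof (rule ccontr)
  assume ne: "gxy w \<noteq> gyx w"
  define e where "e = \<bar>gxy w - gyx w\<bar> / 2"
  have e: "e > 0" using ne by (simp add: e_def)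
  have "\<forall>\<^sub>F z in at w. dist (gxy z) (gxy w) < e" "\<forall>\<^sub>F z in at w. dist (gyx z) (gyx w) < e"
    using cont S e by (auto simp: continuous_on_eq_continuous_at isCont_def tendsto_iff)
  moreover have "\<forall>\<^sub>F z in at w. z \<in> S"
    using S eventually_at_in_open' by blast
  ultimately have "\<forall>\<^sub>F z in at w. z \<in> S \<and> dist (gxy z) (gxy w) < e \<and> dist (gyx z) (gyx w) < e"
    by eventually_elim auto
  then obtain r where r: "r > 0" "\<And>z. z \<noteq> w \<Longrightarrow> dist z w < r \<Longrightarrow> z \<in> S \<and> dist (gxy z) (gxy w) < e \<and> dist (gyx z) (gyx w) < e"
    by (auto simp: eventually_at)
  then have r: "z \<in> S \<and> dist (gxy z) (gxy w) < e \<and> dist (gyx z) (gyx w) < e" if "dist z w < r" for z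
    using that S e by (cases "z = w") auto
  define h where "h = r / 3"
  have h: "h > 0" using \<open>r > 0\<close> by (simp add: h_def)
  define p where "p x y = w + Complex x y" for x y
  have pr: "dist (p x y) w < r" if "x \<in> {0..h}" "y \<in> {0..h}" for x y
    using cmod_le[of "Complex x y"] that \<open>r > 0\<close> by (auto simp: p_def dist_norm h_def)
  have px: "((\<lambda>x. p x y) has_derivative (\<lambda>t. of_real t)) (at x)" 
       "((\<lambda>y. p x y) has_derivative (\<lambda>t. \<i> * of_real t)) (at y)" for x y
    unfolding p_def Complex_eq by (auto intro!: derivative_eq_intros)
  have conv: "((\<lambda>x. k (p x y)) has_real_derivative a) (at x)" "((\<lambda>y. k (p x y)) has_real_derivative b) (at y)"
    if "(k has_derivative (\<lambda>h. Re h * a + Im h * b)) (at (p x y))" for x y a b and k :: "complex \<Rightarrow> real"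
    using has_derivative_compose[OF px(1)[of y x] that] has_derivative_compose[OF px(2)[of x y] that]
    by (simp_all add: has_field_derivative_def mult_commute_abs)
  have "\<exists>x\<in>{0..h}. \<exists>y\<in>{0..h}. g (p h h) - g (p h 0) - g (p 0 h) + g (p 0 0) = h\<^sup>2 * gxy (p x y)"
  proof (rule mixed_difference[OF h])
    fix x y assume xy: "x \<in> {0..h}" "y \<in> {0..h}"
    then have z: "p x y \<in> S" using r pr by blast
    show "((\<lambda>x. g (p x y)) has_real_derivative gx (p x y)) (at x)" by (rule conv(1)[OF g[OF z]])
    show "((\<lambda>y. gx (p x y)) has_real_derivative gxy (p x y)) (at y)" by (rule conv(2)[OF gx[OF z]])
  qed
  moreover have "\<exists>x\<in>{0..h}. \<exists>y\<in>{0..h}. g (p h h) - g (p 0 h) - g (p h 0) + g (p 0 0) = h\<^sup>2 * gyx (p y x)"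
  proof (rule mixed_difference[OF h])
    fix x y assume xy: "x \<in> {0..h}" "y \<in> {0..h}"
    then have z: "p y x \<in> S" using r pr by blast
    show "((\<lambda>x. g (p y x)) has_real_derivative gy (p y x)) (at x)" by (rule conv(2)[OF g[OF z]])
    show "((\<lambda>y. gy (p y x)) has_real_derivative gyx (p y x)) (at y)" by (rule conv(1)[OF gy[OF z]])
  qed
  ultimately obtain x y x' y' where *: "x\<in>{0..h}" "y\<in>{0..h}" "x'\<in>{0..h}" "y'\<in>{0..h}"
     "h\<^sup>2 * gxy (p x y) = h\<^sup>2 * gyx (p y' x')" by (smt (verit))
  then have "gxy (p x y) = gyx (p y' x')" using h by simp
  moreover have "dist (gxy (p x y)) (gxy w) < e" "dist (gyx (p y' x')) (gyx w) < e"
    using r pr * by blast+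
  ultimately show False unfolding e_def dist_real_def by (smt (verit) field_sum_of_halves)
qed

lemma symmetric_partials:
  fixes f :: "complex \<Rightarrow> complex"
  assumes S: "open S" "w \<in> S" and f: "Ck_on (Suc (Suc 0)) S f"
  shows "partial_im (partial_re f) w = partial_re (partial_im f) w"
proof -
  have x: "Ck_on (Suc 0) S (partial_re f)" "Ck_on (Suc 0) S (partial_im f)" using f by auto
  have c: "continuous_on S (partial_im (partial_re f))" "continuous_on S (partial_re (partial_im f))"
    using f by auto
  note d = Ck_on_SucD[OF f] Ck_on_SucD[OF x(1)] Ck_on_SucD[OF x(2)]
  have "Re (partial_im (partial_re f) w) = Re (partial_re (partial_im f) w)"
    by (rule symmetric_partials_real[OF S, of "\<lambda>z. Re (f z)" "\<lambda>z. Re (partial_re f z)" "\<lambda>z. Re (partial_im f z)"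
       "\<lambda>z. Re (partial_re (partial_re f) z)" _ _ "\<lambda>z. Re (partial_im (partial_im f) z)"])
      (use d[THEN has_derivative_Re] c in \<open>auto intro: continuous_intros\<close>)
  moreover have "Im (partial_im (partial_re f) w) = Im (partial_re (partial_im f) w)"
    by (rule symmetric_partials_real[OF S, of "\<lambda>z. Im (f z)" "\<lambda>z. Im (partial_re f z)" "\<lambda>z. Im (partial_im f z)"
       "\<lambda>z. Im (partial_re (partial_re f) z)" _ _ "\<lambda>z. Im (partial_im (partial_im f) z)"])
      (use d[THEN has_derivative_Im] c in \<open>auto intro: continuous_intros\<close>)
  ultimately show ?thesis by (simp add: complex_eq_iff)
qed

lemma Ck_on_wd:
  assumes "open S" "Ck_on (Suc k) S f"
  shows "Ck_on k S (wd f)" "Ck_on k S (wdbar f)"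
proof -
  have "Ck_on k S (partial_re f)" "Ck_on k S (partial_im f)" using assms by auto
  then have "Ck_on k S (\<lambda>w. (partial_re f w - \<i> * partial_im f w) / 2)"
    "Ck_on k S (\<lambda>w. (partial_re f w + \<i> * partial_im f w) / 2)"
    using assms(1) by (auto intro!: Ck_on_divide Ck_on_add Ck_on_diff Ck_on_mult)
  then show "Ck_on k S (wd f)" "Ck_on k S (wdbar f)"
    by (simp_all add: wd_def[abs_def] wdbar_def[abs_def])
qed

lemma wd_wdbar_commute:
  assumes S: "open S" "w \<in> S" and f: "Ck_on (Suc (Suc 0)) S f"
  shows "wdbar (wd f) w = wd (wdbar f) w"
proof -
  have "(partial_re f) differentiable (at w)" "(partial_im f) differentiable (at w)" using S f by auto
  note d = this[THEN differentiable_partials]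
  have 1: "(wd f has_derivative (\<lambda>h. ((Re h *\<^sub>R partial_re (partial_re f) w + Im h *\<^sub>R partial_im (partial_re f) w)
      - \<i> * (Re h *\<^sub>R partial_re (partial_im f) w + Im h *\<^sub>R partial_im (partial_im f) w)) / 2)) (at w)"
    unfolding wd_def[abs_def]
    by (intro bounded_linear.has_derivative[OF bounded_linear_divide] has_derivative_diff has_derivative_mult_right d)
  have 2: "(wdbar f has_derivative (\<lambda>h. ((Re h *\<^sub>R partial_re (partial_re f) w + Im h *\<^sub>R partial_im (partial_re f) w)
      + \<i> * (Re h *\<^sub>R partial_re (partial_im f) w + Im h *\<^sub>R partial_im (partial_im f) w)) / 2)) (at w)"
    unfolding wdbar_def[abs_def]
    by (intro bounded_linear.has_derivative[OF bounded_linear_divide] has_derivative_add has_derivative_mult_right d)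
  show ?thesis
    unfolding wd_def[of "wdbar f"] wdbar_def[of "wd f"] partial_eq[OF 1] partial_eq[OF 2]
    using symmetric_partials[OF S f] by (simp add: field_simps)
qed

section \<open>Absolutely convergent sums of waves and the Beltrami equation\<close>

text \<open>
  The frequency may be any complex number, not only a point of a lattice. So no periodicity has to be
  respected, and \<open>\<kappa> = 0\<close> is the only frequency that needs separate treatment in the solution of
  \<open>\<partial>h/\<partial>cnj v = wave \<kappa>\<close>.
\<close>

definition wave :: "complex \<Rightarrow> complex \<Rightarrow> complex" where
  "wave \<kappa> v = cis (Re (cnj \<kappa> * v))"

lemma norm_wave [simp]: "norm (wave \<kappa> v) = 1"
  by (simp add: wave_def)

lemma wave_add: "wave (\<kappa> + \<mu>) v = wave \<kappa> v * wave \<mu> v"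
  by (simp add: wave_def cis_mult algebra_simps)

lemma wave_0 [simp]: "wave 0 v = 1" "wave \<kappa> 0 = 1"
  by (simp_all add: wave_def)

text \<open>
  Frequencies may repeat, so neither coefficients nor frequencies are determined by \<open>f\<close>, and \<open>r\<close> is any bound
  for a suitable choice. Thus \<open>wiener r f\<close> says that the norm of \<open>f\<close> in the algebra of
  absolutely convergent generalized trigonometric sums does not exceed \<open>r\<close>, up to attainment.
\<close>

definition wiener :: "real \<Rightarrow> (complex \<Rightarrow> complex) \<Rightarrow> bool" where
  "wiener r f \<longleftrightarrow> (\<exists>c \<kappa>. summable (\<lambda>j::nat. norm (c j)) \<and> (\<Sum>j. norm (c j)) \<le> r \<and>
     (\<forall>v. f v = (\<Sum>j. c j * wave (\<kappa> j) v)))"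

lemma wienerE:
  assumes "wiener r f"
  obtains c \<kappa> where "summable (\<lambda>j::nat. norm (c j))" "(\<Sum>j. norm (c j)) \<le> r"
     "\<And>v. (\<lambda>j. c j * wave (\<kappa> j) v) sums f v"
proof -
  from assms obtain c \<kappa> where *: "summable (\<lambda>j::nat. norm (c j))" "(\<Sum>j. norm (c j)) \<le> r"
     "\<And>v. f v = (\<Sum>j. c j * wave (\<kappa> j) v)"
    unfolding wiener_def by blast
  have "summable (\<lambda>j. c j * wave (\<kappa> j) v)" for v
    by (rule summable_norm_cancel) (simp add: norm_mult *)
  with * that show thesis by (metis summable_sums)
qed

lemma wiener_mono: "wiener r f \<Longrightarrow> r \<le> s \<Longrightarrow> wiener s f"
  unfolding wiener_def by (meson order_trans)

lemma wiener_norm_le: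
  assumes "wiener r f" shows "norm (f v) \<le> r"
proof -
  obtain c \<kappa> where *: "summable (\<lambda>j::nat. norm (c j))" "(\<Sum>j. norm (c j)) \<le> r"
     "\<And>v. (\<lambda>j. c j * wave (\<kappa> j) v) sums f v" using wienerE[OF assms] by blast
  have "norm (f v) = norm (\<Sum>j. c j * wave (\<kappa> j) v)" using *(3) sums_unique by metis
  also have "\<dots> \<le> (\<Sum>j. norm (c j * wave (\<kappa> j) v))"
    by (rule summable_norm) (simp add: norm_mult *)
  also have "\<dots> = (\<Sum>j. norm (c j))" by (simp add: norm_mult)
  finally show ?thesis using * by simp
qed

lemma wiener_nonneg: "wiener r f \<Longrightarrow> 0 \<le> r"
  using wiener_norm_le norm_ge_zero order_trans by blast

text \<open>
  A countable family of series is a double series, enumerated here by the pairing of natural numbers;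
  absolute summability allows the rearrangement. Sums, products and double cosine series are all
  obtained from this one closure property.
\<close>

lemma wiener_suminf:
  assumes w: "\<And>n::nat. wiener (r n) (f n)" and r: "summable r"
  shows "wiener (\<Sum>n. r n) (\<lambda>v. \<Sum>n. f n v)"
proof -
  have "\<forall>n. \<exists>c \<kappa>. summable (\<lambda>j::nat. norm (c j)) \<and> (\<Sum>j. norm (c j)) \<le> r n \<and>
     (\<forall>v. (\<lambda>j. c j * wave (\<kappa> j) v) sums f n v)"
    by (rule allI, rule wienerE[OF w]) blast
  then obtain c \<kappa> where c: "\<And>n. summable (\<lambda>j::nat. norm (c n j))" "\<And>n. (\<Sum>j. norm (c n j)) \<le> r n"
     "\<And>n v. (\<lambda>j. c n j * wave (\<kappa> n j) v) sums f n v"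
    by metis
  have hs1: "((\<lambda>j. norm (c n j)) has_sum (\<Sum>j. norm (c n j))) UNIV" for n
    using c(1) by (intro sums_nonneg_imp_has_sum) (auto simp: summable_sums)
  have rn: "summable (\<lambda>n. \<Sum>j. norm (c n j))"
    by (rule summable_comparison_test'[OF r, of 0]) (simp add: c suminf_nonneg)
  have hs2: "((\<lambda>n. \<Sum>j. norm (c n j)) has_sum (\<Sum>n. \<Sum>j. norm (c n j))) UNIV"
    using rn by (intro sums_nonneg_imp_has_sum) (auto simp: summable_sums suminf_nonneg c)
  have hs3: "((\<lambda>(n,j). norm (c n j)) has_sum (\<Sum>n. \<Sum>j. norm (c n j))) (UNIV \<times> UNIV)"
  proof (rule has_sum_SigmaI[OF _ hs2])
    show "(\<lambda>(n,j). norm (c n j)) summable_on UNIV \<times> UNIV"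
      by (rule summable_on_SigmaI[OF _ has_sum_imp_summable[OF hs2]]) (use hs1 in auto)
  qed (use hs1 in auto)
  define c' where "c' m = (case prod_decode m of (n,j) \<Rightarrow> c n j)" for m
  define \<kappa>' where "\<kappa>' m = (case prod_decode m of (n,j) \<Rightarrow> \<kappa> n j)" for m
  have bij: "bij_betw prod_decode UNIV (UNIV \<times> UNIV)"
    using bij_prod_decode by simp
  have "((\<lambda>m. norm (c' m)) has_sum (\<Sum>n. \<Sum>j. norm (c n j))) UNIV"
    using has_sum_reindex_bij_betw[OF bij, of "\<lambda>(n,j). norm (c n j)"] hs3
    by (simp add: c'_def case_prod_unfold)
  then have S: "(\<lambda>m. norm (c' m)) sums (\<Sum>n. \<Sum>j. norm (c n j))"
    by (rule has_sum_imp_sums)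
  have le: "(\<Sum>n. \<Sum>j. norm (c n j)) \<le> (\<Sum>n. r n)"
    using suminf_le[OF _ rn r] c by auto
  have "(\<Sum>n. f n v) = (\<Sum>m. c' m * wave (\<kappa>' m) v)" for v
  proof -
    define F where "F n j = c n j * wave (\<kappa> n j) v" for n j
    have abs: "(\<lambda>(n,j). F n j) summable_on (UNIV \<times> UNIV)"
      by (rule abs_summable_summable)
         (use hs3 in \<open>auto simp: F_def norm_mult case_prod_unfold has_sum_imp_summable\<close>)
    have hsF: "((\<lambda>j. F n j) has_sum f n v) UNIV" for n
      using norm_summable_imp_has_sum[of "F n" "f n v"] c unfolding F_def by (simp add: norm_mult)
    have "((\<lambda>(n,j). F n j) has_sum infsum (\<lambda>(n,j). F n j) (UNIV \<times> UNIV)) (UNIV \<times> UNIV)"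
      using abs by simp
    then have "((\<lambda>n. f n v) has_sum infsum (\<lambda>(n,j). F n j) (UNIV \<times> UNIV)) UNIV"
      by (rule has_sum_SigmaD) (use hsF in auto)
    then have 1: "(\<Sum>n. f n v) = infsum (\<lambda>(n,j). F n j) (UNIV \<times> UNIV)"
      using has_sum_imp_sums sums_unique by metis
    have "((\<lambda>m. c' m * wave (\<kappa>' m) v) has_sum infsum (\<lambda>(n,j). F n j) (UNIV \<times> UNIV)) UNIV"
      using has_sum_reindex_bij_betw[OF bij, of "\<lambda>(n,j). F n j"] abs
      by (simp add: c'_def \<kappa>'_def F_def case_prod_unfold)
    then show ?thesis using 1 has_sum_imp_sums sums_unique by metis
  qed
  then show ?thesis unfolding wiener_def using S le
    by (intro exI[of _ c'] exI[of _ \<kappa>']) (auto simp: sums_iff)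
qed

lemma wiener_wave: "wiener (norm a) (\<lambda>v. a * wave \<kappa> v)"
proof -
  have "(\<lambda>j::nat. norm (if j = 0 then a else 0)) sums norm a"
    using sums_single[of 0 "\<lambda>_. norm a"] by (simp add: if_distrib cong: if_cong)
  moreover have "(\<lambda>j::nat. (if j = 0 then a else 0) * wave \<kappa> v) sums (a * wave \<kappa> v)" for v
    using sums_finite[of "{0}" "\<lambda>j::nat. (if j = 0 then a else 0) * wave \<kappa> v"] by simp
  ultimately show ?thesis unfolding wiener_def
    by (intro exI[of _ "\<lambda>j. if j = 0 then a else 0"] exI[of _ "\<lambda>_. \<kappa>"])
       (auto simp: sums_iff)
qed

lemma wiener_const: "wiener (norm a) (\<lambda>v. a)"
  using wiener_wave[of a 0] by simp

lemma wiener_add: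
  assumes "wiener r f" "wiener s g" shows "wiener (r + s) (\<lambda>v. f v + g v)"
proof -
  define R where "R n = (if n = 0 then r else if n = 1 then s else 0)" for n :: nat
  define F where "F n = (if n = 0 then f else if n = 1 then g else (\<lambda>_. 0))" for n :: nat
  have 1: "R sums (r + s)" 
    using sums_finite[of "{0,1}" R] by (auto simp: R_def)
  have 2: "(\<lambda>n. F n v) sums (f v + g v)" for v
    using sums_finite[of "{0,1}" "\<lambda>n. F n v"] by (auto simp: F_def)
  have "wiener (R n) (F n)" for n
    using assms wiener_const[of 0] by (auto simp: R_def F_def)
  from wiener_suminf[of R F, OF this] 1 2 show ?thesis by (auto simp: sums_iff)
qed

lemma wiener_wave_mult:
  assumes "wiener r f" shows "wiener (norm a * r) (\<lambda>v. a * wave \<mu> v * f v)"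
proof -
  obtain c \<kappa> where *: "summable (\<lambda>j::nat. norm (c j))" "(\<Sum>j. norm (c j)) \<le> r"
     "\<And>v. (\<lambda>j. c j * wave (\<kappa> j) v) sums f v" using wienerE[OF assms] by blast
  have 1: "(\<lambda>j. norm (a * c j)) sums (norm a * (\<Sum>j. norm (c j)))"
    by (simp add: norm_mult * sums_mult summable_sums)
  have 2: "(\<lambda>j. (a * c j) * wave (\<mu> + \<kappa> j) v) sums (a * wave \<mu> v * f v)" for v
    using sums_mult[OF *(3)[of v], of "a * wave \<mu> v"] by (simp add: wave_add mult_ac)
  show ?thesis unfolding wiener_def
    by (rule exI[of _ "\<lambda>j. a * c j"], rule exI[of _ "\<lambda>j. \<mu> + \<kappa> j"])
       (use 1 2 *(2) in \<open>auto simp: sums_iff mult_left_mono\<close>)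
qed

text \<open>
  Multiplying by one wave shifts the frequencies, so the product is a countable sum of shifted copies of \<open>g\<close>.
\<close>

lemma wiener_mult:
  assumes "wiener r f" "wiener s g" shows "wiener (r * s) (\<lambda>v. f v * g v)"
proof -
  obtain c \<kappa> where *: "summable (\<lambda>j::nat. norm (c j))" "(\<Sum>j. norm (c j)) \<le> r"
     "\<And>v. (\<lambda>j. c j * wave (\<kappa> j) v) sums f v" using wienerE[OF assms(1)] by blast
  have "wiener (\<Sum>j. norm (c j) * s) (\<lambda>v. \<Sum>j. c j * wave (\<kappa> j) v * g v)"
    by (rule wiener_suminf) (use * assms in \<open>auto intro: wiener_wave_mult summable_mult2\<close>)
  moreover have "(\<Sum>j. c j * wave (\<kappa> j) v * g v) = f v * g v" for v
    using sums_mult2[OF *(3)] by (simp add: sums_iff)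
  moreover have "(\<Sum>j. norm (c j) * s) \<le> r * s"
    using * wiener_nonneg[OF assms(2)] by (simp flip: suminf_mult2 add: mult_right_mono)
  ultimately show ?thesis using wiener_mono by auto
qed

lemma wave_has_derivative [derivative_intros]:
  "(wave \<kappa> has_derivative (\<lambda>h. \<i> / 2 * (cnj \<kappa> * h + \<kappa> * cnj h) * wave \<kappa> v)) (at v within S)"
proof -
  have e: "wave \<kappa> = (\<lambda>v. exp (\<i> / 2 * (cnj \<kappa> * v + \<kappa> * cnj v)))"
  proof
    fix v
    have "\<i> / 2 * (cnj \<kappa> * v + \<kappa> * cnj v) = \<i> * of_real (Re (cnj \<kappa> * v))"
      by (simp add: complex_eq_iff)
    then show "wave \<kappa> v = exp (\<i> / 2 * (cnj \<kappa> * v + \<kappa> * cnj v))"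
      unfolding wave_def cis_conv_exp by (rule arg_cong[OF sym])
  qed
  have "((\<lambda>v. \<i> / 2 * (cnj \<kappa> * v + \<kappa> * cnj v)) has_derivative
     (\<lambda>h. \<i> / 2 * (cnj \<kappa> * h + \<kappa> * cnj h))) (at v within S)"
    by (auto intro!: derivative_eq_intros)
  from has_derivative_compose[OF this DERIV_exp[unfolded has_field_derivative_def]]
  have "((\<lambda>v. exp (\<i> / 2 * (cnj \<kappa> * v + \<kappa> * cnj v))) has_derivative
     (\<lambda>h. \<i> / 2 * (cnj \<kappa> * h + \<kappa> * cnj h) * exp (\<i> / 2 * (cnj \<kappa> * v + \<kappa> * cnj v)))) (at v within S)"
    by (simp add: mult_ac)
  then show ?thesis by (simp add: e)
qed

lemma wiener_continuous:
  assumes "wiener r f" shows "continuous_on UNIV f"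
proof -
  obtain c \<kappa> where *: "summable (\<lambda>j::nat. norm (c j))" "(\<Sum>j. norm (c j)) \<le> r"
     "\<And>v. (\<lambda>j. c j * wave (\<kappa> j) v) sums f v" using wienerE[OF assms(1)] by blast
  have "uniform_limit UNIV (\<lambda>n v. \<Sum>j<n. c j * wave (\<kappa> j) v) (\<lambda>v. \<Sum>j. c j * wave (\<kappa> j) v) sequentially"
    by (rule Weierstrass_m_test[OF _ *(1)]) (simp add: norm_mult)
  then have ul: "uniform_limit UNIV (\<lambda>n v. \<Sum>j<n. c j * wave (\<kappa> j) v) f sequentially"
    using *(3) by (simp add: sums_iff)
  have "continuous_on UNIV (wave k)" for k
    by (rule has_derivative_continuous_on[OF wave_has_derivative])
  then have "\<forall>\<^sub>F n in sequentially. continuous_on UNIV (\<lambda>v. \<Sum>j<n. c j * wave (\<kappa> j) v)"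
    by (auto intro!: always_eventually continuous_intros)
  then show ?thesis
    by (rule uniform_limit_theorem[OF _ ul]) simp
qed

text \<open>
  The partial sums of the derivatives converge uniformly in operator norm, and the series itself
  converges at \<open>0\<close>, where all terms vanish.
\<close>

lemma wirtinger_series:
  fixes h g f :: "nat \<Rightarrow> complex \<Rightarrow> complex"
  assumes der: "\<And>n v. (h n has_derivative (\<lambda>u. g n v * u + f n v * cnj u)) (at v)"
    and h0: "\<And>n. h n 0 = 0"
    and bd: "\<And>n v. norm (g n v) \<le> r n" "\<And>n v. norm (f n v) \<le> r n" and r: "summable r"
  shows "\<exists>H. H 0 = 0 \<and> (\<forall>v. (H has_derivative (\<lambda>u. (\<Sum>n. g n v) * u + (\<Sum>n. f n v) * cnj u)) (at v))"
proof -
  have "\<exists>H. \<forall>v\<in>UNIV. (\<lambda>n. h n v) sums H v \<and>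
     (H has_derivative (\<lambda>u. (\<Sum>n. g n v) * u + (\<Sum>n. f n v) * cnj u)) (at v within UNIV)"
  proof (rule has_derivative_series[where x = 0 and l = 0])
    show "(\<lambda>n. h n 0) sums 0" by (simp add: h0)
    fix e :: real assume e: "e > 0"
    have "uniform_limit UNIV (\<lambda>n v. \<Sum>j<n. g j v) (\<lambda>v. \<Sum>j. g j v) sequentially"
         "uniform_limit UNIV (\<lambda>n v. \<Sum>j<n. f j v) (\<lambda>v. \<Sum>j. f j v) sequentially"
      using bd by (auto intro!: Weierstrass_m_test[OF _ r])
    then have "\<forall>\<^sub>F n in sequentially. \<forall>v. norm ((\<Sum>j<n. g j v) - (\<Sum>j. g j v)) < e / 2"
       "\<forall>\<^sub>F n in sequentially. \<forall>v. norm ((\<Sum>j<n. f j v) - (\<Sum>j. f j v)) < e / 2"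
      using e unfolding uniform_limit_iff dist_norm by (auto dest!: spec[of _ "e/2"])
    then show "\<forall>\<^sub>F n in sequentially. \<forall>v\<in>UNIV. \<forall>u. norm ((\<Sum>i<n. g i v * u + f i v * cnj u) -
                   ((\<Sum>n. g n v) * u + (\<Sum>n. f n v) * cnj u)) \<le> e * norm u"
    proof eventually_elim
      case (elim n)
      show ?case
      proof (intro ballI allI)
        fix v u
        let ?G = "(\<Sum>j<n. g j v) - (\<Sum>j. g j v)" and ?F = "(\<Sum>j<n. f j v) - (\<Sum>j. f j v)"
        have "(\<Sum>i<n. g i v * u + f i v * cnj u) - ((\<Sum>n. g n v) * u + (\<Sum>n. f n v) * cnj u)
            = ?G * u + ?F * cnj u"
          by (simp add: sum.distrib sum_distrib_left algebra_simps)
        also have "norm \<dots> \<le> norm ?G * norm u + norm ?F * norm u"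
          using norm_triangle_ineq[of "?G * u" "?F * cnj u"] by (simp add: norm_mult)
        also have "\<dots> \<le> e / 2 * norm u + e / 2 * norm u"
          using elim by (intro add_mono mult_right_mono) (auto intro: less_imp_le)
        finally show "norm ((\<Sum>i<n. g i v * u + f i v * cnj u) -
                   ((\<Sum>n. g n v) * u + (\<Sum>n. f n v) * cnj u)) \<le> e * norm u" by simp
      qed
    qed
  qed (use der in auto)
  then obtain H where H: "\<And>v. (\<lambda>n. h n v) sums H v"
     "\<And>v. (H has_derivative (\<lambda>u. (\<Sum>n. g n v) * u + (\<Sum>n. f n v) * cnj u)) (at v)" by auto
  moreover have "H 0 = 0" using H(1)[of 0] h0 sums_unique by force
  ultimately show ?thesis by blast
qed

text \<open>
  The wave with frequency \<open>\<kappa>\<close> has the \<open>v\<close>-bar primitive \<open>2 / (\<i> \<kappa>) * (wave \<kappa> v - 1)\<close>, or \<open>cnj v\<close> if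
  \<open>\<kappa> = 0\<close>, and the \<open>v\<close> derivative of this primitive is \<open>cnj \<kappa> / \<kappa>\<close> times the wave, or \<open>0\<close> if
  \<open>\<kappa> = 0\<close>. As this factor has modulus at most one, \<open>g\<close> has the same bound as \<open>f\<close>: the analogue of the
  Beurling transform is a contraction, without any singular integral. The subtraction of \<open>1\<close> makes the
  primitives vanish at \<open>0\<close>, which yields convergence although \<open>\<kappa>\<close> may be arbitrarily small.
\<close>

lemma wiener_dbar_primitive:
  assumes "wiener r f"
  shows "\<exists>h g. wiener r g \<and> h 0 = 0 \<and> (\<forall>v. (h has_derivative (\<lambda>u. g v * u + f v * cnj u)) (at v))"
proof -
  obtain c \<kappa> where *: "summable (\<lambda>j::nat. norm (c j))" "(\<Sum>j. norm (c j)) \<le> r"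
     "\<And>v. (\<lambda>j. c j * wave (\<kappa> j) v) sums f v" using wienerE[OF assms(1)] by blast
  \<comment> \<open>For \<open>\<kappa> j = 0\<close> division by zero gives the correct coefficient \<open>0\<close>.\<close>
  define c' where "c' j = c j * (cnj (\<kappa> j) / \<kappa> j)" for j
  define h where "h j v = (if \<kappa> j = 0 then c j * cnj v else c j * (2 / (\<i> * \<kappa> j)) * (wave (\<kappa> j) v - 1))" for j v
  have n: "norm (c' j) \<le> norm (c j)" for j
    by (cases "\<kappa> j = 0") (auto simp: c'_def norm_mult norm_divide)
  have "summable (\<lambda>j. norm (c' j))"
    by (rule summable_comparison_test'[OF *(1), of 0]) (simp add: n)
  moreover have "(\<Sum>j. norm (c' j)) \<le> (\<Sum>j. norm (c j))"
    by (rule suminf_le) (use n calculation * in auto)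
  ultimately have "wiener r (\<lambda>v. \<Sum>j. c' j * wave (\<kappa> j) v)"
    unfolding wiener_def using *(2) by fastforce
  moreover have "(h j has_derivative (\<lambda>u. (c' j * wave (\<kappa> j) v) * u + (c j * wave (\<kappa> j) v) * cnj u)) (at v)" for j v
  proof (cases "\<kappa> j = 0")
    case True
    have "h j = (\<lambda>v. c j * cnj v)" using True by (auto simp: h_def)
    then show ?thesis using True
      by (auto intro!: derivative_eq_intros simp: c'_def)
  next
    case False
    have e: "h j = (\<lambda>v. c j * (2 / (\<i> * \<kappa> j)) * (wave (\<kappa> j) v - 1))" using False by (auto simp: h_def)
    show ?thesis unfolding e
      by (rule has_derivative_eq_rhs, (rule derivative_eq_intros refl)+)
         (use False in \<open>auto simp: c'_def fun_eq_iff field_simps\<close>)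
  qed
  then have "\<exists>H. H 0 = 0 \<and> (\<forall>v. (H has_derivative (\<lambda>u. (\<Sum>j. c' j * wave (\<kappa> j) v) * u + (\<Sum>j. c j * wave (\<kappa> j) v) * cnj u)) (at v))"
    by (rule wirtinger_series[where r = "\<lambda>j. norm (c j)"])
       (use * n in \<open>auto simp: norm_mult h_def\<close>)
  ultimately show ?thesis using *(3) by (auto simp: sums_iff)
qed

text \<open>
  In the form \<open>X v = v + s0 * cnj v + H v\<close>, where \<open>H\<close> has the Wirtinger derivatives \<open>G\<close> and \<open>F\<close>, the Beltrami
  equation reads \<open>F = \<tau> + (s0 + \<tau>) * G\<close>. Here \<open>G\<close> depends linearly on \<open>F\<close> with norm at most one, so the
  iteration converges geometrically with ratio \<open>norm s0 + \<delta>\<close>. The bound obtained for \<open>G\<close> is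
  \<open>\<delta> / (1 - norm s0 - \<delta>)\<close>; the factor \<open>2\<close> in the hypothesis makes it less than one, and then the
  derivative \<open>1 + G\<close> of \<open>X\<close> has no zeros.
\<close>

proposition wiener_beltrami:
  assumes \<tau>: "wiener \<delta> \<tau>" and \<delta>: "norm s0 + 2 * \<delta> < 1"
  shows "\<exists>X G. continuous_on UNIV G \<and> continuous_on UNIV \<tau> \<and> (\<forall>v. norm (G v) < 1) \<and>
     (\<forall>v. (X has_derivative (\<lambda>u. (1 + G v) * u + (s0 + \<tau> v) * (1 + G v) * cnj u)) (at v))"
proof -
  define q where "q = norm s0 + \<delta>"
  have d0: "\<delta> \<ge> 0" using wiener_nonneg[OF \<tau>] .
  have q: "0 \<le> q" "q < 1" using d0 \<delta> by (auto simp: q_def)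
  have s: "wiener q (\<lambda>v. s0 + \<tau> v)"
    unfolding q_def by (intro wiener_add wiener_const \<tau>)
  \<comment> \<open>The triples \<open>(f, g, h)\<close> of the iteration: \<open>h\<close> is a \<open>v\<close>-bar primitive of \<open>f\<close>, and \<open>g\<close> its \<open>v\<close> derivative.\<close>
  define Q where "Q n = (\<lambda>(f, g, h). wiener (\<delta> * q ^ n) f \<and> wiener (\<delta> * q ^ n) g \<and> h 0 = 0 \<and>
     (\<forall>v. (h has_derivative (\<lambda>u. g v * u + f v * cnj u)) (at v)))" for n
  have ex: "\<exists>p. Q n p \<and> fst p = f" if "wiener (\<delta> * q ^ n) f" for n f
    using wiener_dbar_primitive[OF that] that by (auto simp: Q_def)
  have "\<exists>p. \<forall>n. (Q n (p n) \<and> (n = 0 \<longrightarrow> fst (p n) = \<tau>)) \<and>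
      fst (p (Suc n)) = (\<lambda>v. (s0 + \<tau> v) * fst (snd (p n)) v)"
  proof (rule dependent_nat_choice)
    show "\<exists>x. Q 0 x \<and> (0 = (0::nat) \<longrightarrow> fst x = \<tau>)"
      using ex[of 0 \<tau>] \<tau> by simp
  next
    fix p n assume "Q n p \<and> (n = 0 \<longrightarrow> fst p = \<tau>)"
    then have "wiener (\<delta> * q ^ n) (fst (snd p))" by (auto simp: Q_def)
    from wiener_mult[OF s this]
    have "wiener (\<delta> * q ^ Suc n) (\<lambda>v. (s0 + \<tau> v) * fst (snd p) v)"
      by (simp add: mult_ac)
    from ex[OF this] show "\<exists>y. (Q (Suc n) y \<and> (Suc n = 0 \<longrightarrow> fst y = \<tau>)) \<and>
        fst y = (\<lambda>v. (s0 + \<tau> v) * fst (snd p) v)" by auto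
  qed
  then obtain p where p: "\<And>n. Q n (p n)" "fst (p 0) = \<tau>"
     "\<And>n. fst (p (Suc n)) = (\<lambda>v. (s0 + \<tau> v) * fst (snd (p n)) v)" by auto
  define f where "f n = fst (p n)" for n
  define g where "g n = fst (snd (p n))" for n
  define h where "h n = snd (snd (p n))" for n
  have fgh: "wiener (\<delta> * q ^ n) (f n)" "wiener (\<delta> * q ^ n) (g n)" "h n 0 = 0"
     "(h n has_derivative (\<lambda>u. g n v * u + f n v * cnj u)) (at v)" for n v
    using p(1)[of n] by (auto simp: Q_def f_def g_def h_def case_prod_unfold)
  have f0: "f 0 = \<tau>" and fS: "f (Suc n) v = (s0 + \<tau> v) * g n v" for n v
    using p by (auto simp: f_def g_def)
  have r: "(\<lambda>n. \<delta> * q ^ n) sums (\<delta> / (1 - q))"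
    using sums_mult[OF geometric_sums[of q], of \<delta>] q by simp
  then have sr: "summable (\<lambda>n. \<delta> * q ^ n)" by (rule sums_summable)
  define G where "G v = (\<Sum>n. g n v)" for v
  define F where "F v = (\<Sum>n. f n v)" for v
  obtain H where H: "\<And>v. (H has_derivative (\<lambda>u. G v * u + F v * cnj u)) (at v)"
    using wirtinger_series[of h g f, OF fgh(4) fgh(3) wiener_norm_le[OF fgh(2)] wiener_norm_le[OF fgh(1)] sr]
    unfolding G_def F_def by blast
  have wG: "wiener (\<delta> / (1 - q)) G"
    using wiener_suminf[OF fgh(2) sr] r by (simp add: sums_iff G_def[abs_def])
  have "summable (\<lambda>n. g n v)" for v
    by (rule summable_norm_cancel, rule summable_comparison_test'[OF sr, of 0])
       (use wiener_norm_le[OF fgh(2)] in auto)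
  then have "(\<lambda>n. f (Suc n) v) sums ((s0 + \<tau> v) * G v)" for v
    unfolding fS G_def by (intro sums_mult summable_sums)
  \<comment> \<open>Summation of the recursion gives the fixed point equation.\<close>
  then have F: "F v = \<tau> v + (s0 + \<tau> v) * G v" for v
    using sums_Suc[of "\<lambda>n. f n v"] by (simp add: F_def sums_iff f0 add.commute)
  have lt: "\<delta> / (1 - q) < 1" using q \<delta> by (simp add: q_def)
  have "((\<lambda>v. v + s0 * cnj v + H v) has_derivative
      (\<lambda>u. (1 + G v) * u + (s0 + \<tau> v) * (1 + G v) * cnj u)) (at v)" for v
    by (rule has_derivative_eq_rhs, (rule derivative_eq_intros H refl)+)
       (simp add: F fun_eq_iff algebra_simps)
  moreover have "norm (G v) < 1" for v using wiener_norm_le[OF wG, of v] lt by simp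
  ultimately show ?thesis using wiener_continuous wG \<tau> by blast
qed

section \<open>Cosine series on a square\<close>

definition cos_coeff :: "nat \<Rightarrow> (real \<Rightarrow> complex) \<Rightarrow> complex" where
  "cos_coeff n f = ((if n = 0 then 1 else 2) / pi) *\<^sub>R integral {0..pi} (\<lambda>x. cos (real n * x) *\<^sub>R f x)"

text \<open>
  By the Weierstrass theorem for \<open>u \<circ> arccos\<close> on \<open>[-1, 1]\<close>, the function \<open>u\<close> is a uniform limit of
  polynomials in \<open>cos x\<close>. All of these are orthogonal to \<open>u\<close>, since products of cosines are sums of
  cosines, and therefore \<open>u\<close> is orthogonal to itself.
\<close>

lemma cos_moments_zero_imp_zero_real:
  fixes u :: "real \<Rightarrow> real"
  assumes u: "continuous_on {0..pi} u"
    and mom: "\<And>n. integral {0..pi} (\<lambda>x. cos (real n * x) * u x) = 0"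
    and x: "x \<in> {0..pi}"
  shows "u x = 0"
proof -
  have int: "(\<lambda>x. c x * u x) integrable_on {0..pi}" if "continuous_on {0..pi} c" for c
    using that u by (intro integrable_continuous_interval continuous_intros)
  have pw: "integral {0..pi} (\<lambda>x. cos x ^ k * cos (real n * x) * u x) = 0" for k n
  proof (induction k arbitrary: n)
    case 0
    then show ?case using mom by simp
  next
    case (Suc k)
    show ?case
    proof (cases n)
      case 0
      then show ?thesis using Suc[of 1] by (simp add: mult_ac)
    next
      case (Suc m)
      have "cos x ^ Suc k * cos (real n * x) * u x = 
        (1/2) * (cos x ^ k * cos (real (Suc n) * x) * u x) + (1/2) * (cos x ^ k * cos (real m * x) * u x)" for x
      proof -
        have "cos x * cos (real n * x) = (cos (real (Suc n) * x) + cos (real m * x)) / 2"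
          using cos_times_cos[of "real n * x" x] by (simp add: Suc algebra_simps)
        then have "cos x ^ k * (cos x * cos (real n * x)) * u x = cos x ^ k * ((cos (real (Suc n) * x) + cos (real m * x)) / 2) * u x"
          by simp
        then show ?thesis by (simp add: algebra_simps add_divide_distrib)
      qed
      then have "integral {0..pi} (\<lambda>x. cos x ^ Suc k * cos (real n * x) * u x) = 
         integral {0..pi} (\<lambda>x. (1/2) * (cos x ^ k * cos (real (Suc n) * x) * u x)) 
       + integral {0..pi} (\<lambda>x. (1/2) * (cos x ^ k * cos (real m * x) * u x))"
        by (subst integral_add[symmetric])
           (auto intro!: integrable_on_mult_right int continuous_intros)
      then show ?thesis using Suc.IH[of "Suc n"] Suc.IH[of m] by simp
    qed
  qed
  have I: "integral {0..pi} (\<lambda>x. u x * u x) = 0"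
  proof (rule ccontr)
    assume ne: "integral {0..pi} (\<lambda>x. u x * u x) \<noteq> 0"
    define C where "C = integral {0..pi} (\<lambda>x. \<bar>u x\<bar>)"
    have C: "C \<ge> 0" unfolding C_def by (rule integral_nonneg) (use u in \<open>auto intro!: integrable_continuous_interval continuous_intros\<close>)
    define e where "e = \<bar>integral {0..pi} (\<lambda>x. u x * u x)\<bar> / (C + 1)"
    have e: "e > 0" using ne C by (simp add: e_def)
    have "continuous_on {-1..1} (\<lambda>t. u (arccos t))"
      by (rule continuous_on_compose2[OF u]) (auto intro!: continuous_intros arccos_lbound arccos_ubound)
    then obtain p where "real_polynomial_function p" and p: "\<And>t. t \<in> {-1..1} \<Longrightarrow> \<bar>u (arccos t) - p t\<bar> < e"
      using Stone_Weierstrass_real_polynomial_function[of "{-1..1}" "\<lambda>t. u (arccos t)" e] e by auto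
    then obtain a N where pa: "p = (\<lambda>x. \<Sum>i\<le>N. a i * x ^ i)"
      using real_polynomial_function_imp_sum by blast
    have pc: "\<bar>u x - p (cos x)\<bar> < e" if "x \<in> {0..pi}" for x
      using p[of "cos x"] that by (auto simp: arccos_cos)
    have pcont: "continuous_on {0..pi} (\<lambda>x. p (cos x))" unfolding pa by (intro continuous_intros)
    have "integral {0..pi} (\<lambda>x. p (cos x) * u x) = integral {0..pi} (\<lambda>x. \<Sum>i\<le>N. a i * (cos x ^ i * cos (real 0 * x) * u x))"
      by (simp add: pa sum_distrib_left mult_ac)
    also have "\<dots> = (\<Sum>i\<le>N. integral {0..pi} (\<lambda>x. a i * (cos x ^ i * cos (real 0 * x) * u x)))"
      by (rule integral_sum) (auto intro!: integrable_on_mult_right int continuous_intros)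
    also have "\<dots> = 0" using pw[of _ 0] by simp
    finally have z: "integral {0..pi} (\<lambda>x. p (cos x) * u x) = 0" .
    have "integral {0..pi} (\<lambda>x. u x * u x) = integral {0..pi} (\<lambda>x. (u x - p (cos x)) * u x) + integral {0..pi} (\<lambda>x. p (cos x) * u x)"
      using integral_add[OF int[of "\<lambda>x. u x - p (cos x)"] int[OF pcont]] continuous_on_diff[OF u pcont]
      by (simp add: algebra_simps)
    then have "\<bar>integral {0..pi} (\<lambda>x. u x * u x)\<bar> = norm (integral {0..pi} (\<lambda>x. (u x - p (cos x)) * u x))"
      by (simp add: z)
    also have "\<dots> \<le> integral {0..pi} (\<lambda>x. e * \<bar>u x\<bar>)"
    proof (rule integral_norm_bound_integral)
      show "(\<lambda>x. (u x - p (cos x)) * u x) integrable_on {0..pi}"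
        by (rule int[OF continuous_on_diff[OF u pcont]])
      show "(\<lambda>x. e * \<bar>u x\<bar>) integrable_on {0..pi}"
        using u by (intro integrable_continuous_interval continuous_intros)
      show "norm ((u x - p (cos x)) * u x) \<le> e * \<bar>u x\<bar>" if "x \<in> {0..pi}" for x
        using mult_right_mono[OF less_imp_le[OF pc[OF that]], of "\<bar>u x\<bar>"] by (simp add: abs_mult)
    qed
    also have "\<dots> = e * C" by (simp add: C_def)
    also have "\<dots> < e * (C + 1)" using e by simp
    also have "\<dots> = \<bar>integral {0..pi} (\<lambda>x. u x * u x)\<bar>" using C by (simp add: e_def)
    finally show False by simp
  qed
  have "\<forall>x\<in>{0..pi}. u x * u x = 0"
    using integral_eq_0_iff[OF continuous_on_mult[OF u u] pi_gt_zero] I by simp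
  then show ?thesis using x by simp
qed

lemma cos_moments_zero_imp_zero:
  fixes u :: "real \<Rightarrow> complex"
  assumes u: "continuous_on {0..pi} u"
    and mom: "\<And>n. integral {0..pi} (\<lambda>x. cos (real n * x) *\<^sub>R u x) = 0"
    and x: "x \<in> {0..pi}"
  shows "u x = 0"
proof -
  have int: "(\<lambda>x. cos (real n * x) *\<^sub>R u x) integrable_on {0..pi}" for n
    using u by (intro integrable_continuous_interval continuous_intros)
  have "Re (u x) = 0"
    by (rule cos_moments_zero_imp_zero_real[of "\<lambda>x. Re (u x)"])
       (use u x mom integral_linear[OF int bounded_linear_Re] in \<open>auto intro!: continuous_intros simp: o_def\<close>)
  moreover have "Im (u x) = 0"
    by (rule cos_moments_zero_imp_zero_real[of "\<lambda>x. Im (u x)"])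
       (use u x mom integral_linear[OF int bounded_linear_Im] in \<open>auto intro!: continuous_intros simp: o_def\<close>)
  ultimately show ?thesis by (simp add: complex_eq_iff)
qed

lemma cos_has_integral:
  fixes k :: int
  shows "((\<lambda>x. cos (of_int k * x)) has_integral (if k = 0 then pi else 0)) {0..pi}"
proof (cases "k = 0")
  case True
  then show ?thesis using has_integral_const_real[of "1::real" 0 pi] by simp
next
  case False
  have "((\<lambda>x. cos (of_int k * x)) has_integral (sin (of_int k * pi) / of_int k - sin (of_int k * 0) / of_int k)) {0..pi}"
    by (rule fundamental_theorem_of_calculus)
       (use False in \<open>auto intro!: derivative_eq_intros simp: has_real_derivative_iff_has_vector_derivative[symmetric]\<close>)
  moreover have "sin (of_int k * pi) = 0" by (auto simp: sin_zero_iff_int2)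
  ultimately show ?thesis using False by simp
qed

lemma cos_cos_has_integral:
  "((\<lambda>x. cos (real m * x) * cos (real n * x)) has_integral (if m = n then if n = 0 then pi else pi / 2 else 0)) {0..pi}"
proof -
  have e: "cos (real m * x) * cos (real n * x) = (cos (of_int (int m - int n) * x) + cos (of_int (int m + int n) * x)) * (1/2)" for x
    by (simp add: cos_times_cos algebra_simps)
  have "((\<lambda>x. (cos (of_int (int m - int n) * x) + cos (of_int (int m + int n) * x)) * (1/2)) has_integral
     ((if int m - int n = 0 then pi else 0) + (if int m + int n = 0 then pi else 0)) * (1/2)) {0..pi}"
    by (intro has_integral_mult_left has_integral_add cos_has_integral)
  then show ?thesis unfolding e using has_integral_const_real[of "1::real" 0 pi] by (auto split: if_splits)
qed

text \<open>
  Two integrations by parts, performed at once by an explicit antiderivative. The boundary term of the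
  first one contains \<open>sin (n x)\<close> and vanishes at both endpoints. So the coefficients are
  of order \<open>1 / n\<^sup>2\<close> although \<open>f\<close> satisfies no boundary condition, which is why a cosine series is used
  rather than a Fourier series: no cut-off function is needed to make a local function periodic.
  The constant comes from \<open>4 / pi + 2 \<le> 4\<close> and \<open>1 / n\<^sup>2 \<le> 4 / (n + 1)\<^sup>2\<close>.
\<close>

lemma cos_coeff_bound:
  fixes f f1 f2 :: "real \<Rightarrow> complex"
  assumes d: "\<And>x. x \<in> {0..pi} \<Longrightarrow> (f has_vector_derivative f1 x) (at x within {0..pi})"
     "\<And>x. x \<in> {0..pi} \<Longrightarrow> (f1 has_vector_derivative f2 x) (at x within {0..pi})"
    and c: "continuous_on {0..pi} f2"
    and b: "\<And>x. x \<in> {0..pi} \<Longrightarrow> norm (f x) \<le> M" "\<And>x. x \<in> {0..pi} \<Longrightarrow> norm (f1 x) \<le> M"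
      "\<And>x. x \<in> {0..pi} \<Longrightarrow> norm (f2 x) \<le> M"
  shows "norm (cos_coeff n f) \<le> 16 * M / (real n + 1)\<^sup>2"
proof -
  have M: "M \<ge> 0" using b(1)[of 0] norm_ge_zero[of "f 0"] pi_ge_zero by (meson atLeastAtMost_iff order_trans order_refl)
  have cf: "continuous_on {0..pi} f"
    by (rule continuous_on_vector_derivative[OF d(1)])
  have iB: "norm (integral {0..pi} (\<lambda>x. cos (real n * x) *\<^sub>R g x)) \<le> M * pi"
    if "continuous_on {0..pi} g" "\<And>x. x \<in> {0..pi} \<Longrightarrow> norm (g x) \<le> M" for g :: "real \<Rightarrow> complex"
  proof -
    have "norm (cos (real n * x) *\<^sub>R g x) \<le> M" if "x \<in> {0..pi}" for x
      using mult_mono[of "\<bar>cos (real n * x)\<bar>" 1 "norm (g x)" M] \<open>x \<in> {0..pi} \<Longrightarrow> norm (g x) \<le> M\<close> that by simp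
    moreover have "continuous_on {0..pi} (\<lambda>x. cos (real n * x) *\<^sub>R g x)"
      using that by (intro continuous_intros)
    ultimately show ?thesis
      using integral_bound[of 0 pi "\<lambda>x. cos (real n * x) *\<^sub>R g x" M] by simp
  qed
  show ?thesis
  proof (cases "n = 0")
    case True
    have "norm (cos_coeff n f) = norm (integral {0..pi} (\<lambda>x. cos (real n * x) *\<^sub>R f x)) / pi"
      using True by (simp add: cos_coeff_def)
    also have "\<dots> \<le> M" using iB[OF cf b(1)] by (simp add: field_simps)
    finally show ?thesis using True M by simp
  next
    case False
    define G where "G x = (sin (real n * x) / real n) *\<^sub>R f x + (cos (real n * x) / (real n)\<^sup>2) *\<^sub>R f1 x" for x
    have dG: "(G has_vector_derivative (cos (real n * x) *\<^sub>R f x + (1 / (real n)\<^sup>2) *\<^sub>R (cos (real n * x) *\<^sub>R f2 x))) (at x within {0..pi})"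
      if "x \<in> {0..pi}" for x
      unfolding G_def
      by (rule has_vector_derivative_eq_rhs, (rule derivative_eq_intros d that refl | simp add: False)+)
         (use False in \<open>simp add: power2_eq_square power4_eq_xxxx divide_simps\<close>)
    have "((\<lambda>x. cos (real n * x) *\<^sub>R f x + (1 / (real n)\<^sup>2) *\<^sub>R (cos (real n * x) *\<^sub>R f2 x)) has_integral (G pi - G 0)) {0..pi}"
      by (rule fundamental_theorem_of_calculus) (use dG in auto)
    then have "integral {0..pi} (\<lambda>x. cos (real n * x) *\<^sub>R f x + (1 / (real n)\<^sup>2) *\<^sub>R (cos (real n * x) *\<^sub>R f2 x)) = G pi - G 0"
      by (rule integral_unique)
    also have "integral {0..pi} (\<lambda>x. cos (real n * x) *\<^sub>R f x + (1 / (real n)\<^sup>2) *\<^sub>R (cos (real n * x) *\<^sub>R f2 x)) =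
       integral {0..pi} (\<lambda>x. cos (real n * x) *\<^sub>R f x) + (1 / (real n)\<^sup>2) *\<^sub>R integral {0..pi} (\<lambda>x. cos (real n * x) *\<^sub>R f2 x)"
    proof -
      have i1: "(\<lambda>x. cos (real n * x) *\<^sub>R f x) integrable_on {0..pi}"
        using cf by (intro integrable_continuous_interval continuous_intros)
      have i2: "(\<lambda>x. cos (real n * x) *\<^sub>R f2 x) integrable_on {0..pi}"
        using c by (intro integrable_continuous_interval continuous_intros)
      show ?thesis
        by (simp only: integral_add[OF i1 integrable_cmul[OF i2]] integral_cmul)
    qed
    finally have "integral {0..pi} (\<lambda>x. cos (real n * x) *\<^sub>R f x) = 
       (G pi - G 0) - (1 / (real n)\<^sup>2) *\<^sub>R integral {0..pi} (\<lambda>x. cos (real n * x) *\<^sub>R f2 x)"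
      by (simp add: algebra_simps)
    also have "norm \<dots> \<le> norm (G pi) + norm (G 0) + norm ((1 / (real n)\<^sup>2) *\<^sub>R integral {0..pi} (\<lambda>x. cos (real n * x) *\<^sub>R f2 x))"
    proof -
      have "norm (a - b - c) \<le> norm a + norm b + norm c" for a b c :: complex by norm
      then show ?thesis .
    qed
    also have "\<dots> \<le> M / (real n)\<^sup>2 + M / (real n)\<^sup>2 + (M * pi) / (real n)\<^sup>2"
    proof (intro add_mono)
      have "norm (G t) \<le> M / (real n)\<^sup>2" if "t = 0 \<or> t = pi" for t
      proof -
        have "norm (G t) = \<bar>cos (real n * t)\<bar> * norm (f1 t) / (real n)\<^sup>2"
          using that by (auto simp: G_def sin_npi)
        also have "\<dots> \<le> 1 * M / (real n)\<^sup>2"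
          using that b(2) by (intro divide_right_mono mult_mono) auto
        finally show ?thesis by simp
      qed
      then show "norm (G pi) \<le> M / (real n)\<^sup>2" "norm (G 0) \<le> M / (real n)\<^sup>2" by auto
      show "norm ((1 / (real n)\<^sup>2) *\<^sub>R integral {0..pi} (\<lambda>x. cos (real n * x) *\<^sub>R f2 x)) \<le> (M * pi) / (real n)\<^sup>2"
        using iB[OF c b(3)] by (auto intro!: divide_right_mono)
    qed
    finally have "norm (cos_coeff n f) \<le> 2 / pi * (M / (real n)\<^sup>2 + M / (real n)\<^sup>2 + (M * pi) / (real n)\<^sup>2)"
      using False by (simp add: cos_coeff_def divide_right_mono)
    also have "\<dots> = (4 / pi + 2) * (M / (real n)\<^sup>2)"
      using False by (simp add: field_simps)
    also have "\<dots> \<le> 4 * (M / (real n)\<^sup>2)"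
      using pi_ge_two M by (intro mult_right_mono) (auto simp: field_simps)
    also have "\<dots> \<le> 16 * M / (real n + 1)\<^sup>2"
    proof -
      have "(real n + 1)\<^sup>2 \<le> (2 * real n)\<^sup>2" using False by (intro power_mono) auto
      then have "M * (real n + 1)\<^sup>2 \<le> M * (4 * (real n)\<^sup>2)" using M by (intro mult_left_mono) (auto simp: power_mult_distrib)
      then show ?thesis using False by (simp add: divide_simps mult_ac)
    qed
    finally show ?thesis .
  qed
qed

lemma summable_inverse_Suc_square: "summable (\<lambda>n. 1 / (real n + 1)\<^sup>2)"
  using inverse_squares_sums by (simp add: sums_iff add.commute)

text \<open>
  The series converges uniformly, so its sum has the same cosine moments as \<open>f\<close> and therefore equals \<open>f\<close>.
\<close>

lemma cosine_series_sums:
  fixes f :: "real \<Rightarrow> complex"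
  assumes f: "continuous_on {0..pi} f"
    and b: "\<And>n. norm (cos_coeff n f) \<le> B n" "summable B"
    and x: "x \<in> {0..pi}"
  shows "(\<lambda>n. cos (real n * x) *\<^sub>R cos_coeff n f) sums f x"
proof -
  define a :: "nat \<Rightarrow> complex" where "a n = cos_coeff n f" for n
  define g where "g x = (\<Sum>n. cos (real n * x) *\<^sub>R a n)" for x
  have bd: "norm (cos (real n * x) *\<^sub>R a n) \<le> B n" for n x
    using mult_mono[of "\<bar>cos (real n * x)\<bar>" 1 "norm (a n)" "B n"] b(1)[of n] by (simp add: a_def)
  have ul: "uniform_limit {0..pi} (\<lambda>N x. \<Sum>n<N. cos (real n * x) *\<^sub>R a n) g sequentially"
    unfolding g_def by (rule Weierstrass_m_test[OF bd b(2)])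
  have sm: "summable (\<lambda>n. cos (real n * x) *\<^sub>R a n)" for x
    by (rule summable_norm_cancel, rule summable_comparison_test'[OF b(2), of 0]) (use bd in auto)
  have cg: "continuous_on {0..pi} g"
    by (rule uniform_limit_theorem[OF _ ul]) (auto intro!: always_eventually continuous_intros)
  have mom: "integral {0..pi} (\<lambda>x. cos (real m * x) *\<^sub>R (f x - g x)) = 0" for m
  proof -
    have ul2: "uniform_limit {0..pi} (\<lambda>N x. cos (real m * x) *\<^sub>R (\<Sum>n<N. cos (real n * x) *\<^sub>R a n)) (\<lambda>x. cos (real m * x) *\<^sub>R g x) sequentially"
    proof -
      have "norm (cos (real m * x) *\<^sub>R cos (real n * x) *\<^sub>R a n) \<le> B n" for n x
        using mult_mono[of "\<bar>cos (real m * x)\<bar>" 1 "norm (cos (real n * x) *\<^sub>R a n)" "B n"] bd[of n x]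
        by (simp add: abs_mult mult.assoc)
      then have "uniform_limit {0..pi} (\<lambda>N x. \<Sum>n<N. cos (real m * x) *\<^sub>R cos (real n * x) *\<^sub>R a n)
          (\<lambda>x. \<Sum>n. cos (real m * x) *\<^sub>R cos (real n * x) *\<^sub>R a n) sequentially"
        by (rule Weierstrass_m_test[OF _ b(2)])
      moreover have "(\<Sum>n. cos (real m * x) *\<^sub>R cos (real n * x) *\<^sub>R a n) = cos (real m * x) *\<^sub>R g x" for x
        unfolding g_def by (rule suminf_scaleR_right[symmetric, OF sm])
      ultimately show ?thesis by (simp add: scaleR_sum_right)
    qed
    have cN: "continuous_on {0..pi} (\<lambda>x. cos (real m * x) *\<^sub>R (\<Sum>n<N. cos (real n * x) *\<^sub>R a n))" for N
      by (intro continuous_intros)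
    obtain I J where IJ: "\<And>N. ((\<lambda>x. cos (real m * x) *\<^sub>R (\<Sum>n<N. cos (real n * x) *\<^sub>R a n)) has_integral I N) {0..pi}"
      "((\<lambda>x. cos (real m * x) *\<^sub>R g x) has_integral J) {0..pi}" "I \<longlonglongrightarrow> J"
      using uniform_limit_integral[OF ul2 cN trivial_limit_sequentially] by blast
    define c where "c = (if m = 0 then pi else pi / 2)"
    have "I N = c *\<^sub>R a m" if "N > m" for N
    proof -
      have "((\<lambda>x. \<Sum>n<N. (cos (real m * x) * cos (real n * x)) *\<^sub>R a n) has_integral
         (\<Sum>n<N. (if m = n then if n = 0 then pi else pi / 2 else 0) *\<^sub>R a n)) {0..pi}"
        by (intro has_integral_sum has_integral_scaleR_left cos_cos_has_integral) auto
      moreover have "(\<Sum>n<N. (if m = n then if n = 0 then pi else pi / 2 else 0) *\<^sub>R a n) = c *\<^sub>R a m"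
        using that by (subst sum.remove[of _ m]) (auto simp: c_def intro!: sum.neutral)
      ultimately show ?thesis using has_integral_unique[OF IJ(1)[of N]] by (simp add: scaleR_sum_right)
    qed
    then have "I \<longlonglongrightarrow> c *\<^sub>R a m"
      by (intro tendsto_eventually eventually_sequentiallyI[of "Suc m"]) auto
    then have "J = c *\<^sub>R a m" using IJ(3) LIMSEQ_unique by blast
    also have "\<dots> = integral {0..pi} (\<lambda>x. cos (real m * x) *\<^sub>R f x)"
      by (simp add: c_def a_def cos_coeff_def)
    finally have "integral {0..pi} (\<lambda>x. cos (real m * x) *\<^sub>R g x) = integral {0..pi} (\<lambda>x. cos (real m * x) *\<^sub>R f x)"
      using IJ(2) integral_unique by blast
    then show ?thesis
      using f cg by (subst scaleR_diff_right, subst integral_diff) (auto intro!: integrable_continuous_interval continuous_intros)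
  qed
  have "f x - g x = 0"
    by (rule cos_moments_zero_imp_zero[OF _ mom x]) (use f cg in \<open>auto intro: continuous_intros\<close>)
  then show ?thesis using sm[of x] by (simp add: g_def a_def sums_iff)
qed

lemma wiener_cos:
  "wiener 1 (\<lambda>v. of_real (cos (real m * Re v)))" "wiener 1 (\<lambda>v. of_real (cos (real m * Im v)))"
proof -
  have "wiener (norm (1/2::complex) + norm (1/2::complex)) (\<lambda>v. 1/2 * wave \<kappa> v + 1/2 * wave (-\<kappa>) v)" for \<kappa>
    by (intro wiener_add wiener_wave)
  moreover have "1/2 * wave \<kappa> v + 1/2 * wave (-\<kappa>) v = of_real (cos (Re (cnj \<kappa> * v)))" for \<kappa> v
  proof -
    have "Re (cnj (-\<kappa>) * v) = - Re (cnj \<kappa> * v)" by simp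
    then show ?thesis unfolding wave_def by (simp only:) (simp add: complex_eq_iff del: times_complex.simps)
  qed
  ultimately have *: "wiener 1 (\<lambda>v. of_real (cos (Re (cnj \<kappa> * v))))" for \<kappa> by simp
  show "wiener 1 (\<lambda>v. of_real (cos (real m * Re v)))" using *[of "of_nat m"] by simp
  show "wiener 1 (\<lambda>v. of_real (cos (real m * Im v)))" using *[of "\<i> * of_nat m"] by simp
qed

text \<open>
  The square of the constant \<open>16\<close> in the decay estimate for one variable, times the double sum of the decay
  factors.
\<close>

definition cosine_square_const :: real where "cosine_square_const = 256 * (\<Sum>n. 1 / (real n + 1)\<^sup>2)\<^sup>2"

text \<open>
  Here \<open>F i j\<close> is the derivative of order \<open>i\<close> in \<open>x\<close> and \<open>j\<close> in \<open>y\<close> of \<open>F 0 0\<close>. The cosine coefficients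
  in \<open>x\<close> are twice differentiable functions of \<open>y\<close>, by differentiation under the integral sign, and
  inherit the decay together with their derivatives; so they can be expanded in \<open>y\<close>.
\<close>

lemma cosine_series_square:
  fixes F :: "nat \<Rightarrow> nat \<Rightarrow> real \<Rightarrow> real \<Rightarrow> complex"
  assumes dx: "\<And>i j x y. \<lbrakk>i < 2; j \<le> 2; x \<in> {0..pi}; y \<in> {0..pi}\<rbrakk> \<Longrightarrow>
      ((\<lambda>x. F i j x y) has_vector_derivative F (Suc i) j x y) (at x within {0..pi})"
    and dy: "\<And>j x y. \<lbrakk>j < 2; x \<in> {0..pi}; y \<in> {0..pi}\<rbrakk> \<Longrightarrow>
      ((\<lambda>y. F 0 j x y) has_vector_derivative F 0 (Suc j) x y) (at y within {0..pi})"
    and cont: "\<And>i j. \<lbrakk>i \<le> 2; j \<le> 2\<rbrakk> \<Longrightarrow> continuous_on ({0..pi} \<times> {0..pi}) (\<lambda>(x,y). F i j x y)"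
    and bd: "\<And>i j x y. \<lbrakk>i \<le> 2; j \<le> 2; x \<in> {0..pi}; y \<in> {0..pi}\<rbrakk> \<Longrightarrow> norm (F i j x y) \<le> M"
  shows "\<exists>\<tau>. wiener (cosine_square_const * M) \<tau> \<and> (\<forall>x\<in>{0..pi}. \<forall>y\<in>{0..pi}. \<tau> (Complex x y) = F 0 0 x y)"
proof -
  have M: "M \<ge> 0" using bd[of 0 0 0 0] norm_ge_zero[of "F 0 0 0 0"] pi_ge_zero
    by (meson atLeastAtMost_iff order_trans order_refl zero_le)
  define K where "K = (\<Sum>n. 1 / (real n + 1)\<^sup>2)"
  define A where "A m j y = cos_coeff m (\<lambda>x. F 0 j x y)" for m j y
  have cx: "continuous_on {0..pi} (\<lambda>x. F i j x y)" if "i \<le> 2" "j \<le> 2" "y \<in> {0..pi}" for i j y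
  proof -
    have "continuous_on {0..pi} (\<lambda>x. (x,y))" by (intro continuous_intros)
    moreover have "(\<lambda>x. (x,y)) ` {0..pi} \<subseteq> {0..pi} \<times> {0..pi}" using that by auto
    ultimately show ?thesis
      using continuous_on_compose2[OF cont[OF that(1,2)], of "{0..pi}" "\<lambda>x. (x,y)"] by simp
  qed
  have cs: "continuous_on ({0..pi} \<times> {0..pi}) (\<lambda>p. F 0 j (snd p) (fst p))" if "j \<le> 2" for j
  proof -
    have "continuous_on ({0..pi} \<times> {0..pi}) (\<lambda>p::real \<times> real. (snd p, fst p))"
      by (intro continuous_intros)
    moreover have "(\<lambda>p. (snd p, fst p)) ` ({0..pi} \<times> {0..pi}) \<subseteq> {0..pi} \<times> {0..pi}" by auto
    ultimately show ?thesis
      using continuous_on_compose2[OF cont[OF _ that, of 0], of "{0..pi} \<times> {0..pi}" "\<lambda>p. (snd p, fst p)"] by simp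
  qed
  have A_bd: "norm (A m j y) \<le> 16 * M / (real m + 1)\<^sup>2" if "j \<le> 2" "y \<in> {0..pi}" for m j y
    unfolding A_def
    by (rule cos_coeff_bound[of _ "\<lambda>x. F 1 j x y" "\<lambda>x. F 2 j x y"])
       (use dx[of 0 j] dx[of 1 j] that cx bd in \<open>auto simp: numeral_2_eq_2\<close>)
  have A_der: "(A m j has_vector_derivative A m (Suc j) y) (at y within {0..pi})" if "j < 2" "y \<in> {0..pi}" for m j y
  proof -
    have "((\<lambda>y. integral (cbox 0 pi) (\<lambda>x. cos (real m * x) *\<^sub>R F 0 j x y)) has_vector_derivative
        integral (cbox 0 pi) (\<lambda>x. cos (real m * x) *\<^sub>R F 0 (Suc j) x y)) (at y within {0..pi})"
    proof (rule leibniz_rule_vector_derivative)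
      fix y x :: real assume "y \<in> {0..pi}" "x \<in> cbox 0 pi"
      then show "((\<lambda>y. cos (real m * x) *\<^sub>R F 0 j x y) has_vector_derivative cos (real m * x) *\<^sub>R F 0 (Suc j) x y) (at y within {0..pi})"
        using dy[of j x y] that
        by (auto intro!: bounded_linear.has_vector_derivative[OF bounded_linear_scaleR_right])
    next
      fix y :: real assume "y \<in> {0..pi}"
      then show "(\<lambda>x. cos (real m * x) *\<^sub>R F 0 j x y) integrable_on cbox 0 pi"
        using cx[of 0 j y] that by (auto intro!: integrable_continuous_interval continuous_intros)
    next
      show "continuous_on ({0..pi} \<times> cbox 0 pi) (\<lambda>(y, x). cos (real m * x) *\<^sub>R F 0 (Suc j) x y)"
        using cs[of "Suc j"] that by (auto simp: case_prod_unfold intro!: continuous_intros)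
    qed (use that in auto)
    then show ?thesis unfolding A_def[abs_def] cos_coeff_def
      by (auto intro!: bounded_linear.has_vector_derivative[OF bounded_linear_scaleR_right])
  qed
  have cA: "continuous_on {0..pi} (A m j)" if "j \<le> 2" for m j
  proof -
    have "continuous_on {0..pi} (\<lambda>y. integral (cbox 0 pi) (\<lambda>x. cos (real m * x) *\<^sub>R F 0 j x y))"
    proof (rule integral_continuous_on_param)
      show "continuous_on ({0..pi} \<times> cbox 0 pi) (\<lambda>(y, x). cos (real m * x) *\<^sub>R F 0 j x y)"
        using cs[OF that] by (auto simp: case_prod_unfold intro!: continuous_intros)
    qed
    then show ?thesis unfolding A_def[abs_def] cos_coeff_def by (auto intro!: continuous_intros)
  qed
  define b where "b m n = cos_coeff n (A m 0)" for m n
  have sK: "summable (\<lambda>n. c * (1 / (real n + 1)\<^sup>2))" for c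
    by (rule summable_mult[OF summable_inverse_Suc_square])
  have b_bd: "norm (b m n) \<le> 256 * M / (real m + 1)\<^sup>2 * (1 / (real n + 1)\<^sup>2)" for m n
  proof -
    have "norm (b m n) \<le> 16 * (16 * M / (real m + 1)\<^sup>2) / (real n + 1)\<^sup>2"
      unfolding b_def
      by (rule cos_coeff_bound[of _ "A m 1" "A m 2"])
         (use A_der[of 0] A_der[of 1] cA A_bd in \<open>auto simp: numeral_2_eq_2\<close>)
    then show ?thesis by simp
  qed
  define T where "T m v = (\<Sum>n. of_real (cos (real n * Im v)) * b m n)" for m v
  define \<tau> where "\<tau> v = (\<Sum>m. of_real (cos (real m * Re v)) * T m v)" for v
  have wT: "wiener (256 * M / (real m + 1)\<^sup>2 * K) (T m)" for m
  proof -
    have "wiener (\<Sum>n. 256 * M / (real m + 1)\<^sup>2 * (1 / (real n + 1)\<^sup>2)) (T m)"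
      unfolding T_def
    proof (rule wiener_suminf[OF _ sK])
      fix n
      have "wiener (1 * norm (b m n)) (\<lambda>v. of_real (cos (real n * Im v)) * b m n)"
        by (intro wiener_mult wiener_cos wiener_const)
      then show "wiener (256 * M / (real m + 1)\<^sup>2 * (1 / (real n + 1)\<^sup>2)) (\<lambda>v. of_real (cos (real n * Im v)) * b m n)"
        using b_bd by (auto elim: wiener_mono)
    qed
    then show ?thesis by (subst (asm) suminf_mult[OF summable_inverse_Suc_square]) (simp add: K_def)
  qed
  have "wiener (\<Sum>m. (256 * M * K) * (1 / (real m + 1)\<^sup>2)) \<tau>"
    unfolding \<tau>_def
  proof (rule wiener_suminf[OF _ sK])
    fix m
    have "wiener (1 * (256 * M / (real m + 1)\<^sup>2 * K)) (\<lambda>v. of_real (cos (real m * Re v)) * T m v)"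
      by (intro wiener_mult wiener_cos wT)
    then show "wiener (256 * M * K * (1 / (real m + 1)\<^sup>2)) (\<lambda>v. of_real (cos (real m * Re v)) * T m v)"
      by (simp add: mult_ac)
  qed
  then have "wiener (cosine_square_const * M) \<tau>"
    by (subst (asm) suminf_mult[OF summable_inverse_Suc_square])
       (simp add: K_def cosine_square_const_def power2_eq_square mult_ac)
  moreover have "\<tau> (Complex x y) = F 0 0 x y" if xy: "x \<in> {0..pi}" "y \<in> {0..pi}" for x y
  proof -
    have "(\<lambda>n. cos (real n * y) *\<^sub>R b m n) sums A m 0 y" for m
      unfolding b_def by (rule cosine_series_sums[OF cA b_bd[unfolded b_def] sK xy(2)]) simp
    then have "T m (Complex x y) = A m 0 y" for m
      by (simp add: T_def sums_iff scaleR_conv_of_real)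
    moreover have "(\<lambda>m. cos (real m * x) *\<^sub>R A m 0 y) sums F 0 0 x y"
      unfolding A_def
    proof (rule cosine_series_sums[OF _ _ sK[of "16 * M"] xy(1)])
      show "continuous_on {0..pi} (\<lambda>x. F 0 0 x y)" using cx xy by auto
      show "norm (cos_coeff n (\<lambda>x. F 0 0 x y)) \<le> 16 * M * (1 / (real n + 1)\<^sup>2)" for n
        using A_bd[of 0 y n] xy by (simp add: A_def)
    qed
    ultimately show ?thesis by (simp add: \<tau>_def sums_iff scaleR_conv_of_real)
  qed
  ultimately show ?thesis by blast
qed

section \<open>Local solutions of the Beltrami equation\<close>

lemma Ck_on_funpow:
  "Ck_on (i + k) S f \<Longrightarrow> Ck_on k S ((partial_re ^^ i) f)"
  "Ck_on (i + k) S f \<Longrightarrow> Ck_on k S ((partial_im ^^ i) f)"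
  by (induction i arbitrary: k) (auto dest: Ck_on_Suc_imp simp flip: add_Suc_right, (metis Ck_on.simps(2) add_Suc_right)+)

text \<open>
  Each derivative of the rescaled function carries a factor \<open>\<epsilon>\<close>, and the difference \<open>\<sigma> - \<sigma> w0\<close> itself is small
  near \<open>w0\<close> by continuity. The square \<open>[0, pi]\<^sup>2\<close> is centred at \<open>w0\<close> after
  rescaling, so that \<open>w0\<close> is an interior point of the region where the representation holds. The
  expansion takes two derivatives in each of the two variables, hence the differentiability class.
\<close>

lemma small_wiener_representation:
  fixes \<sigma> :: "complex \<Rightarrow> complex"
  assumes D: "open D" "w0 \<in> D" and ck: "Ck_on 4 D \<sigma>" and \<delta>: "\<delta> > 0"
  shows "\<exists>\<epsilon>>0. \<exists>\<tau>. wiener \<delta> \<tau> \<and> (\<forall>x\<in>{0..pi}. \<forall>y\<in>{0..pi}.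
           w0 + of_real \<epsilon> * (Complex x y - Complex (pi/2) (pi/2)) \<in> D \<and>
           \<sigma> (w0 + of_real \<epsilon> * (Complex x y - Complex (pi/2) (pi/2))) = \<sigma> w0 + \<tau> (Complex x y))"
proof -
  define c0 where "c0 = Complex (pi/2) (pi/2)"
  define \<sigma>' where "\<sigma>' w = \<sigma> w - \<sigma> w0" for w
  define G where "G i j = (partial_re ^^ i) ((partial_im ^^ j) \<sigma>')" for i j
  have ck': "Ck_on 4 D \<sigma>'" unfolding \<sigma>'_def by (intro Ck_on_diff ck D Ck_on_const)
  have GC: "Ck_on k D (G i j)" if "k + i + j = 4" for i j k
    unfolding G_def by (intro Ck_on_funpow) (use ck' that in \<open>simp add: add_ac\<close>)
  have Gcont: "continuous_on D (G i j)" if "i \<le> 2" "j \<le> 2" for i j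
    by (rule Ck_on_imp_continuous_on[OF GC[of "4 - i - j"]]) (use that in simp)
  obtain R where R: "R > 0" "cball w0 R \<subseteq> D" using D open_contains_cball by blast
  have "\<exists>C. \<forall>i\<in>{..2}. \<forall>j\<in>{..2}. \<forall>w\<in>cball w0 R. norm (G i j w) \<le> C"
  proof -
    have "\<exists>C. \<forall>w\<in>cball w0 R. norm (G i j w) \<le> C" if "i \<le> 2" "j \<le> 2" for i j
    proof -
      have "compact (G i j ` cball w0 R)"
        using Gcont[OF that] R by (intro compact_continuous_image) (auto intro: continuous_on_subset)
      then show ?thesis by (auto dest: compact_imp_bounded simp: bounded_iff)
    qed
    then obtain C where C: "\<And>i j w. i \<le> 2 \<Longrightarrow> j \<le> 2 \<Longrightarrow> w \<in> cball w0 R \<Longrightarrow> norm (G i j w) \<le> C i j" by metis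
    have "norm (G i j w) \<le> Max ((\<lambda>(i,j). C i j) ` ({..2} \<times> {..2}))" if "i \<le> 2" "j \<le> 2" "w \<in> cball w0 R" for i j w
      by (rule order_trans[OF C[OF that]], rule Max_ge) (use that in auto)
    then show ?thesis by (intro exI[of _ "Max ((\<lambda>(i,j). C i j) ` ({..2} \<times> {..2}))"]) auto
  qed
  then obtain C where C: "\<And>i j w. i \<le> 2 \<Longrightarrow> j \<le> 2 \<Longrightarrow> w \<in> cball w0 R \<Longrightarrow> norm (G i j w) \<le> C"
    by (meson atMost_iff)
  have C0: "C \<ge> 0" using C[of 0 0 w0] R norm_ge_zero order_trans by (metis centre_in_cball less_imp_le zero_le)
  have sq: "cosine_square_const \<ge> 0" by (simp add: cosine_square_const_def)
  define M where "M = \<delta> / (cosine_square_const + 1)"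
  have M: "M > 0" using \<delta> sq by (simp add: M_def)
  have "continuous_on D \<sigma>'" using Ck_on_imp_continuous_on ck' by blast
  then have "isCont \<sigma>' w0" using D continuous_on_eq_continuous_at by blast
  then obtain r where r: "r > 0" "\<And>w. dist w w0 < r \<Longrightarrow> norm (\<sigma>' w) < M"
    unfolding continuous_at_eps_delta using M by (auto simp: \<sigma>'_def dist_norm norm_minus_commute)
  \<comment> \<open>Points of the rescaled square have distance at most \<open>4 * \<epsilon>\<close> from \<open>w0\<close>, as \<open>pi < 4\<close>.\<close>
  define \<epsilon> where "\<epsilon> = Min {1, R / 4, r / 5, M / (C + 1)}"
  have \<epsilon>: "\<epsilon> > 0" "\<epsilon> \<le> 1" "\<epsilon> \<le> R / 4" "\<epsilon> \<le> r / 5" "\<epsilon> \<le> M / (C + 1)"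
  proof -
    have le: "\<epsilon> \<le> x" if "x \<in> {1, R / 4, r / 5, M / (C + 1)}" for x
      unfolding \<epsilon>_def by (rule Min_le) (use that in auto)
    show "\<epsilon> \<le> 1" "\<epsilon> \<le> R / 4" "\<epsilon> \<le> r / 5" "\<epsilon> \<le> M / (C + 1)" by (rule le, simp)+
    show "\<epsilon> > 0" using R r M C0 by (simp add: \<epsilon>_def)
  qed
  define pt where "pt x y = w0 + of_real \<epsilon> * (Complex x y - c0)" for x y
  have ptd: "dist (pt x y) w0 \<le> 4 * \<epsilon>" if "x \<in> {0..pi}" "y \<in> {0..pi}" for x y
  proof -
    have "norm (Complex x y - c0) \<le> \<bar>x - pi/2\<bar> + \<bar>y - pi/2\<bar>"
      using cmod_le[of "Complex x y - c0"] by (simp add: c0_def)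
    also have "\<dots> \<le> pi" using that by (auto simp: abs_if)
    also have "\<dots> \<le> 4" using pi_less_4 by simp
    finally show ?thesis using \<epsilon> by (simp add: pt_def dist_norm norm_mult)
  qed
  have ptR: "pt x y \<in> cball w0 R" if "x \<in> {0..pi}" "y \<in> {0..pi}" for x y
    using ptd[OF that] \<epsilon> by (simp add: dist_commute)
  have ptD: "pt x y \<in> D" if "x \<in> {0..pi}" "y \<in> {0..pi}" for x y
    using ptR[OF that] R by auto
  define F where "F i j x y = of_real (\<epsilon> ^ (i + j)) * G i j (pt x y)" for i j x y
  have dpt: "((\<lambda>x. pt x y) has_derivative (\<lambda>t. of_real (\<epsilon> * t))) (at x within A)"
     "((\<lambda>y. pt x y) has_derivative (\<lambda>t. \<i> * of_real (\<epsilon> * t))) (at y within A)" for x y A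
    unfolding pt_def Complex_eq by (auto intro!: derivative_eq_intros simp: algebra_simps)
  have Gd: "(G i j has_derivative (\<lambda>h. Re h *\<^sub>R partial_re (G i j) w + Im h *\<^sub>R partial_im (G i j) w)) (at w)"
    if "i + j \<le> 3" "w \<in> D" for i j w
    by (rule Ck_on_SucD[OF GC[of "Suc (3 - i - j)"] that(2)]) (use that in simp)
  have "\<exists>\<tau>. wiener (cosine_square_const * M) \<tau> \<and> (\<forall>x\<in>{0..pi}. \<forall>y\<in>{0..pi}. \<tau> (Complex x y) = F 0 0 x y)"
  proof (rule cosine_series_square[of F])
    fix i j :: nat and x y :: real assume *: "i < 2" "j \<le> 2" "x \<in> {0..pi}" "y \<in> {0..pi}"
    have "((\<lambda>x. G i j (pt x y)) has_derivative (\<lambda>t. \<epsilon> * t *\<^sub>R partial_re (G i j) (pt x y))) (at x within {0..pi})"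
      by (rule has_derivative_eq_rhs[OF has_derivative_compose[OF dpt(1)[of y x] Gd[OF _ ptD]]])
         (use * in \<open>auto simp: fun_eq_iff scaleR_conv_of_real\<close>)
    then have "((\<lambda>x. G i j (pt x y)) has_vector_derivative \<epsilon> *\<^sub>R partial_re (G i j) (pt x y)) (at x within {0..pi})"
      unfolding has_vector_derivative_def
      by (rule has_derivative_eq_rhs) (simp add: fun_eq_iff scaleR_conv_of_real)
    from bounded_linear.has_vector_derivative[OF bounded_linear_mult_right this, of "of_real (\<epsilon> ^ (i + j))"]
    show "((\<lambda>x. F i j x y) has_vector_derivative F (Suc i) j x y) (at x within {0..pi})"
      by (simp add: F_def G_def scaleR_conv_of_real mult_ac)
  next
    fix j :: nat and x y :: real assume *: "j < 2" "x \<in> {0..pi}" "y \<in> {0..pi}"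
    have "((\<lambda>y. G 0 j (pt x y)) has_derivative (\<lambda>t. \<epsilon> * t *\<^sub>R partial_im (G 0 j) (pt x y))) (at y within {0..pi})"
      by (rule has_derivative_eq_rhs[OF has_derivative_compose[OF dpt(2)[of x y] Gd[OF _ ptD]]])
         (use * in \<open>auto simp: fun_eq_iff scaleR_conv_of_real\<close>)
    then have "((\<lambda>y. G 0 j (pt x y)) has_vector_derivative \<epsilon> *\<^sub>R partial_im (G 0 j) (pt x y)) (at y within {0..pi})"
      unfolding has_vector_derivative_def
      by (rule has_derivative_eq_rhs) (simp add: fun_eq_iff scaleR_conv_of_real)
    from bounded_linear.has_vector_derivative[OF bounded_linear_mult_right this, of "of_real (\<epsilon> ^ j)"]
    show "((\<lambda>y. F 0 j x y) has_vector_derivative F 0 (Suc j) x y) (at y within {0..pi})"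
      by (simp add: F_def G_def scaleR_conv_of_real mult_ac)
  next
    fix i j :: nat assume *: "i \<le> 2" "j \<le> 2"
    have "continuous_on ({0..pi} \<times> {0..pi}) (\<lambda>p. pt (fst p) (snd p))"
      unfolding pt_def Complex_eq by (intro continuous_intros)
    then have "continuous_on ({0..pi} \<times> {0..pi}) (\<lambda>p. G i j (pt (fst p) (snd p)))"
      by (rule continuous_on_compose2[OF Gcont[OF *]]) (use ptD in auto)
    then show "continuous_on ({0..pi} \<times> {0..pi}) (\<lambda>(x,y). F i j x y)"
      unfolding F_def by (auto simp: case_prod_unfold intro!: continuous_intros)
  next
    fix i j :: nat and x y :: real assume *: "i \<le> 2" "j \<le> 2" "x \<in> {0..pi}" "y \<in> {0..pi}"
    show "norm (F i j x y) \<le> M"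
    proof (cases "i + j = 0")
      case True
      have "dist (pt x y) w0 < r" using ptd[OF *(3,4)] \<epsilon> r(1) by simp
      then show ?thesis using True r(2)[of "pt x y"] by (simp add: F_def G_def)
    next
      case False
      have "norm (F i j x y) = \<epsilon> ^ (i + j) * norm (G i j (pt x y))"
        using \<epsilon> by (simp add: F_def norm_mult norm_power)
      also have "\<dots> \<le> \<epsilon> * C"
      proof (rule mult_mono)
        show "\<epsilon> ^ (i + j) \<le> \<epsilon>" using power_decreasing[of 1 "i + j" \<epsilon>] False \<epsilon> by simp
        show "norm (G i j (pt x y)) \<le> C" by (rule C[OF *(1,2) ptR[OF *(3,4)]])
      qed (use \<epsilon> in auto)
      also have "\<dots> \<le> M / (C + 1) * (C + 1)" using \<epsilon> C0 by (intro mult_mono) auto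
      finally show ?thesis using C0 by simp
    qed
  qed
  then obtain \<tau> where \<tau>: "wiener (cosine_square_const * M) \<tau>" "\<And>x y. x\<in>{0..pi} \<Longrightarrow> y\<in>{0..pi} \<Longrightarrow> \<tau> (Complex x y) = F 0 0 x y"
    by auto
  have "cosine_square_const * M \<le> \<delta>" using sq \<delta> by (simp add: M_def field_simps)
  then have "wiener \<delta> \<tau>" using \<tau> wiener_mono by blast
  moreover have "\<sigma> (pt x y) = \<sigma> w0 + \<tau> (Complex x y)" if "x\<in>{0..pi}" "y\<in>{0..pi}" for x y
    using \<tau>(2)[OF that] by (simp add: F_def G_def \<sigma>'_def)
  ultimately show ?thesis using \<epsilon>(1) ptD unfolding pt_def c0_def by blast
qed

text \<open>
  The Beltrami equation is invariant under similarities of the independent variable, so a solution for the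
  rescaled coefficient can be carried back to a neighbourhood of \<open>w0\<close>.
\<close>

lemma local_beltrami_solution:
  fixes \<sigma> :: "complex \<Rightarrow> complex"
  assumes D: "open D" "w0 \<in> D" and ck: "Ck_on 4 D \<sigma>" and \<sigma>: "norm (\<sigma> w0) < 1"
  shows "\<exists>U chi \<alpha>. open U \<and> w0 \<in> U \<and> U \<subseteq> D \<and> continuous_on U \<alpha> \<and> (\<forall>w\<in>U. \<alpha> w \<noteq> 0) \<and>
     (\<forall>w\<in>U. (chi has_derivative (\<lambda>u. \<alpha> w * u + \<sigma> w * \<alpha> w * cnj u)) (at w))"
proof -
  define \<delta> where "\<delta> = (1 - norm (\<sigma> w0)) / 4"
  have \<delta>: "\<delta> > 0" "norm (\<sigma> w0) + 2 * \<delta> < 1" using \<sigma> by (auto simp: \<delta>_def field_simps)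
  define c0 where "c0 = Complex (pi/2) (pi/2)"
  obtain \<epsilon> \<tau> where \<epsilon>: "\<epsilon> > 0" and \<tau>: "wiener \<delta> \<tau>"
    and rep: "\<And>x y. x\<in>{0..pi} \<Longrightarrow> y\<in>{0..pi} \<Longrightarrow> w0 + of_real \<epsilon> * (Complex x y - c0) \<in> D \<and>
           \<sigma> (w0 + of_real \<epsilon> * (Complex x y - c0)) = \<sigma> w0 + \<tau> (Complex x y)"
    using small_wiener_representation[OF D ck \<delta>(1)] unfolding c0_def by blast
  obtain X G where G: "continuous_on UNIV G" "\<And>v. norm (G v) < 1"
    and X: "\<And>v. (X has_derivative (\<lambda>u. (1 + G v) * u + (\<sigma> w0 + \<tau> v) * (1 + G v) * cnj u)) (at v)"
    using wiener_beltrami[OF \<tau> \<delta>(2)] by blast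
  define L where "L w = (w - w0) / of_real \<epsilon> + c0" for w
  define U where "U = L -` {v. 0 < Re v \<and> Re v < pi \<and> 0 < Im v \<and> Im v < pi}"
  have cL: "continuous_on UNIV L" unfolding L_def using \<epsilon> by (intro continuous_intros) auto
  have "open {v. 0 < Re v \<and> Re v < pi \<and> 0 < Im v \<and> Im v < pi}"
    by (intro open_Collect_conj open_Collect_less continuous_intros)
  then have oU: "open U" unfolding U_def by (rule open_vimage[OF _ cL])
  have U: "w \<in> D \<and> \<sigma> w = \<sigma> w0 + \<tau> (L w)" if "w \<in> U" for w
  proof -
    have "w0 + of_real \<epsilon> * (L w - c0) = w" using \<epsilon> by (simp add: L_def)
    then show ?thesis using rep[of "Re (L w)" "Im (L w)"] that by (auto simp: U_def)
  qed
  have "w0 \<in> U" by (simp add: U_def L_def c0_def)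
  moreover have "(1 + G v) / of_real \<epsilon> \<noteq> 0" for v
  proof
    assume "(1 + G v) / of_real \<epsilon> = 0"
    then have "G v = -1" using \<epsilon> by (simp add: add_eq_0_iff)
    then show False using G(2)[of v] by simp
  qed
  moreover have "continuous_on U (\<lambda>w. (1 + G (L w)) / of_real \<epsilon>)"
    using \<epsilon> by (auto intro!: continuous_intros continuous_on_compose2[OF G(1)] continuous_on_subset[OF cL])
  moreover have "((\<lambda>w. X (L w)) has_derivative
      (\<lambda>u. (1 + G (L w)) / of_real \<epsilon> * u + \<sigma> w * ((1 + G (L w)) / of_real \<epsilon>) * cnj u)) (at w)" if "w \<in> U" for w
  proof -
    have "(L has_derivative (\<lambda>u. u / of_real \<epsilon>)) (at w)"
      unfolding L_def using \<epsilon> by (auto intro!: derivative_eq_intros)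
    from has_derivative_compose[OF this X] show ?thesis
      by (rule has_derivative_eq_rhs) (use U[OF that] in \<open>simp add: fun_eq_iff\<close>)
  qed
  moreover have "U \<subseteq> D" using U by blast
  ultimately show ?thesis using oU
    by (intro exI[of _ U] exI[of _ "\<lambda>w. X (L w)"] exI[of _ "\<lambda>w. (1 + G (L w)) / of_real \<epsilon>"] conjI ballI)
qed

lemma real_linear_inverse:
  fixes p q k u :: complex
  assumes "norm p \<noteq> norm q"
  shows "p * u + q * cnj u = k \<longleftrightarrow> u = (cnj p * k - q * cnj k) / of_real ((norm p)\<^sup>2 - (norm q)\<^sup>2)"
proof -
  have J: "of_real ((norm p)\<^sup>2 - (norm q)\<^sup>2) = p * cnj p - q * cnj q"
    by (simp add: complex_norm_square del: of_real_power) 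
  have "(norm p)\<^sup>2 - (norm q)\<^sup>2 \<noteq> 0" using assms by simp
  then have J0: "p * cnj p - q * cnj q \<noteq> 0" using J of_real_eq_0_iff by metis
  have c: "cnj (p * cnj p - q * cnj q) = p * cnj p - q * cnj q" by (simp add: mult.commute)
  show ?thesis unfolding J
  proof
    assume "p * u + q * cnj u = k"
    then show "u = (cnj p * k - q * cnj k) / (p * cnj p - q * cnj q)"
      using J0 by (auto simp: field_simps)
  next
    assume u: "u = (cnj p * k - q * cnj k) / (p * cnj p - q * cnj q)"
    have "cnj u = (p * cnj k - cnj q * k) / (p * cnj p - q * cnj q)"
      unfolding u by (simp only: complex_cnj_divide c) simp
    then have "p * u + q * cnj u = (p * (cnj p * k - q * cnj k) + q * (p * cnj k - cnj q * k)) / (p * cnj p - q * cnj q)"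
      unfolding u by (simp add: add_divide_distrib)
    also have "p * (cnj p * k - q * cnj k) + q * (p * cnj k - cnj q * k) = (p * cnj p - q * cnj q) * k"
      by (simp add: algebra_simps)
    finally show "p * u + q * cnj u = k" using J0 by simp
  qed
qed

text \<open>
  The explicit derivative of the inverse is what later expresses the derivatives of \<open>zinv \<circ> \<chi>\<^sup>-\<^sup>1\<close>.
\<close>

lemma wirtinger_inverse_function:
  fixes f p q :: "complex \<Rightarrow> complex"
  assumes U: "open U" "w0 \<in> U"
    and der: "\<And>w. w \<in> U \<Longrightarrow> (f has_derivative (\<lambda>u. p w * u + q w * cnj u)) (at w)"
    and cont: "continuous_on U p" "continuous_on U q"
    and J: "\<And>w. w \<in> U \<Longrightarrow> norm (p w) \<noteq> norm (q w)"
  obtains U' V g where "open U'" "U' \<subseteq> U" "w0 \<in> U'" "open V" "homeomorphism U' V f g"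
    "\<And>y. y \<in> V \<Longrightarrow> (g has_derivative (\<lambda>k. (cnj (p (g y)) * k - q (g y) * cnj k) /
        of_real ((norm (p (g y)))\<^sup>2 - (norm (q (g y)))\<^sup>2))) (at y)"
proof -
  define cb where "cb = Blinfun cnj"
  have cb: "blinfun_apply cb = cnj" unfolding cb_def by (rule bounded_linear_Blinfun_apply[OF bounded_linear_cnj])
  define L where "L a b = blinfun_mult_right a + (blinfun_mult_right b o\<^sub>L cb)" for a b :: complex
  have L: "blinfun_apply (L a b) u = a * u + b * cnj u" for a b u
    by (simp add: L_def blinfun.add_left cb)
  define inv0 where "inv0 = L (cnj (p w0) / of_real ((norm (p w0))\<^sup>2 - (norm (q w0))\<^sup>2)) (- q w0 / of_real ((norm (p w0))\<^sup>2 - (norm (q w0))\<^sup>2))"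
  have inv0: "blinfun_apply inv0 k = (cnj (p w0) * k - q w0 * cnj k) / of_real ((norm (p w0))\<^sup>2 - (norm (q w0))\<^sup>2)" for k
    by (simp add: inv0_def L diff_divide_distrib)
  have cL: "continuous_on U (\<lambda>w. L (p w) (q w))"
    unfolding L_def
    by (intro continuous_intros bounded_linear.continuous_on[OF bounded_linear_blinfun_mult_right] cont
        bounded_bilinear.continuous_on[OF bounded_bilinear_blinfun_compose])
  have i0: "inv0 o\<^sub>L L (p w0) (q w0) = id_blinfun"
  proof (rule blinfun_eqI)
    fix u
    show "blinfun_apply (inv0 o\<^sub>L L (p w0) (q w0)) u = blinfun_apply id_blinfun u"
      using real_linear_inverse[OF J[OF U(2)], of u "p w0 * u + q w0 * cnj u"] by (simp add: inv0 L)
  qed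
  have der': "(f has_derivative blinfun_apply (L (p w) (q w))) (at w)" if "w \<in> U" for w
    using der[OF that] by (simp add: L[abs_def])
  obtain U' V g g' where *: "open U'" "U' \<subseteq> U" "w0 \<in> U'" "open V" "f w0 \<in> V" "homeomorphism U' V f g"
    "\<And>y. y \<in> V \<Longrightarrow> (g has_derivative (g' y)) (at y)"
    "\<And>y. y \<in> V \<Longrightarrow> g' y = inv (blinfun_apply (L (p (g y)) (q (g y))))"
    using inverse_function_theorem[OF U(1) der' cL U(2) i0] by metis
  have "(g has_derivative (\<lambda>k. (cnj (p (g y)) * k - q (g y) * cnj k) /
        of_real ((norm (p (g y)))\<^sup>2 - (norm (q (g y)))\<^sup>2))) (at y)" if "y \<in> V" for y
  proof -
    have gU: "g y \<in> U" using *(2,6) that by (auto simp: homeomorphism_def)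
    let ?h = "\<lambda>k. (cnj (p (g y)) * k - q (g y) * cnj k) / of_real ((norm (p (g y)))\<^sup>2 - (norm (q (g y)))\<^sup>2)"
    have "inv (blinfun_apply (L (p (g y)) (q (g y)))) = ?h"
    proof (rule inv_equality)
      show "?h (blinfun_apply (L (p (g y)) (q (g y))) u) = u" for u
        using real_linear_inverse[OF J[OF gU], of u "p (g y) * u + q (g y) * cnj u"] by (simp add: L)
      show "blinfun_apply (L (p (g y)) (q (g y))) (?h k) = k" for k
        using real_linear_inverse[OF J[OF gU], of "?h k" k] by (simp add: L)
    qed
    then show ?thesis using *(7,8)[OF that] by simp
  qed
  with * that show thesis by blast
qed

section \<open>Factorization of solutions\<close>

text \<open>
  With \<open>\<kappa>\<close> frozen at \<open>x0\<close>, the function \<open>Y = Z - \<kappa> x0 * cnj Z\<close> is complex differentiable at \<open>x0\<close>: the parts of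
  its derivative that involve \<open>cnj k\<close> cancel. Conversely \<open>Z\<close> is bounded by a multiple of \<open>Y\<close>, because
  \<open>norm (\<kappa> x0) \<noteq> 1\<close>. So the error made by freezing \<open>\<kappa>\<close>, which is only continuous, is of smaller order
  than \<open>x - x0\<close>.
\<close>

lemma beltrami_zero_quotient_limit:
  fixes Z \<kappa> :: "complex \<Rightarrow> complex" and P :: complex
  assumes V: "open V" "x0 \<in> V"
    and der: "(Z has_derivative (\<lambda>k. P * k + \<kappa> x0 * cnj P * cnj k)) (at x0)"
    and P: "P \<noteq> 0" and \<kappa>: "isCont \<kappa> x0" "norm (\<kappa> x0) \<noteq> 1" and Z0: "Z x0 = 0"
  shows "((\<lambda>x. (Z x - \<kappa> x * cnj (Z x)) / (x - x0)) \<longlongrightarrow> P * of_real (1 - (norm (\<kappa> x0))\<^sup>2)) (at x0)"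
proof -
  define k0 where "k0 = \<kappa> x0"
  define J where "J = 1 - (norm k0)\<^sup>2"
  have J: "J \<noteq> 0" using \<kappa>(2) by (simp add: J_def k0_def abs_square_eq_1)
  have Jc: "of_real J = 1 - k0 * cnj k0" by (simp add: J_def complex_norm_square del: of_real_power)
  define Y where "Y x = Z x - k0 * cnj (Z x)" for x
  have "(Y has_derivative (\<lambda>k. P * k + \<kappa> x0 * cnj P * cnj k - k0 * cnj (P * k + \<kappa> x0 * cnj P * cnj k))) (at x0)"
    unfolding Y_def by (intro has_derivative_diff has_derivative_mult_right has_derivative_cnj der)
  also have "(\<lambda>k. P * k + \<kappa> x0 * cnj P * cnj k - k0 * cnj (P * k + \<kappa> x0 * cnj P * cnj k)) = (*) (P * of_real J)"
    by (simp add: fun_eq_iff Jc k0_def algebra_simps)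
  finally have "(Y has_field_derivative P * of_real J) (at x0)"
    by (simp add: has_field_derivative_def)
  then have Yl: "((\<lambda>x. Y x / (x - x0)) \<longlongrightarrow> P * of_real J) (at x0)"
    by (simp add: has_field_derivative_iff Y_def Z0)
  have Zb: "norm (Z x) \<le> (1 + norm k0) / \<bar>J\<bar> * norm (Y x)" for x
  proof -
    have "of_real J * Z x = Y x + k0 * cnj (Y x)" unfolding Jc Y_def by (simp add: algebra_simps)
    then have "\<bar>J\<bar> * norm (Z x) = norm (Y x + k0 * cnj (Y x))" by (metis norm_mult norm_of_real)
    also have "\<dots> \<le> norm (Y x) + norm k0 * norm (Y x)"
      using norm_triangle_ineq[of "Y x" "k0 * cnj (Y x)"] by (simp add: norm_mult)
    finally show ?thesis using J by (simp add: field_simps)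
  qed
  have "((\<lambda>x. (\<kappa> x - k0) * cnj (Z x) / (x - x0)) \<longlongrightarrow> 0) (at x0)"
  proof (rule Lim_null_comparison)
    show "\<forall>\<^sub>F x in at x0. norm ((\<kappa> x - k0) * cnj (Z x) / (x - x0))
        \<le> norm (\<kappa> x - k0) * ((1 + norm k0) / \<bar>J\<bar> * norm (Y x / (x - x0)))"
    proof (intro always_eventually allI)
      fix x
      have "norm ((\<kappa> x - k0) * cnj (Z x) / (x - x0)) = norm (\<kappa> x - k0) * (norm (Z x) / norm (x - x0))"
        by (simp add: norm_mult norm_divide)
      also have "\<dots> \<le> norm (\<kappa> x - k0) * ((1 + norm k0) / \<bar>J\<bar> * norm (Y x) / norm (x - x0))"
        by (intro mult_left_mono divide_right_mono Zb) auto
      finally show "norm ((\<kappa> x - k0) * cnj (Z x) / (x - x0))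
        \<le> norm (\<kappa> x - k0) * ((1 + norm k0) / \<bar>J\<bar> * norm (Y x / (x - x0)))"
        by (simp add: norm_divide)
    qed
    have "((\<lambda>x. \<kappa> x - k0) \<longlongrightarrow> 0) (at x0)"
      using \<kappa>(1) by (simp add: isCont_def k0_def LIM_zero_iff)
    from tendsto_mult[OF tendsto_norm[OF this] tendsto_mult[OF tendsto_const[of "(1 + norm k0) / \<bar>J\<bar>"] tendsto_norm[OF Yl]]]
    show "((\<lambda>x. norm (\<kappa> x - k0) * ((1 + norm k0) / \<bar>J\<bar> * norm (Y x / (x - x0)))) \<longlongrightarrow> 0) (at x0)"
      by simp
  qed
  from tendsto_diff[OF Yl this] show ?thesis
    by (simp add: Y_def J_def k0_def algebra_simps diff_divide_distrib)
qed

text \<open>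
  The right-hand side is the solution of \<open>W = Z - \<kappa> * cnj Z\<close> for \<open>Z\<close>, so only \<open>W = exp s * f\<close> has to be
  achieved. Since \<open>P\<close> has no zeros, a zero of \<open>W\<close> at \<open>x0\<close> is simple in the sense of the preceding lemma;
  after division by \<open>x - x0\<close> a continuous function without zeros near \<open>x0\<close> is left, and this has a
  continuous logarithm.
\<close>

lemma similarity_representation:
  fixes Z P \<kappa> :: "complex \<Rightarrow> complex"
  assumes V: "open V" "x0 \<in> V"
    and der: "\<And>x. x \<in> V \<Longrightarrow> (Z has_derivative (\<lambda>k. P x * k + \<kappa> x * cnj (P x) * cnj k)) (at x)"
    and P: "\<And>x. x \<in> V \<Longrightarrow> P x \<noteq> 0"
    and \<kappa>: "continuous_on V \<kappa>" "\<And>x. x \<in> V \<Longrightarrow> norm (\<kappa> x) \<noteq> 1"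
  obtains V' s f where "open V'" "x0 \<in> V'" "V' \<subseteq> V" "continuous_on V' s" "f analytic_on V'"
    "\<And>x. x \<in> V' \<Longrightarrow> Z x = (exp (s x) * f x + \<kappa> x * cnj (f x * exp (s x))) / of_real (1 - (norm (\<kappa> x))\<^sup>2)"
proof -
  define W where "W x = Z x - \<kappa> x * cnj (Z x)" for x
  have J: "(1 - (norm (\<kappa> x))\<^sup>2) \<noteq> 0" if "x \<in> V" for x
    using \<kappa>(2)[OF that] by (simp add: abs_square_eq_1)
  have cZ: "continuous_on V Z"
    using der has_derivative_continuous by (blast intro: continuous_at_imp_continuous_on)
  have cW: "continuous_on V W" unfolding W_def by (intro continuous_intros cZ \<kappa>)
  have ZW: "Z x = (W x + \<kappa> x * cnj (W x)) / of_real (1 - (norm (\<kappa> x))\<^sup>2)" if "x \<in> V" for x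
  proof -
    have "W x + \<kappa> x * cnj (W x) = Z x * of_real (1 - (norm (\<kappa> x))\<^sup>2)"
      by (simp add: W_def complex_norm_square algebra_simps del: of_real_power)
    moreover have "complex_of_real (1 - (norm (\<kappa> x))\<^sup>2) \<noteq> 0" using J[OF that] of_real_eq_0_iff by blast
    ultimately show ?thesis by (metis nonzero_mult_div_cancel_right)
  qed
  obtain f Q where f: "f analytic_on V" and Q: "continuous_on V Q" "Q x0 \<noteq> 0"
     and WfQ: "\<And>x. x \<in> V \<Longrightarrow> W x = f x * Q x"
  proof (cases "Z x0 = 0")
    case True
    define L where "L = P x0 * of_real (1 - (norm (\<kappa> x0))\<^sup>2)"
    define Q where "Q x = (if x = x0 then L else W x / (x - x0))" for x
    have lim: "((\<lambda>x. W x / (x - x0)) \<longlongrightarrow> L) (at x0)"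
      unfolding W_def L_def
    proof (rule beltrami_zero_quotient_limit[of V x0 Z "P x0" \<kappa>])
      show "isCont \<kappa> x0" using V \<kappa> continuous_on_eq_continuous_at by blast
    qed (use V P der \<kappa> True in auto)
    have "continuous_on V Q"
    proof (rule continuous_at_imp_continuous_on, intro ballI)
      fix x assume x: "x \<in> V"
      show "isCont Q x"
      proof (cases "x = x0")
        case True
        have "(Q \<longlongrightarrow> L) (at x0)"
          by (rule Lim_transform_eventually[OF lim]) (auto simp: Q_def eventually_at_filter)
        then show ?thesis using True by (simp add: isCont_def Q_def)
      next
        case False
        have "isCont (\<lambda>x. W x / (x - x0)) x"
          using cW V x False continuous_on_eq_continuous_at by (auto intro!: continuous_intros)
        moreover have "\<forall>\<^sub>F y in nhds x. W y / (y - x0) = Q y"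
          using t1_space_nhds[OF False] by eventually_elim (simp add: Q_def)
        ultimately show ?thesis by (metis isCont_cong)
      qed
    qed
    moreover have "W x0 = 0" using True by (simp add: W_def)
    moreover have "complex_of_real (1 - (norm (\<kappa> x0))\<^sup>2) \<noteq> 0"
      using J[OF V(2)] of_real_eq_0_iff by blast
    then have "Q x0 \<noteq> 0" using P[OF V(2)]
      by (simp add: Q_def L_def del: of_real_diff of_real_power of_real_eq_0_iff)
    ultimately show thesis
      by (intro that[of "\<lambda>x. x - x0" Q]) (auto simp: Q_def intro!: analytic_intros)
  next
    case False
    have "W x0 \<noteq> 0" using ZW[OF V(2)] False by auto
    then show thesis using cW by (intro that[of "\<lambda>_. 1" W]) auto
  qed
  define V' where "V' = V \<inter> (\<lambda>x. Q x / Q x0) -` {z. Re z > 0}"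
  have "continuous_on V (\<lambda>x. Q x / Q x0)" using Q by (intro continuous_intros) auto
  then have "open V'" unfolding V'_def
    by (intro continuous_open_preimage V open_halfspace_Re_gt)
  moreover have "x0 \<in> V'" using V Q by (simp add: V'_def)
  moreover have V'V: "V' \<subseteq> V" by (auto simp: V'_def)
  moreover have "continuous_on V' (\<lambda>x. Ln (Q x / Q x0) + Ln (Q x0))"
  proof (intro continuous_intros)
    show "continuous_on V' Q" using Q V'V continuous_on_subset by blast
    show "Q x / Q x0 \<notin> \<real>\<^sub>\<le>\<^sub>0" if "x \<in> V'" for x
      using that by (auto simp: V'_def complex_nonpos_Reals_iff)
  qed (use Q in auto)
  moreover have "f analytic_on V'" using f V'V analytic_on_subset by blast
  moreover have "exp (Ln (Q x / Q x0) + Ln (Q x0)) = Q x" if "x \<in> V'" for x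
  proof -
    have "Q x / Q x0 \<noteq> 0" using that by (auto simp: V'_def)
    then show ?thesis using Q by (simp add: exp_add)
  qed
  ultimately show thesis
    using ZW WfQ by (intro that[of V' "\<lambda>x. Ln (Q x / Q x0) + Ln (Q x0)" f]) (auto simp: mult.commute subset_iff)
qed

section \<open>The characteristic equation and the leading derivative\<close>

text \<open>
  Let \<open>E = \<bar>a\<bar>\<^sup>2 + \<bar>d\<bar>\<^sup>2 - \<bar>b\<bar>\<^sup>2 - \<bar>c\<bar>\<^sup>2\<close> and \<open>F = a cnj d - c cnj b\<close>, both divided by the common denominator.
  For a real covector with complex component \<open>\<xi>\<close>, the determinant of the symbol of
  \<open>a cnj p + b p = c q + d cnj q\<close> is proportional to \<open>E \<bar>\<xi>\<bar>\<^sup>2 - 2 Re (F (cnj \<xi>)\<^sup>2)\<close>. The coefficients \<open>A\<^sub>i\<^sub>j\<close> satisfy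
  \<open>A\<^sub>1\<^sub>2 + A\<^sub>2\<^sub>1 = 2 E\<close>, \<open>A\<^sub>1\<^sub>2 - A\<^sub>2\<^sub>1 = 4 Re F\<close> and \<open>A\<^sub>1\<^sub>1 + A\<^sub>2\<^sub>2 = 4 Im F\<close>. Thus the assumptions say
  \<open>2 \<bar>F\<bar> < E\<close>, and \<open>\<sigma>\<close> is the root of modulus less than one of \<open>E \<sigma> = F \<sigma>\<^sup>2 + cnj F\<close>; the third claim is this equation
  without the denominator, in factorized form.
\<close>

lemma beltrami_coeff_characteristic:
  assumes den: "denom a b c d \<noteq> 0"
    and ell: "4 * A12 a b c d * A21 a b c d - (A11 a b c d + A22 a b c d)\<^sup>2 > 0"
    and pos: "A12 a b c d > 0"
    and \<sigma>: "\<sigma> = beltrami_coeff (A11 a b c d) (A12 a b c d) (A21 a b c d) (A22 a b c d)"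
  shows "norm \<sigma> < 1" "A12 a b c d + A21 a b c d > 0"
    and "(a * \<sigma> - d) * (cnj a - cnj d * \<sigma>) = (b - c * \<sigma>) * (cnj b * \<sigma> - cnj c)"
    and "(norm a)\<^sup>2 + (norm d)\<^sup>2 \<noteq> (norm b)\<^sup>2 + (norm c)\<^sup>2"
proof -
  define N where "N = denom a b c d"
  define e where "e = (norm a)\<^sup>2 + (norm d)\<^sup>2 - (norm b)\<^sup>2 - (norm c)\<^sup>2"
  define \<phi> where "\<phi> = a * cnj d - c * cnj b"
  have N: "N \<noteq> 0" using den by (simp add: N_def)
  define E where "E = e / N"
  define F where "F = \<phi> / of_real N"
  have S: "A12 a b c d + A21 a b c d = 2 * E"
    unfolding A12_def A21_def N_def[symmetric] E_def e_def add_divide_distrib[symmetric] times_divide_eq_right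
    by (rule arg_cong[of _ _ "\<lambda>x. x / N"]) (simp add: cmod_power2, algebra)
  have D: "A12 a b c d - A21 a b c d = 4 * Re F"
    unfolding A12_def A21_def N_def[symmetric] F_def \<phi>_def diff_divide_distrib[symmetric] Re_divide_of_real times_divide_eq_right
    by (rule arg_cong[of _ _ "\<lambda>x. x / N"]) (simp add: cmod_power2, algebra)
  have T: "A11 a b c d + A22 a b c d = 4 * Im F"
    unfolding A11_def A22_def N_def[symmetric] F_def \<phi>_def Im_divide_of_real times_divide_eq_right add_divide_distrib[symmetric]
    by (rule arg_cong[of _ _ "\<lambda>x. x / N"]) (simp add: algebra_simps)
  define r where "r = sqrt (4 * A12 a b c d * A21 a b c d - (A11 a b c d + A22 a b c d)\<^sup>2)"
  have r: "r > 0" using ell by (simp add: r_def)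
  have "A12 a b c d * A21 a b c d > 0" 
  proof -
    have "0 < 4 * A12 a b c d * A21 a b c d"
      using ell zero_le_power2[of "A11 a b c d + A22 a b c d"] by linarith
    then show ?thesis by (simp add: mult.assoc)
  qed
  then have A21: "A21 a b c d > 0" using pos by (simp add: zero_less_mult_iff)
  then have E: "E > 0" using pos S by simp
  show "A12 a b c d + A21 a b c d > 0" using A21 pos by simp
  have r2: "r\<^sup>2 = 4 * E\<^sup>2 - 16 * (norm F)\<^sup>2"
  proof -
    have "r\<^sup>2 = 4 * A12 a b c d * A21 a b c d - (A11 a b c d + A22 a b c d)\<^sup>2" using ell by (simp add: r_def)
    also have "4 * A12 a b c d * A21 a b c d = (A12 a b c d + A21 a b c d)\<^sup>2 - (A12 a b c d - A21 a b c d)\<^sup>2"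
      by (simp add: power2_eq_square algebra_simps)
    finally show ?thesis unfolding S D T by (simp add: cmod_power2 power_mult_distrib)
  qed
  define m where "m = 2 * E + r"
  have m: "m > 0" using E r by (simp add: m_def)
  have \<sigma>F: "\<sigma> = 4 * cnj F / of_real m"
  proof -
    have "\<sigma> = (of_real (4 * Re F) - \<i> * of_real (4 * Im F)) / of_real (2 * E + r)"
      unfolding \<sigma> beltrami_coeff_def S[symmetric] D[symmetric] T[symmetric] r_def ..
    also have "of_real (4 * Re F) - \<i> * of_real (4 * Im F) = 4 * cnj F" by (simp add: complex_eq_iff)
    finally show ?thesis by (simp add: m_def)
  qed
  have "(4 * norm F)\<^sup>2 < (2 * E)\<^sup>2"
    using r2 zero_less_power[OF r, of 2] by (simp add: power_mult_distrib)
  then have "4 * norm F < 2 * E" by (rule power2_less_imp_less) (use E in simp)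
  then have "4 * norm F < m" using r by (simp add: m_def)
  then show "norm \<sigma> < 1" using m by (simp add: \<sigma>F norm_mult norm_divide)
  have e0: "e \<noteq> 0" using E by (auto simp: E_def)
  then show "(norm a)\<^sup>2 + (norm d)\<^sup>2 \<noteq> (norm b)\<^sup>2 + (norm c)\<^sup>2" by (simp add: e_def)
  have mm: "4 * E * m = 16 * (norm F)\<^sup>2 + m\<^sup>2"
    using r2 by (simp add: m_def power2_eq_square algebra_simps)
  have "of_real E * \<sigma> = F * \<sigma>\<^sup>2 + cnj F"
  proof -
    have m0: "complex_of_real m \<noteq> 0" using m by simp
    have "(of_real E * \<sigma> - F * \<sigma>\<^sup>2 - cnj F) * (of_real m)\<^sup>2 = cnj F * (4 * of_real E * of_real m - 16 * (F * cnj F) - (of_real m)\<^sup>2)"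
      using m0 by (simp add: \<sigma>F field_simps power2_eq_square)
    also have "4 * of_real E * of_real m - 16 * (F * cnj F) - (of_real m)\<^sup>2 = complex_of_real (4 * E * m - 16 * (norm F)\<^sup>2 - m\<^sup>2)"
      by (simp add: complex_norm_square[symmetric])
    also have "\<dots> = 0" using mm by simp
    finally have "of_real E * \<sigma> - F * \<sigma>\<^sup>2 - cnj F = 0" using m0 by simp
    then show ?thesis by (simp add: algebra_simps)
  qed
  then have root: "of_real e * \<sigma> = \<phi> * \<sigma>\<^sup>2 + cnj \<phi>"
    using N by (simp add: E_def F_def field_simps)
  have ec: "of_real e = a * cnj a + d * cnj d - b * cnj b - c * cnj c"
    by (simp add: e_def complex_norm_square[symmetric])
  show "(a * \<sigma> - d) * (cnj a - cnj d * \<sigma>) = (b - c * \<sigma>) * (cnj b * \<sigma> - cnj c)"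
    using root unfolding ec \<phi>_def by (simp add: algebra_simps power2_eq_square)
qed

lemma norm_reflection_identity:
  fixes x y s :: complex
  shows "(norm (x - y * cnj s))\<^sup>2 - (norm (x * s - y))\<^sup>2 = (1 - (norm s)\<^sup>2) * ((norm x)\<^sup>2 - (norm y)\<^sup>2)"
  unfolding cmod_power2 by (simp add: power2_eq_square algebra_simps)

text \<open>
  If \<open>p = cnj \<sigma> * q\<close>, the equation becomes \<open>(a \<sigma> - d) cnj q = (c - b cnj \<sigma>) q\<close>, so the two factors have equal
  modulus. If they are nonzero, the characteristic equation yields \<open>\<bar>a - d cnj \<sigma>\<bar> = \<bar>b - c \<sigma>\<bar>\<close> as well;
  comparing squares gives \<open>\<bar>a\<bar>\<^sup>2 - \<bar>b\<bar>\<^sup>2 = \<bar>d\<bar>\<^sup>2 - \<bar>c\<bar>\<^sup>2\<close>, and the characteristic equation then makes both sides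
  zero, against ellipticity. If they vanish, then \<open>\<alpha> = w * lw\<close> satisfies
  \<open>\<alpha> = (1 + \<bar>\<sigma>\<bar>\<^sup>2) / (1 - \<bar>\<sigma>\<bar>\<^sup>2)\<close> and \<open>d = (1 + \<alpha>) \<sigma>\<close>, while \<open>\<bar>d\<bar> = \<bar>\<alpha>\<bar>\<close> because \<open>l\<close> is real; hence
  \<open>2 \<bar>\<sigma>\<bar> = 1 + \<bar>\<sigma>\<bar>\<^sup>2\<close>, that is \<open>\<bar>\<sigma>\<bar> = 1\<close>.
\<close>

lemma first_derivative_nonzero:
  fixes a b c d p q \<sigma> w lw lwb :: complex
  assumes w: "w \<noteq> 0" and lreal: "lwb = cnj lw"
    and a: "a = 1 + w * lw" and b: "b = - (1 / w) * lwb"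
    and c: "c = 1 / w\<^sup>2 * (1 - w * lw)" and d: "d = w * lwb"
    and pde: "a * cnj p + b * p = c * q + d * cnj q" and J: "norm p \<noteq> norm q"
    and s1: "norm \<sigma> < 1"
    and char: "(a * \<sigma> - d) * (cnj a - cnj d * \<sigma>) = (b - c * \<sigma>) * (cnj b * \<sigma> - cnj c)"
    and E: "(norm a)\<^sup>2 + (norm d)\<^sup>2 \<noteq> (norm b)\<^sup>2 + (norm c)\<^sup>2"
  shows "p \<noteq> cnj \<sigma> * q"
proof
  assume p: "p = cnj \<sigma> * q"
  then have q: "q \<noteq> 0" using J by auto
  have "(a * \<sigma> - d) * cnj q = (c - b * cnj \<sigma>) * q"
    using pde unfolding p by (simp add: algebra_simps)
  then have n1: "norm (a * \<sigma> - d) = norm (c - b * cnj \<sigma>)"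
    using q by (metis complex_mod_cnj mult_cancel_right norm_eq_zero norm_mult)
  define t where "t = norm \<sigma>"
  have t: "0 \<le> t" "t < 1" using s1 by (auto simp: t_def)
  have tt: "of_real (t\<^sup>2) = \<sigma> * cnj \<sigma>" by (simp only: t_def complex_norm_square)
  show False
  proof (cases "a * \<sigma> = d")
    case True
    then have cb: "c = b * cnj \<sigma>" using n1 by simp
    define \<alpha> where "\<alpha> = w * lw"
    have nd: "norm d = norm \<alpha>" by (simp add: d \<alpha>_def lreal norm_mult)
    have "1 - \<alpha> = w\<^sup>2 * c" using w by (simp add: c \<alpha>_def)
    also have "\<dots> = - (w * lwb) * cnj \<sigma>" unfolding cb b using w by (simp add: power2_eq_square)
    also have "w * lwb = (1 + \<alpha>) * \<sigma>" using True by (simp add: d a \<alpha>_def)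
    also have "- ((1 + \<alpha>) * \<sigma>) * cnj \<sigma> = - (1 + \<alpha>) * (\<sigma> * cnj \<sigma>)" by (simp add: algebra_simps)
    also note tt[symmetric]
    finally have al: "\<alpha> * of_real (1 - t\<^sup>2) = of_real (1 + t\<^sup>2)" by (simp add: algebra_simps)
    then have "(1 + \<alpha>) * of_real (1 - t\<^sup>2) = 2" by (simp add: algebra_simps)
    then have "norm (1 + \<alpha>) * \<bar>1 - t\<^sup>2\<bar> = 2" by (metis norm_mult norm_numeral norm_of_real)
    moreover have "norm \<alpha> * \<bar>1 - t\<^sup>2\<bar> = \<bar>1 + t\<^sup>2\<bar>" using al by (metis norm_mult norm_of_real)
    moreover have "norm (1 + \<alpha>) * t = norm \<alpha>"
      using nd True by (metis a \<alpha>_def norm_mult t_def)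
    ultimately have "2 * t = \<bar>1 + t\<^sup>2\<bar>" by (metis mult.assoc mult.commute)
    also have "\<dots> = 1 + t\<^sup>2" by simp
    finally have "2 * t = 1 + t\<^sup>2" .
    then have "(1 - t)\<^sup>2 = 0" by (simp add: power2_eq_square algebra_simps)
    then show False using t by simp
  next
    case False
    have n2: "norm (a - d * cnj \<sigma>) = norm (b - c * \<sigma>)"
    proof -
      have "norm (a * \<sigma> - d) * norm (cnj (a - d * cnj \<sigma>)) = norm (b - c * \<sigma>) * norm (cnj (b * cnj \<sigma> - c))"
        using char by (simp flip: norm_mult)
      moreover have "norm (cnj (b * cnj \<sigma> - c)) = norm (a * \<sigma> - d)"
        unfolding complex_mod_cnj n1 by (rule norm_minus_commute)
      ultimately show ?thesis using False by (simp only: complex_mod_cnj) simp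
    qed
    note i1 = norm_reflection_identity[of _ _ \<sigma>, folded t_def]
    have i2: "(norm (b - c * \<sigma>))\<^sup>2 - (norm (c - b * cnj \<sigma>))\<^sup>2 = (1 - t\<^sup>2) * ((norm b)\<^sup>2 - (norm c)\<^sup>2)"
      unfolding t_def cmod_power2 by (simp add: power2_eq_square algebra_simps)
    have t2: "t\<^sup>2 < 1" using t by (simp add: power_less_one_iff abs_square_less_1)
    have AC: "(norm a)\<^sup>2 - (norm d)\<^sup>2 = (norm b)\<^sup>2 - (norm c)\<^sup>2"
      using i1[of a d] i2 n1 n2 t2 by simp
    define A where "A = (norm a)\<^sup>2 - (norm b)\<^sup>2"
    define F where "F = a * cnj d - c * cnj b"
    have "(norm (a * \<sigma> - d))\<^sup>2 - (norm (c - b * cnj \<sigma>))\<^sup>2 = t\<^sup>2 * A + ((norm d)\<^sup>2 - (norm c)\<^sup>2) - 2 * Re (F * \<sigma>)"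
      unfolding t_def cmod_power2 A_def F_def by (simp add: power2_eq_square algebra_simps)
    then have k1: "A * (1 + t\<^sup>2) = 2 * Re (F * \<sigma>)" using n1 AC by (simp add: A_def algebra_simps)
    have "of_real (2 * A) * \<sigma> = F * \<sigma>\<^sup>2 + cnj F"
    proof -
      have "2 * A = (norm a)\<^sup>2 + (norm d)\<^sup>2 - (norm b)\<^sup>2 - (norm c)\<^sup>2" using AC by (simp add: A_def)
      then have ofA: "of_real (2 * A) = a * cnj a + d * cnj d - b * cnj b - c * cnj c"
        by (simp only: of_real_add of_real_diff complex_norm_square)
      show ?thesis unfolding ofA using char by (simp add: F_def algebra_simps power2_eq_square)
    qed
    then have "Re (cnj \<sigma> * (of_real (2 * A) * \<sigma>)) = Re (cnj \<sigma> * (F * \<sigma>\<^sup>2 + cnj F))" by simp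
    also have "cnj \<sigma> * (of_real (2 * A) * \<sigma>) = of_real (2 * A * t\<^sup>2)"
      unfolding of_real_mult tt by (simp add: mult_ac)
    also have "cnj \<sigma> * (F * \<sigma>\<^sup>2 + cnj F) = of_real (t\<^sup>2) * (F * \<sigma>) + cnj (F * \<sigma>)"
      unfolding tt by (simp add: power2_eq_square algebra_simps)
    finally have "2 * A * t\<^sup>2 = (1 + t\<^sup>2) * Re (F * \<sigma>)" by (simp only: Re_complex_of_real) (simp add: algebra_simps)
    moreover have "Re (F * \<sigma>) = A * (1 + t\<^sup>2) / 2" using k1 by linarith
    ultimately have "2 * A * t\<^sup>2 = (1 + t\<^sup>2) * (A * (1 + t\<^sup>2) / 2)" by (simp only:)
    then have "A * (1 - t\<^sup>2)\<^sup>2 = 0" by (simp add: power2_eq_square algebra_simps)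
    then have "A = 0" using t2 by simp
    then show False using E AC by (simp add: A_def)
  qed
qed

lemma Ck_on_norm_power2:
  fixes f :: "complex \<Rightarrow> complex"
  assumes "open S" "Ck_on k S f" shows "Ck_on k S (\<lambda>w. (norm (f w))\<^sup>2)"
  unfolding cmod_power2 by (intro Ck_on_add Ck_on_power2 Ck_on_Re Ck_on_Im assms)

lemma Ck_on_beltrami_coeff:
  fixes a b c d :: "complex \<Rightarrow> complex"
  assumes S: "open S" and ck: "Ck_on k S a" "Ck_on k S b" "Ck_on k S c" "Ck_on k S d"
    and den: "\<And>w. w \<in> S \<Longrightarrow> denom (a w) (b w) (c w) (d w) \<noteq> 0"
    and ell: "\<And>w. w \<in> S \<Longrightarrow> 4 * A12 (a w) (b w) (c w) (d w) * A21 (a w) (b w) (c w) (d w)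
         - (A11 (a w) (b w) (c w) (d w) + A22 (a w) (b w) (c w) (d w))\<^sup>2 > 0"
    and pos: "\<And>w. w \<in> S \<Longrightarrow> A12 (a w) (b w) (c w) (d w) > 0"
  shows "Ck_on k S (\<lambda>w. beltrami_coeff (A11 (a w) (b w) (c w) (d w)) (A12 (a w) (b w) (c w) (d w))
      (A21 (a w) (b w) (c w) (d w)) (A22 (a w) (b w) (c w) (d w)))"
proof -
  have dk: "Ck_on k S (\<lambda>w. denom (a w) (b w) (c w) (d w))"
    unfolding denom_def by (intro Ck_on_diff Ck_on_norm_power2 Ck_on_add S ck)
  have k11: "Ck_on k S (\<lambda>w. A11 (a w) (b w) (c w) (d w))"
    unfolding A11_def by (intro Ck_on_mult Ck_on_const Ck_on_divide Ck_on_Im Ck_on_cnj Ck_on_add S ck dk den)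
  have k12: "Ck_on k S (\<lambda>w. A12 (a w) (b w) (c w) (d w))"
    unfolding A12_def by (intro Ck_on_divide Ck_on_diff Ck_on_norm_power2 Ck_on_add S ck dk den)
  have k21: "Ck_on k S (\<lambda>w. A21 (a w) (b w) (c w) (d w))"
    unfolding A21_def by (intro Ck_on_divide Ck_on_diff Ck_on_norm_power2 Ck_on_add S ck dk den)
  have k22: "Ck_on k S (\<lambda>w. A22 (a w) (b w) (c w) (d w))"
    unfolding A22_def by (intro Ck_on_mult Ck_on_const Ck_on_divide Ck_on_Im Ck_on_cnj Ck_on_diff S ck dk den)
  have nz: "complex_of_real (A12 (a w) (b w) (c w) (d w) + A21 (a w) (b w) (c w) (d w) +
      sqrt (4 * A12 (a w) (b w) (c w) (d w) * A21 (a w) (b w) (c w) (d w)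
         - (A11 (a w) (b w) (c w) (d w) + A22 (a w) (b w) (c w) (d w))\<^sup>2)) \<noteq> 0" if "w \<in> S" for w
  proof -
    have "A12 (a w) (b w) (c w) (d w) + A21 (a w) (b w) (c w) (d w) > 0"
      by (rule beltrami_coeff_characteristic(2)[OF den ell pos refl]) (use that in auto)
    moreover have "sqrt (4 * A12 (a w) (b w) (c w) (d w) * A21 (a w) (b w) (c w) (d w)
         - (A11 (a w) (b w) (c w) (d w) + A22 (a w) (b w) (c w) (d w))\<^sup>2) > 0"
      using ell[OF that] by simp
    ultimately show ?thesis unfolding of_real_eq_0_iff by linarith
  qed
  show ?thesis unfolding beltrami_coeff_def
    by (intro Ck_on_divide Ck_on_of_real Ck_on_diff Ck_on_add Ck_on_mult Ck_on_const Ck_on_sqrt Ck_on_power2 S k11 k12 k21 k22 nz ell)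
qed

section \<open>The hodograph equation\<close>

lemma real_valued_wirtinger:
  fixes l :: "complex \<Rightarrow> complex" and L :: "complex \<Rightarrow> real"
  assumes S: "open S" "w \<in> S" and l: "\<And>w. w \<in> S \<Longrightarrow> l w = of_real (L w)"
    and L: "L differentiable (at w)"
  shows "wdbar l w = cnj (wd l w)"
proof -
  have "((\<lambda>w. complex_of_real (L w)) has_derivative (\<lambda>h. of_real (Re h *\<^sub>R partial_re L w + Im h *\<^sub>R partial_im L w))) (at w)"
    by (intro has_derivative_of_real differentiable_partials L)
  then have "(l has_derivative (\<lambda>h. of_real (Re h *\<^sub>R partial_re L w + Im h *\<^sub>R partial_im L w))) (at w)"
    by (rule has_derivative_transform_within_open[OF _ S]) (simp add: l)
  from partial_eq[OF this] show ?thesis by (simp add: wd_def wdbar_def)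
qed

text \<open>
  The first derivatives of \<open>\<phi>\<close> are \<open>n / (2 \<zeta>)\<close> and \<open>n \<zeta> / 2\<close>, with \<open>n = exp (l \<circ> \<zeta>)\<close>. Equality of the mixed
  second derivatives of \<open>\<phi>\<close> is an equation for the derivatives \<open>A\<close>, \<open>B\<close> of \<open>\<zeta>\<close>; multiplied by the
  Jacobian \<open>J\<close> of the inverse map it becomes linear in \<open>p\<close> and \<open>q\<close>, because \<open>J * A = cnj p\<close>
  and \<open>J * B = - q\<close>.
\<close>

lemma hodograph_equation:
  fixes n :: "complex \<Rightarrow> real" and \<phi> \<zeta> zinv l :: "complex \<Rightarrow> complex"
  assumes n: "\<And>z. z \<in> \<Omega> \<Longrightarrow> n z > 0"
    and \<phi>: "smooth_on \<Omega> \<phi>"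
    and eik: "\<And>z. z \<in> \<Omega> \<Longrightarrow> 4 * wd \<phi> z * wdbar \<phi> z = complex_of_real ((n z)\<^sup>2)"
    and \<zeta>: "\<And>z. z \<in> \<Omega> \<Longrightarrow> \<zeta> z = 2 / complex_of_real (n z) * wdbar \<phi> z"
    and D0: "0 \<notin> D"
    and diffeo: "smooth_diffeomorphism \<Omega> D \<zeta> zinv"
    and l: "\<And>w. w \<in> D \<Longrightarrow> l w = complex_of_real (ln (n (zinv w)))"
    and ldiff: "l differentiable (at w)"
    and w: "w \<in> D"
  shows "wd \<phi> (zinv w) = of_real (n (zinv w)) / (2 * w)" "wdbar \<phi> (zinv w) = of_real (n (zinv w)) * w / 2"
    and "norm (wd zinv w) \<noteq> norm (wdbar zinv w)"
    and "coeff_a l w * cnj (wd zinv w) + coeff_b l w * wd zinv w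
       = coeff_c l w * wdbar zinv w + coeff_d l w * cnj (wdbar zinv w)"
proof -
  have open_: "open \<Omega>" "open D" and hom: "homeomorphism \<Omega> D \<zeta> zinv"
    and sm: "smooth_on \<Omega> \<zeta>" "smooth_on D zinv"
    using diffeo by (auto simp: smooth_diffeomorphism_def)
  define z0 where "z0 = zinv w"
  have z0: "z0 \<in> \<Omega>" "\<zeta> z0 = w" using hom w by (auto simp: z0_def homeomorphism_def)
  have w0: "w \<noteq> 0" using w D0 by auto
  have \<zeta>D: "\<zeta> z \<in> D" if "z \<in> \<Omega>" for z using hom that by (auto simp: homeomorphism_def)
  have \<zeta>0: "\<zeta> z \<noteq> 0" if "z \<in> \<Omega>" for z using \<zeta>D[OF that] D0 by auto
  have zb: "wdbar \<phi> z = of_real (n z) * \<zeta> z / 2" if "z \<in> \<Omega>" for z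
    using \<zeta>[OF that] n[OF that] by simp
  have zz: "wd \<phi> z = of_real (n z) / (2 * \<zeta> z)" if "z \<in> \<Omega>" for z
  proof -
    have "2 * wd \<phi> z * \<zeta> z * of_real (n z) = of_real (n z) * of_real (n z)"
      using eik[OF that] by (simp add: zb[OF that] power2_eq_square algebra_simps)
    then have "2 * wd \<phi> z * \<zeta> z = of_real (n z)" using n[OF that] by simp
    then show ?thesis using \<zeta>0[OF that] by (simp add: field_simps)
  qed
  show "wd \<phi> (zinv w) = of_real (n (zinv w)) / (2 * w)" "wdbar \<phi> (zinv w) = of_real (n (zinv w)) * w / 2"
    using zz[OF z0(1)] zb[OF z0(1)] z0 by (simp_all add: z0_def)
  define p where "p = wd zinv w"
  define q where "q = wdbar zinv w"
  define A where "A = wd \<zeta> z0"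
  define B where "B = wdbar \<zeta> z0"
  have "Ck_on 1 \<Omega> \<zeta>" "Ck_on 1 D zinv" using sm unfolding smooth_on_def by blast+
  then have "\<zeta> differentiable (at z0)" "zinv differentiable (at w)" using z0 w by auto
  then have d\<zeta>: "(\<zeta> has_derivative (\<lambda>u. A * u + B * cnj u)) (at z0)"
    and dz: "(zinv has_derivative (\<lambda>u. p * u + q * cnj u)) (at w)"
    unfolding A_def B_def p_def q_def by (auto intro: wirtinger_has_derivative)
  have "((\<lambda>z. zinv (\<zeta> z)) has_derivative (\<lambda>u. p * (A * u + B * cnj u) + q * cnj (A * u + B * cnj u))) (at z0)"
    by (rule has_derivative_compose[OF d\<zeta> dz[folded z0(2)]])
  then have "((\<lambda>z. z) has_derivative (\<lambda>u. p * (A * u + B * cnj u) + q * cnj (A * u + B * cnj u))) (at z0)"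
    by (rule has_derivative_transform_within_open[OF _ open_(1) z0(1)]) (use hom in \<open>auto simp: homeomorphism_def\<close>)
  then have "(\<lambda>u. p * (A * u + B * cnj u) + q * cnj (A * u + B * cnj u)) = (\<lambda>u. u)"
    using has_derivative_ident has_derivative_unique by blast
  then have id: "p * (A * u + B * cnj u) + q * cnj (A * u + B * cnj u) = u" for u by metis
  have id1: "p * A + q * cnj B = 1" and id2: "p * B + q * cnj A = 0"
    using id[of 1] id[of \<i>] by (auto simp: algebra_simps complex_eq_iff)
  define J where "J = p * cnj p - q * cnj q"
  have cid1: "cnj p * cnj A + cnj q * B = 1" and cid2: "cnj p * cnj B + cnj q * A = 0"
    using arg_cong[OF id1, of cnj] arg_cong[OF id2, of cnj] by simp_all
  have JA: "J * A = cnj p"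
  proof -
    have "J * A = cnj p * (p * A + q * cnj B) - q * (cnj p * cnj B + cnj q * A)"
      by (simp add: J_def algebra_simps)
    then show ?thesis using id1 cid2 by simp
  qed
  have JB: "J * B = - q"
  proof -
    have "J * B = cnj p * (p * B + q * cnj A) - q * (cnj p * cnj A + cnj q * B)"
      by (simp add: J_def algebra_simps)
    then show ?thesis using id2 cid1 by simp
  qed
  have J0: "J \<noteq> 0" using JA JB id1 by auto
  have Jn: "J = of_real ((norm p)\<^sup>2 - (norm q)\<^sup>2)" by (simp add: J_def complex_norm_square del: of_real_power)
  show "norm (wd zinv w) \<noteq> norm (wdbar zinv w)" using J0 Jn by (auto simp: p_def q_def)
  have cJ: "cnj J = J" by (simp add: J_def mult.commute)
  have JA': "J * cnj A = p" and JB': "J * cnj B = - cnj q"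
    using arg_cong[OF JA, of cnj] arg_cong[OF JB, of cnj] cJ by simp_all
  define lw where "lw = wd l w"
  define lb where "lb = wdbar l w"
  have dl: "(l has_derivative (\<lambda>u. lw * u + lb * cnj u)) (at (\<zeta> z0))"
    unfolding lw_def lb_def z0 by (rule wirtinger_has_derivative[OF ldiff])
  have nexp: "exp (l (\<zeta> z)) = of_real (n z)" if "z \<in> \<Omega>" for z
  proof -
    have "zinv (\<zeta> z) = z" using hom that by (auto simp: homeomorphism_def)
    then show ?thesis using l[OF \<zeta>D[OF that]] n[OF that] by (simp add: exp_of_real)
  qed
  define N where "N = exp (l (\<zeta> z0))"
  have N0: "N \<noteq> 0" by (simp add: N_def)
  define K where "K u = lw * (A * u + B * cnj u) + lb * cnj (A * u + B * cnj u)" for u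
  have dn: "((\<lambda>z. exp (l (\<zeta> z))) has_derivative (\<lambda>u. N * K u)) (at z0)"
    using has_derivative_compose[OF has_derivative_compose[OF d\<zeta> dl] DERIV_exp[unfolded has_field_derivative_def]]
    by (simp add: K_def N_def)
  have "((\<lambda>z. exp (l (\<zeta> z)) * \<zeta> z / 2) has_derivative (\<lambda>u. (N * (A * u + B * cnj u) + N * K u * w) / 2)) (at z0)"
    by (rule has_derivative_eq_rhs[OF bounded_linear.has_derivative[OF bounded_linear_divide has_derivative_mult[OF dn d\<zeta>]]])
       (simp add: N_def z0 fun_eq_iff)
  then have "(wdbar \<phi> has_derivative (\<lambda>u. (N * (A * u + B * cnj u) + N * K u * w) / 2)) (at z0)"
    by (rule has_derivative_transform_within_open[OF _ open_(1) z0(1)]) (simp add: zb nexp)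
  then have "(wdbar \<phi> has_derivative (\<lambda>u. N / 2 * (A + (lw * A + lb * cnj B) * w) * u + N / 2 * (B + (lw * B + lb * cnj A) * w) * cnj u)) (at z0)"
    by (rule has_derivative_eq_rhs) (simp add: fun_eq_iff K_def field_simps)
  then have e1: "wd (wdbar \<phi>) z0 = N / 2 * (A + (lw * A + lb * cnj B) * w)"
    by (rule wirtinger_eq)
  have "((\<lambda>z. exp (l (\<zeta> z)) / (2 * \<zeta> z)) has_derivative (\<lambda>u. (N * K u * w - N * (A * u + B * cnj u)) / (2 * w\<^sup>2))) (at z0)"
    by (rule has_derivative_eq_rhs[OF has_derivative_divide'[OF dn has_derivative_mult_right[OF d\<zeta>]]])
       (use w0 in \<open>simp_all add: N_def z0 fun_eq_iff field_simps power2_eq_square\<close>)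
  then have "(wd \<phi> has_derivative (\<lambda>u. (N * K u * w - N * (A * u + B * cnj u)) / (2 * w\<^sup>2))) (at z0)"
    by (rule has_derivative_transform_within_open[OF _ open_(1) z0(1)]) (simp add: zz nexp)
  then have "(wd \<phi> has_derivative (\<lambda>u. N / (2 * w\<^sup>2) * ((lw * A + lb * cnj B) * w - A) * u
       + N / (2 * w\<^sup>2) * ((lw * B + lb * cnj A) * w - B) * cnj u)) (at z0)"
    by (rule has_derivative_eq_rhs) (use w0 in \<open>simp add: fun_eq_iff K_def field_simps\<close>)
  then have e2: "wdbar (wd \<phi>) z0 = N / (2 * w\<^sup>2) * ((lw * B + lb * cnj A) * w - B)"
    by (rule wirtinger_eq)
  have "Ck_on (Suc (Suc 0)) \<Omega> \<phi>" using \<phi> unfolding smooth_on_def by blast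
  from wd_wdbar_commute[OF open_(1) z0(1) this]
  have "N / (2 * w\<^sup>2) * ((lw * B + lb * cnj A) * w - B) = N / 2 * (A + (lw * A + lb * cnj B) * w)"
    unfolding e1 e2 .
  moreover have "R = w\<^sup>2 * S" if "N / (2 * w\<^sup>2) * R = N / 2 * S" for R S
  proof -
    have "N / (2 * w\<^sup>2) * R = N / (2 * w\<^sup>2) * (w\<^sup>2 * S)" using that w0 by simp
    then show ?thesis using N0 w0 by (metis divide_eq_0_iff mult_cancel_left no_zero_divisors power_not_zero zero_neq_numeral)
  qed
  ultimately have "(lw * B + lb * cnj A) * w - B = w\<^sup>2 * (A + (lw * A + lb * cnj B) * w)" by blast
  then have "J * ((lw * B + lb * cnj A) * w - B) = J * (w\<^sup>2 * (A + (lw * A + lb * cnj B) * w))" by simp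
  then have "(lw * (J * B) + lb * (J * cnj A)) * w - J * B = w\<^sup>2 * (J * A + (lw * (J * A) + lb * (J * cnj B)) * w)"
    by (simp add: algebra_simps)
  then have fin: "(lb * p - lw * q) * w + q = w\<^sup>2 * (cnj p + (lw * cnj p - lb * cnj q) * w)"
    unfolding JA JB JA' JB' by (simp add: algebra_simps)
  have "w\<^sup>2 * (coeff_a l w * cnj p + coeff_b l w * p - coeff_c l w * q - coeff_d l w * cnj q) = 0"
  proof -
    have ab: "coeff_a l w = 1 + w * lw" "w\<^sup>2 * coeff_b l w = - (w * lb)"
      and cd: "w\<^sup>2 * coeff_c l w = 1 - w * lw" "coeff_d l w = w * lb"
      using w0 by (simp_all add: coeff_a_def coeff_b_def coeff_c_def coeff_d_def lw_def lb_def power2_eq_square)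
    have "w\<^sup>2 * (coeff_a l w * cnj p + coeff_b l w * p - coeff_c l w * q - coeff_d l w * cnj q)
       = w\<^sup>2 * coeff_a l w * cnj p + (w\<^sup>2 * coeff_b l w) * p - (w\<^sup>2 * coeff_c l w) * q - w\<^sup>2 * coeff_d l w * cnj q"
      by (simp add: algebra_simps)
    also have "\<dots> = 0" unfolding ab cd using fin by (simp add: algebra_simps power2_eq_square)
    finally show ?thesis .
  qed
  then have "coeff_a l w * cnj p + coeff_b l w * p - coeff_c l w * q - coeff_d l w * cnj q = 0"
    using w0 by (metis mult_eq_0_iff power_not_zero)
  then show "coeff_a l w * cnj (wd zinv w) + coeff_b l w * wd zinv w
       = coeff_c l w * wdbar zinv w + coeff_d l w * cnj (wdbar zinv w)"
    by (simp add: p_def q_def algebra_simps)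
qed

section \<open>The parametrization\<close>

theorem corollary3p6:
  fixes n :: "complex \<Rightarrow> real" and \<phi> \<zeta> zinv :: "complex \<Rightarrow> complex"
    and \<Omega> D :: "complex set"
    and l a b c d \<sigma> :: "complex \<Rightarrow> complex"
    and a11 a12 a21 a22 :: "complex \<Rightarrow> real"
  assumes "open \<Omega>"
    and "smooth_on \<Omega> n" and "\<And>z. z \<in> \<Omega> \<Longrightarrow> n z > 0"
    and "smooth_on \<Omega> \<phi>"
    and "\<And>z. z \<in> \<Omega> \<Longrightarrow> 4 * wd \<phi> z * wdbar \<phi> z = complex_of_real ((n z)\<^sup>2)"
    and "\<And>z. z \<in> \<Omega> \<Longrightarrow> \<zeta> z = 2 / complex_of_real (n z) * wdbar \<phi> z"
    and "0 \<notin> D"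
    and "smooth_diffeomorphism \<Omega> D \<zeta> zinv"
    and "\<And>w. w \<in> D \<Longrightarrow> l w = complex_of_real (ln (n (zinv w)))"
    and "\<And>w. w \<in> D \<Longrightarrow> a w = coeff_a l w"
    and "\<And>w. w \<in> D \<Longrightarrow> b w = coeff_b l w"
    and "\<And>w. w \<in> D \<Longrightarrow> c w = coeff_c l w"
    and "\<And>w. w \<in> D \<Longrightarrow> d w = coeff_d l w"
    and "\<And>w. w \<in> D \<Longrightarrow> (cmod (a w + c w))\<^sup>2 - (cmod (b w + d w))\<^sup>2 \<noteq> 0"
    and "\<And>w. w \<in> D \<Longrightarrow> a11 w = A11 (a w) (b w) (c w) (d w)"
    and "\<And>w. w \<in> D \<Longrightarrow> a12 w = A12 (a w) (b w) (c w) (d w)"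
    and "\<And>w. w \<in> D \<Longrightarrow> a21 w = A21 (a w) (b w) (c w) (d w)"
    and "\<And>w. w \<in> D \<Longrightarrow> a22 w = A22 (a w) (b w) (c w) (d w)"
    and "\<And>w. w \<in> D \<Longrightarrow> 4 * a12 w * a21 w - (a11 w + a22 w)\<^sup>2 > 0"
    and "\<And>w. w \<in> D \<Longrightarrow> a12 w > 0"
    and "\<And>w. w \<in> D \<Longrightarrow> \<sigma> w = beltrami_coeff (a11 w) (a12 w) (a21 w) (a22 w)"
  shows "\<forall>w0\<in>D. \<exists>U V (chi :: complex \<Rightarrow> complex) chi_inv
      (\<kappa> :: complex \<Rightarrow> complex) (s :: complex \<Rightarrow> complex) (f :: complex \<Rightarrow> complex)
      (\<Phi> :: complex \<Rightarrow> complex \<Rightarrow> complex) (Z :: complex \<Rightarrow> complex).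
      open U \<and> w0 \<in> U \<and> U \<subseteq> D \<and> open V \<and>
      homeomorphism U V chi chi_inv \<and> Ck_on 1 U chi \<and>
      (\<forall>w\<in>U. wdbar chi w = \<sigma> w * wd chi w) \<and>
      continuous_on V \<kappa> \<and> (\<forall>x\<in>V. cmod (\<kappa> x) \<noteq> 1) \<and>
      continuous_on V s \<and> f analytic_on V \<and>
      (\<forall>x\<in>V. Z x = (exp (s x) * f x + \<kappa> x * cnj (f x * exp (s x)))
                    / complex_of_real (1 - (cmod (\<kappa> x))\<^sup>2)) \<and>
      Ck_on 1 V Z \<and>
      (\<forall>x\<in>V. wdbar Z x = \<kappa> x * cnj (wd Z x)) \<and>
      (\<forall>w\<in>U. zinv w = Z (chi w) \<and> \<phi> (zinv w) = \<Phi> w (chi w)) \<and>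
      (\<forall>w\<in>U.
         wd (\<lambda>w. \<phi> (zinv w)) w =
           complex_of_real (n (Z (chi w))) / (2 * w) *
             ((1 + w\<^sup>2 * cnj (\<kappa> (chi w))) * wd Z (chi w) * wd chi w
              + cnj (\<sigma> w) * (\<kappa> (chi w) + w\<^sup>2) * cnj (wd Z (chi w) * wd chi w)) \<and>
         wdbar (\<lambda>w. \<phi> (zinv w)) w =
           complex_of_real (n (Z (chi w))) / (2 * w) *
             (\<sigma> w * (1 + w\<^sup>2 * cnj (\<kappa> (chi w))) * wd Z (chi w) * wd chi w
              + (\<kappa> (chi w) + w\<^sup>2) * cnj (wd Z (chi w) * wd chi w)))"
proof
  fix w0 assume w0: "w0 \<in> D"
  have opens: "open \<Omega>" "open D" and hom: "homeomorphism \<Omega> D \<zeta> zinv" and smz: "smooth_on D zinv"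
    using assms(8) by (auto simp: smooth_diffeomorphism_def)
  have zinv\<Omega>: "zinv w \<in> \<Omega>" if "w \<in> D" for w using hom that by (auto simp: homeomorphism_def)
  have wn0: "w \<noteq> 0" if "w \<in> D" for w using that assms(7) by auto
  have ckz: "Ck_on k D zinv" for k using smz by (simp add: smooth_on_def)
  define L where "L w = ln (n (zinv w))" for w
  have ckL: "Ck_on k D L" for k
  proof -
    have "Ck_on k \<Omega> n" using assms(2) by (simp add: smooth_on_def)
    from Ck_on_compose[OF opens(2,1) this ckz] show ?thesis
      unfolding L_def using assms(3) zinv\<Omega> opens by (intro Ck_on_ln) auto
  qed
  have ckl: "Ck_on k D l" for k
    by (rule Ck_on_cong[OF opens(2) Ck_on_of_real[OF opens(2) ckL]]) (simp add: assms(9) L_def)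
  have ldiff: "l differentiable (at w)" and lreal: "wdbar l w = cnj (wd l w)" if "w \<in> D" for w
  proof -
    show "l differentiable (at w)" using ckl[of 1] that by simp
    show "wdbar l w = cnj (wd l w)"
      by (rule real_valued_wirtinger[OF opens(2) that, of l L])
         (use ckL[of 1] that in \<open>auto simp: assms(9) L_def\<close>)
  qed
  have cks: "Ck_on 4 D a" "Ck_on 4 D b" "Ck_on 4 D c" "Ck_on 4 D d"
  proof -
    have 1: "Ck_on 4 D (wd l)" "Ck_on 4 D (wdbar l)" by (rule Ck_on_wd[OF opens(2) ckl])+
    note i = Ck_on_mult Ck_on_add Ck_on_diff Ck_on_minus Ck_on_divide Ck_on_const Ck_on_ident Ck_on_power2
    show "Ck_on 4 D a" 
      by (rule Ck_on_cong[OF opens(2) _ assms(10)[symmetric]]) (unfold coeff_a_def, intro i 1 opens)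
    show "Ck_on 4 D b" 
      by (rule Ck_on_cong[OF opens(2) _ assms(11)[symmetric]]) (unfold coeff_b_def, intro i 1 opens wn0)
    show "Ck_on 4 D c" 
      by (rule Ck_on_cong[OF opens(2) _ assms(12)[symmetric]]) (unfold coeff_c_def, intro i 1 opens, use wn0 in auto)
    show "Ck_on 4 D d" 
      by (rule Ck_on_cong[OF opens(2) _ assms(13)[symmetric]]) (unfold coeff_d_def, intro i 1 opens)
  qed
  have den: "denom (a w) (b w) (c w) (d w) \<noteq> 0" if "w \<in> D" for w
    using assms(14)[OF that] by (simp add: denom_def)
  have ell: "4 * A12 (a w) (b w) (c w) (d w) * A21 (a w) (b w) (c w) (d w)
         - (A11 (a w) (b w) (c w) (d w) + A22 (a w) (b w) (c w) (d w))\<^sup>2 > 0" if "w \<in> D" for w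
    using assms(15-19)[OF that] by simp
  have pos: "A12 (a w) (b w) (c w) (d w) > 0" if "w \<in> D" for w
    using assms(16,20)[OF that] by simp
  have \<sigma>eq: "\<sigma> w = beltrami_coeff (A11 (a w) (b w) (c w) (d w)) (A12 (a w) (b w) (c w) (d w))
      (A21 (a w) (b w) (c w) (d w)) (A22 (a w) (b w) (c w) (d w))" if "w \<in> D" for w
    using assms(15-18,21)[OF that] by simp
  have ck\<sigma>: "Ck_on 4 D \<sigma>"
    by (rule Ck_on_cong[OF opens(2) Ck_on_beltrami_coeff[OF opens(2) cks den ell pos]]) (auto simp: \<sigma>eq)
  note char = beltrami_coeff_characteristic[OF den ell pos \<sigma>eq]
  have s1: "norm (\<sigma> w) < 1" if "w \<in> D" for w by (rule char(1)) (use that in auto)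
  define p where "p = wd zinv"
  define q where "q = wdbar zinv"
  have dz: "(zinv has_derivative (\<lambda>u. p w * u + q w * cnj u)) (at w)" if "w \<in> D" for w
    unfolding p_def q_def by (rule wirtinger_has_derivative) (use ckz[of 1] that in simp)
  have cpq: "continuous_on D p" "continuous_on D q"
    unfolding p_def q_def by (rule Ck_on_imp_continuous_on[OF Ck_on_wd(1)[OF opens(2) ckz]],
       rule Ck_on_imp_continuous_on[OF Ck_on_wd(2)[OF opens(2) ckz]])
  note hodo = hodograph_equation[OF assms(3,4,5,6,7,8,9) ldiff]
  have pq: "norm (p w) \<noteq> norm (q w)" if "w \<in> D" for w
    unfolding p_def q_def by (rule hodo(3)) (use that in auto)
  have first: "p w \<noteq> cnj (\<sigma> w) * q w" if w: "w \<in> D" for w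
  proof (rule first_derivative_nonzero[OF wn0[OF w] lreal[OF w]])
    show "a w * cnj (p w) + b w * p w = c w * q w + d w * cnj (q w)"
      using hodo(4)[of w] w assms(10-13)[OF w] by (simp add: p_def q_def)
  qed (use assms(10-13)[OF w] pq[OF w] char[OF w w w w] in \<open>simp_all add: coeff_a_def coeff_b_def coeff_c_def coeff_d_def\<close>)

  obtain U0 chi \<alpha> where U0: "open U0" "w0 \<in> U0" "U0 \<subseteq> D" and c\<alpha>: "continuous_on U0 \<alpha>"
    and \<alpha>0: "\<And>w. w \<in> U0 \<Longrightarrow> \<alpha> w \<noteq> 0"
    and dchi: "\<And>w. w \<in> U0 \<Longrightarrow> (chi has_derivative (\<lambda>u. \<alpha> w * u + \<sigma> w * \<alpha> w * cnj u)) (at w)"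
    using local_beltrami_solution[OF opens(2) w0 ck\<sigma> s1[OF w0]] by blast
  have c\<sigma>: "continuous_on D \<sigma>" by (rule Ck_on_imp_continuous_on[OF ck\<sigma>])
  have c\<sigma>\<alpha>: "continuous_on U0 (\<lambda>w. \<sigma> w * \<alpha> w)"
    by (intro continuous_intros c\<alpha> continuous_on_subset[OF c\<sigma> U0(3)])
  have J\<alpha>: "norm (\<alpha> w) \<noteq> norm (\<sigma> w * \<alpha> w)" if "w \<in> U0" for w
    using \<alpha>0[OF that] s1[of w] that U0(3) by (auto simp: norm_mult)
  obtain U1 V0 g where U1: "open U1" "U1 \<subseteq> U0" "w0 \<in> U1" and V0: "open V0" and hom1: "homeomorphism U1 V0 chi g"
    and dg: "\<And>y. y \<in> V0 \<Longrightarrow> (g has_derivative (\<lambda>k. (cnj (\<alpha> (g y)) * k - \<sigma> (g y) * \<alpha> (g y) * cnj k) /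
        of_real ((norm (\<alpha> (g y)))\<^sup>2 - (norm (\<sigma> (g y) * \<alpha> (g y)))\<^sup>2))) (at y)"
    using wirtinger_inverse_function[OF U0(1,2) dchi c\<alpha> c\<sigma>\<alpha> J\<alpha>] by blast
  have gU1: "g x \<in> U1" "chi (g x) = x" if "x \<in> V0" for x using hom1 that by (auto simp: homeomorphism_def)
  have gU0: "g x \<in> U0" and gD: "g x \<in> D" if "x \<in> V0" for x using gU1(1)[OF that] U1(2) U0(3) by auto
  define J where "J w = complex_of_real ((norm (\<alpha> w))\<^sup>2 - (norm (\<sigma> w * \<alpha> w))\<^sup>2)" for w
  have J0: "J w \<noteq> 0" if "w \<in> U0" for w using J\<alpha>[OF that] unfolding J_def of_real_eq_0_iff by simp
  have cJ: "cnj (J w) = J w" for w by (simp only: J_def complex_cnj_complex_of_real)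
  define Z where "Z x = zinv (g x)" for x
  \<comment> \<open>The Wirtinger derivatives of \<open>Z\<close>, from the chain rule and the derivative of \<open>g\<close>.\<close>
  define P where "P x = (p (g x) * cnj (\<alpha> (g x)) - q (g x) * cnj (\<sigma> (g x) * \<alpha> (g x))) / J (g x)" for x
  define Q where "Q x = (q (g x) * \<alpha> (g x) - p (g x) * (\<sigma> (g x) * \<alpha> (g x))) / J (g x)" for x
  define \<kappa> where "\<kappa> x = Q x / cnj (P x)" for x
  have dZ: "(Z has_derivative (\<lambda>k. P x * k + Q x * cnj k)) (at x)" if "x \<in> V0" for x
  proof -
    have "((\<lambda>x. zinv (g x)) has_derivative (\<lambda>k. p (g x) * ((cnj (\<alpha> (g x)) * k - \<sigma> (g x) * \<alpha> (g x) * cnj k) / J (g x))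
        + q (g x) * cnj ((cnj (\<alpha> (g x)) * k - \<sigma> (g x) * \<alpha> (g x) * cnj k) / J (g x)))) (at x)"
      using has_derivative_compose[OF dg[OF that] dz[OF gD[OF that]]] by (simp only: J_def)
    then show ?thesis unfolding Z_def[abs_def]
      by (rule has_derivative_eq_rhs)
         (use J0[OF gU0[OF that]] in \<open>simp add: fun_eq_iff P_def Q_def cJ field_simps\<close>)
  qed
  have P0: "P x \<noteq> 0" if "x \<in> V0" for x
  proof -
    have "P x = cnj (\<alpha> (g x)) * (p (g x) - cnj (\<sigma> (g x)) * q (g x)) / J (g x)"
      by (simp add: P_def algebra_simps)
    then show ?thesis using \<alpha>0[OF gU0[OF that]] first[OF gD[OF that]] J0[OF gU0[OF that]] by simp
  qed
  have Q\<kappa>: "Q x = \<kappa> x * cnj (P x)" if "x \<in> V0" for x using P0[OF that] by (simp add: \<kappa>_def)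
  \<comment> \<open>The Jacobians of \<open>Z\<close> and of \<open>zinv\<close> differ by a nonzero factor that contains \<open>1 - \<bar>\<sigma>\<bar>\<^sup>2\<close>.\<close>
  have \<kappa>1: "norm (\<kappa> x) \<noteq> 1" if "x \<in> V0" for x
  proof
    let ?w = "g x"
    assume "norm (\<kappa> x) = 1"
    then have "norm (Q x) = norm (P x)" using Q\<kappa>[OF that] by (simp add: norm_mult)
    moreover have "P x = cnj (\<alpha> ?w) * (p ?w - q ?w * cnj (\<sigma> ?w)) / J ?w" "Q x = - \<alpha> ?w * (p ?w * \<sigma> ?w - q ?w) / J ?w"
      by (simp_all add: P_def Q_def algebra_simps)
    ultimately have "norm (p ?w - q ?w * cnj (\<sigma> ?w)) = norm (p ?w * \<sigma> ?w - q ?w)"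
      using \<alpha>0[OF gU0[OF that]] J0[OF gU0[OF that]] by (simp add: norm_mult norm_divide)
    then have "(1 - (norm (\<sigma> ?w))\<^sup>2) * ((norm (p ?w))\<^sup>2 - (norm (q ?w))\<^sup>2) = 0"
      using norm_reflection_identity[of "p ?w" "q ?w" "\<sigma> ?w"] by simp
    moreover have "(norm (\<sigma> ?w))\<^sup>2 < 1" using s1[OF gD[OF that]] by (simp add: abs_square_less_1)
    ultimately show False using pq[OF gD[OF that]] by simp
  qed
  have cg: "continuous_on V0 g" using hom1 by (simp add: homeomorphism_def)
  have cs: "continuous_on V0 (\<lambda>x. p (g x))" "continuous_on V0 (\<lambda>x. q (g x))"
      "continuous_on V0 (\<lambda>x. \<sigma> (g x))" "continuous_on V0 (\<lambda>x. \<alpha> (g x))"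
    using gD gU0 by (auto intro!: continuous_on_compose2[OF cpq(1) cg] continuous_on_compose2[OF cpq(2) cg]
        continuous_on_compose2[OF c\<sigma> cg] continuous_on_compose2[OF c\<alpha> cg])
  have cJg: "continuous_on V0 (\<lambda>x. J (g x))" unfolding J_def by (intro continuous_intros cs)
  have cP: "continuous_on V0 P" and cQ: "continuous_on V0 Q"
    unfolding P_def Q_def using J0 gU0 by (auto intro!: continuous_intros cs cJg)
  have c\<kappa>: "continuous_on V0 \<kappa>" unfolding \<kappa>_def using P0 by (auto intro!: continuous_intros cP cQ)
  have x0: "chi w0 \<in> V0" using hom1 U1(3) by (auto simp: homeomorphism_def)
  have dZ': "(Z has_derivative (\<lambda>k. P x * k + \<kappa> x * cnj (P x) * cnj k)) (at x)" if "x \<in> V0" for x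
    using dZ[OF that] unfolding Q\<kappa>[OF that] .
  obtain V s f where V: "open V" "chi w0 \<in> V" "V \<subseteq> V0" and cs': "continuous_on V s" and f: "f analytic_on V"
    and Zrep: "\<And>x. x \<in> V \<Longrightarrow> Z x = (exp (s x) * f x + \<kappa> x * cnj (f x * exp (s x))) / of_real (1 - (norm (\<kappa> x))\<^sup>2)"
    using similarity_representation[OF V0 x0 dZ' P0 c\<kappa> \<kappa>1] by blast
  define U where "U = U1 \<inter> chi -` V"
  have cchi: "continuous_on U1 chi" using hom1 by (simp add: homeomorphism_def)
  have oU: "open U" unfolding U_def by (rule continuous_open_preimage[OF cchi U1(1) V(1)])
  have w0U: "w0 \<in> U" using U1(3) V(2) by (simp add: U_def)
  have UU0: "U \<subseteq> U0" and UD: "U \<subseteq> D" using U1(2) U0(3) by (auto simp: U_def)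
  have "chi ` U = V"
  proof
    show "V \<subseteq> chi ` U"
    proof
      fix x assume "x \<in> V"
      then have "g x \<in> U" "x = chi (g x)" using gU1[of x] V(3) by (auto simp: U_def)
      then show "x \<in> chi ` U" by blast
    qed
  qed (auto simp: U_def)
  then have homU: "homeomorphism U V chi g"
    by (intro homeomorphism_of_subsets[OF hom1 _ V(3)]) (auto simp: U_def)
  have gchi: "g (chi w) = w" if "w \<in> U" for w using homU that by (simp add: homeomorphism_def)
  have chiV: "chi w \<in> V" if "w \<in> U" for w using that by (simp add: U_def)
  have dchiU: "(chi has_derivative (\<lambda>u. \<alpha> w * u + \<sigma> w * \<alpha> w * cnj u)) (at w)" if "w \<in> U" for w
    using dchi that UU0 by blast
  have dZV: "(Z has_derivative (\<lambda>k. P x * k + \<kappa> x * cnj (P x) * cnj k)) (at x)" if "x \<in> V" for x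
    using dZ' that V(3) by blast
  note wchi = wirtinger_eq[OF dchiU] and wZ = wirtinger_eq[OF dZV]
  have ckchi: "Ck_on 1 U chi"
    unfolding One_nat_def
    by (rule Ck_on_SucI[OF oU dchiU])
       (use continuous_on_subset[OF c\<alpha> UU0] continuous_on_subset[OF c\<sigma>\<alpha> UU0] in \<open>auto intro!: continuous_intros\<close>)
  have ckZ: "Ck_on 1 V Z"
    unfolding One_nat_def
    by (rule Ck_on_SucI[OF V(1) dZV])
       (use continuous_on_subset[OF cP V(3)] continuous_on_subset[OF c\<kappa> V(3)] in \<open>auto intro!: continuous_intros\<close>)
  \<comment> \<open>Conversely \<open>p\<close> and \<open>q\<close> in terms of \<open>Z\<close> and \<open>\<chi>\<close>, by differentiation of \<open>zinv = Z \<circ> \<chi>\<close>; inserted into the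
    derivatives of \<open>\<phi> \<circ> zinv\<close> they give the asserted formulas.\<close>
  have pform: "p w = P (chi w) * \<alpha> w + \<kappa> (chi w) * cnj (P (chi w)) * cnj (\<sigma> w * \<alpha> w)" (is "_ = ?p")
    and qform: "q w = P (chi w) * (\<sigma> w * \<alpha> w) + \<kappa> (chi w) * cnj (P (chi w)) * cnj (\<alpha> w)" (is "_ = ?q")
    if w: "w \<in> U" for w
  proof -
    have "((\<lambda>w. Z (chi w)) has_derivative (\<lambda>u. P (chi w) * (\<alpha> w * u + \<sigma> w * \<alpha> w * cnj u)
       + \<kappa> (chi w) * cnj (P (chi w)) * cnj (\<alpha> w * u + \<sigma> w * \<alpha> w * cnj u))) (at w)"
      by (rule has_derivative_compose[OF dchiU[OF w] dZV[OF chiV[OF w]]])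
    then have "(zinv has_derivative (\<lambda>u. P (chi w) * (\<alpha> w * u + \<sigma> w * \<alpha> w * cnj u)
       + \<kappa> (chi w) * cnj (P (chi w)) * cnj (\<alpha> w * u + \<sigma> w * \<alpha> w * cnj u))) (at w)"
      by (rule has_derivative_transform_within_open[OF _ oU w]) (simp add: Z_def gchi)
    then have "(zinv has_derivative (\<lambda>u. ?p * u + ?q * cnj u)) (at w)"
      by (rule has_derivative_eq_rhs) (simp add: fun_eq_iff algebra_simps)
    from wirtinger_eq[OF this] show "p w = ?p" "q w = ?q" by (simp_all only: p_def q_def)
  qed
  have formulas: "wd (\<lambda>w. \<phi> (zinv w)) w =
           complex_of_real (n (Z (chi w))) / (2 * w) *
             ((1 + w\<^sup>2 * cnj (\<kappa> (chi w))) * wd Z (chi w) * wd chi w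
              + cnj (\<sigma> w) * (\<kappa> (chi w) + w\<^sup>2) * cnj (wd Z (chi w) * wd chi w)) \<and>
         wdbar (\<lambda>w. \<phi> (zinv w)) w =
           complex_of_real (n (Z (chi w))) / (2 * w) *
             (\<sigma> w * (1 + w\<^sup>2 * cnj (\<kappa> (chi w))) * wd Z (chi w) * wd chi w
              + (\<kappa> (chi w) + w\<^sup>2) * cnj (wd Z (chi w) * wd chi w))" if w: "w \<in> U" for w
  proof -
    have wD: "w \<in> D" using w UD by auto
    have "Ck_on 1 \<Omega> \<phi>" using assms(4) unfolding smooth_on_def by blast
    then have d\<phi>: "(\<phi> has_derivative (\<lambda>u. wd \<phi> (zinv w) * u + wdbar \<phi> (zinv w) * cnj u)) (at (zinv w))"
      using zinv\<Omega>[OF wD] by (intro wirtinger_has_derivative) simp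
    have "((\<lambda>w. \<phi> (zinv w)) has_derivative (\<lambda>u. (wd \<phi> (zinv w) * p w + wdbar \<phi> (zinv w) * cnj (q w)) * u
        + (wd \<phi> (zinv w) * q w + wdbar \<phi> (zinv w) * cnj (p w)) * cnj u)) (at w)"
      by (rule has_derivative_eq_rhs[OF has_derivative_compose[OF dz[OF wD] d\<phi>]]) (simp add: fun_eq_iff algebra_simps)
    note wphi = wirtinger_eq[OF this]
    have h: "wd \<phi> (zinv w) = of_real (n (zinv w)) / (2 * w)" "wdbar \<phi> (zinv w) = of_real (n (zinv w)) / (2 * w) * w\<^sup>2"
      using hodo(1,2)[of w] wD wn0[OF wD] by (simp_all add: power2_eq_square)
    have Zc: "Z (chi w) = zinv w" by (simp add: Z_def gchi[OF w])
    show ?thesis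
      unfolding wphi h wchi[OF w] wZ[OF chiV[OF w]] Zc pform[OF w] qform[OF w]
      by (simp add: algebra_simps)
  qed
  show "\<exists>U V (chi :: complex \<Rightarrow> complex) chi_inv
      (\<kappa> :: complex \<Rightarrow> complex) (s :: complex \<Rightarrow> complex) (f :: complex \<Rightarrow> complex)
      (\<Phi> :: complex \<Rightarrow> complex \<Rightarrow> complex) (Z :: complex \<Rightarrow> complex).
      open U \<and> w0 \<in> U \<and> U \<subseteq> D \<and> open V \<and>
      homeomorphism U V chi chi_inv \<and> Ck_on 1 U chi \<and>
      (\<forall>w\<in>U. wdbar chi w = \<sigma> w * wd chi w) \<and>
      continuous_on V \<kappa> \<and> (\<forall>x\<in>V. cmod (\<kappa> x) \<noteq> 1) \<and>
      continuous_on V s \<and> f analytic_on V \<and>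
      (\<forall>x\<in>V. Z x = (exp (s x) * f x + \<kappa> x * cnj (f x * exp (s x)))
                    / complex_of_real (1 - (cmod (\<kappa> x))\<^sup>2)) \<and>
      Ck_on 1 V Z \<and>
      (\<forall>x\<in>V. wdbar Z x = \<kappa> x * cnj (wd Z x)) \<and>
      (\<forall>w\<in>U. zinv w = Z (chi w) \<and> \<phi> (zinv w) = \<Phi> w (chi w)) \<and>
      (\<forall>w\<in>U.
         wd (\<lambda>w. \<phi> (zinv w)) w =
           complex_of_real (n (Z (chi w))) / (2 * w) *
             ((1 + w\<^sup>2 * cnj (\<kappa> (chi w))) * wd Z (chi w) * wd chi w
              + cnj (\<sigma> w) * (\<kappa> (chi w) + w\<^sup>2) * cnj (wd Z (chi w) * wd chi w)) \<and>
         wdbar (\<lambda>w. \<phi> (zinv w)) w =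
           complex_of_real (n (Z (chi w))) / (2 * w) *
             (\<sigma> w * (1 + w\<^sup>2 * cnj (\<kappa> (chi w))) * wd Z (chi w) * wd chi w
              + (\<kappa> (chi w) + w\<^sup>2) * cnj (wd Z (chi w) * wd chi w)))"
  proof (rule exI[of _ U], rule exI[of _ V], rule exI[of _ chi], rule exI[of _ g], rule exI[of _ \<kappa>],
      rule exI[of _ s], rule exI[of _ f], rule exI[of _ "\<lambda>w x. \<phi> (zinv w)"], rule exI[of _ Z],
      intro conjI ballI)
    show "cmod (\<kappa> x) \<noteq> 1" if "x \<in> V" for x using \<kappa>1 that V(3) by blast
    show "continuous_on V \<kappa>" by (rule continuous_on_subset[OF c\<kappa> V(3)])
    show "zinv w = Z (chi w)" if "w \<in> U" for w by (simp add: Z_def gchi[OF that])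
  qed (use oU w0U UD V(1) homU ckchi cs' f Zrep ckZ wchi wZ formulas in \<open>simp_all\<close>)
qed

end
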